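(* Let $K$ be a countable fine hyperbolic graph and let $\Gamma$ be a (discrete) group acting on $K$ by graph automorphisms with finite quotient. If the vertex stabilizer $\Gamma^x=\{s\in\Gamma: sx=x\}$ is exact for every vertex $x$ of $K$, then $\Gamma$ is exact.
   Context: Graphs: $K$ is a connected graph with vertex set $V(K)$ and edge set $E(K)$, without loops or multiple edges, and $d$ is the path metric on $V(K)$. A finite path of length $n$ is a sequence $x_0x_1\cdots x_n$ of vertices with each $x_i$ equal or adjacent to $x_{i+1}$. A circuit is a closed path ($x_0=x_n$) with $x_0,\dots,x_{n-1}$ distinct. A path $\alpha$ is geodesic if $d(\alpha(m),\alpha(n))=|m-n|$ for all $m,n$. The Gromov product is $\langle x,y\rangle_z=\frac12(d(x,z)+d(y,z)-d(x,y))$. $K$ is hyperbolic if there is $\delta>0$ such that for any finite geodesic paths $\alpha$ and $\beta$ starting at a common vertex $z$ and ending at $\alpha_+$ and $\beta_+$, and any $k\le\langle\alpha_+,\beta_+\rangle_z$, one has $d(\alpha(k),\beta(k))<\delta$. $K$ is fine if for every $n$ and every edge $e\in E(K)$, the set of circuits of length at most $n$ containing $e$ is finite. The action of $\Gamma$ on $K$ has finite quotient if there are finitely many orbits of vertices and of edges. Exactness: for a discrete group $G$, $\mathrm{Prob}(G)=\{\mu\in\ell_1(G):\mu\ge0,\ \sum_{s}\mu(s)=1\}$ with the pointwise convergence topology (which coincides with the $\ell_1$-norm topology), and $(s\cdot\mu)(t)=\mu(s^{-1}t)$. An action of $G$ by homeomorphisms on a compact Hausdorff space $\Omega$ is amenable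 if for every finite $E\subset G$ and $\varepsilon>0$ there is a continuous map $\mu\colon\Omega\to\mathrm{Prob}(G)$, $\omega\mapsto\mu_\omega$, with $\max_{s\in E}\sup_{\omega\in\Omega}\|s\cdot\mu_\omega-\mu_{s\omega}\|_1\le\varepsilon$. The group $G$ is exact if it acts amenably on some (nonempty) compact Hausdorff space. *)

theory Defs
  imports "HOL-Analysis.Analysis" "HOL-Algebra.Group_Action"
begin

section \<open>Graphs\<close>

text \<open>A graph is given by a vertex set \<open>V\<close> and a set \<open>E\<close> of two-element subsets of \<open>V\<close>.
  A path \<open>x\<^sub>0 x\<^sub>1 \<dots> x\<^sub>n\<close> is the list of its \<open>n + 1\<close> vertices; consecutive vertices may coincide.\<close>

definition simple_graph :: "'v set \<Rightarrow> 'v set set \<Rightarrow> bool" where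
  "simple_graph V E \<longleftrightarrow> (\<forall>e\<in>E. \<exists>u\<in>V. \<exists>v\<in>V. u \<noteq> v \<and> e = {u, v})"

definition graph_path :: "'v set \<Rightarrow> 'v set set \<Rightarrow> 'v list \<Rightarrow> bool" where
  "graph_path V E xs \<longleftrightarrow>
     xs \<noteq> [] \<and> set xs \<subseteq> V \<and> successively (\<lambda>x y. x = y \<or> {x, y} \<in> E) xs"

definition path_length :: "'v list \<Rightarrow> nat" where
  "path_length xs = length xs - 1"

definition path_between :: "'v set \<Rightarrow> 'v set set \<Rightarrow> 'v \<Rightarrow> 'v \<Rightarrow> 'v list \<Rightarrow> bool" where
  "path_between V E x y xs \<longleftrightarrow> graph_path V E xs \<and> hd xs = x \<and> last xs = y"

text \<open>As usual, the empty graph does not count as connected.\<close>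

definition connected_graph :: "'v set \<Rightarrow> 'v set set \<Rightarrow> bool" where
  "connected_graph V E \<longleftrightarrow>
     simple_graph V E \<and> V \<noteq> {} \<and> (\<forall>x\<in>V. \<forall>y\<in>V. \<exists>xs. path_between V E x y xs)"

definition graph_dist :: "'v set \<Rightarrow> 'v set set \<Rightarrow> 'v \<Rightarrow> 'v \<Rightarrow> nat" where
  "graph_dist V E x y = (LEAST n. \<exists>xs. path_between V E x y xs \<and> path_length xs = n)"

definition circuit :: "'v set \<Rightarrow> 'v set set \<Rightarrow> 'v list \<Rightarrow> bool" where
  "circuit V E xs \<longleftrightarrow> graph_path V E xs \<and> hd xs = last xs \<and> distinct (butlast xs)"

definition path_contains_edge :: "'v list \<Rightarrow> 'v set \<Rightarrow> bool" where
  "path_contains_edge xs e \<longleftrightarrow> (\<exists>i. Suc i < length xs \<and> {xs ! i, xs ! Suc i} = e)"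

definition fine_graph :: "'v set \<Rightarrow> 'v set set \<Rightarrow> bool" where
  "fine_graph V E \<longleftrightarrow>
     (\<forall>n. \<forall>e\<in>E. finite {xs. circuit V E xs \<and> path_length xs \<le> n \<and> path_contains_edge xs e})"

definition geodesic_path :: "'v set \<Rightarrow> 'v set set \<Rightarrow> 'v list \<Rightarrow> bool" where
  "geodesic_path V E xs \<longleftrightarrow> graph_path V E xs \<and>
     (\<forall>m < length xs. \<forall>n < length xs.
        int (graph_dist V E (xs ! m) (xs ! n)) = \<bar>int m - int n\<bar>)"

definition gromov_product :: "'v set \<Rightarrow> 'v set set \<Rightarrow> 'v \<Rightarrow> 'v \<Rightarrow> 'v \<Rightarrow> real" where
  "gromov_product V E x y z =
     (real (graph_dist V E x z) + real (graph_dist V E y z) - real (graph_dist V E x y)) / 2"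

text \<open>The bound on \<open>k\<close> keeps the indices in range: the Gromov product of the end points is at
  most the length of either geodesic.\<close>

definition hyperbolic_graph :: "'v set \<Rightarrow> 'v set set \<Rightarrow> bool" where
  "hyperbolic_graph V E \<longleftrightarrow>
     (\<exists>\<delta>::real. \<delta> > 0 \<and>
        (\<forall>z \<alpha> \<beta>. \<forall>k::nat.
           geodesic_path V E \<alpha> \<and> geodesic_path V E \<beta> \<and> hd \<alpha> = z \<and> hd \<beta> = z \<and>
           real k \<le> gromov_product V E (last \<alpha>) (last \<beta>) z \<longrightarrow>
           real (graph_dist V E (\<alpha> ! k) (\<beta> ! k)) < \<delta>))"

section \<open>Group actions on graphs\<close>

definition graph_action ::
  "('g, 'm) monoid_scheme \<Rightarrow> 'v set \<Rightarrow> 'v set set \<Rightarrow> ('g \<Rightarrow> 'v \<Rightarrow> 'v) \<Rightarrow> bool" where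
  "graph_action G V E \<phi> \<longleftrightarrow> group_action G V \<phi> \<and>
     (\<forall>g\<in>carrier G. \<forall>u\<in>V. \<forall>v\<in>V. {\<phi> g u, \<phi> g v} \<in> E \<longleftrightarrow> {u, v} \<in> E)"

definition finite_quotient ::
  "('g, 'm) monoid_scheme \<Rightarrow> 'v set \<Rightarrow> 'v set set \<Rightarrow> ('g \<Rightarrow> 'v \<Rightarrow> 'v) \<Rightarrow> bool" where
  "finite_quotient G V E \<phi> \<longleftrightarrow>
     finite (orbits G V \<phi>) \<and> finite (orbits G E (\<lambda>g e. \<phi> g ` e))"

abbreviation stabilizer_group ::
  "('g, 'm) monoid_scheme \<Rightarrow> ('g \<Rightarrow> 'v \<Rightarrow> 'v) \<Rightarrow> 'v \<Rightarrow> ('g, 'm) monoid_scheme" where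
  "stabilizer_group G \<phi> x \<equiv> G\<lparr>carrier := stabilizer G \<phi> x\<rparr>"

section \<open>Amenable actions and exact groups\<close>

definition prob_on :: "('g, 'm) monoid_scheme \<Rightarrow> ('g \<Rightarrow> real) set" where
  "prob_on G = {\<mu> \<in> extensional (carrier G).
     (\<forall>s\<in>carrier G. 0 \<le> \<mu> s) \<and> (\<mu> has_sum 1) (carrier G)}"

definition prob_topology :: "('g, 'm) monoid_scheme \<Rightarrow> ('g \<Rightarrow> real) topology" where
  "prob_topology G = subtopology (powertop_real (carrier G)) (prob_on G)"

definition translate :: "('g, 'm) monoid_scheme \<Rightarrow> 'g \<Rightarrow> ('g \<Rightarrow> real) \<Rightarrow> 'g \<Rightarrow> real" where
  "translate G s \<mu> = (\<lambda>t\<in>carrier G. \<mu> (inv\<^bsub>G\<^esub> s \<otimes>\<^bsub>G\<^esub> t))"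

definition l1_dist :: "('g, 'm) monoid_scheme \<Rightarrow> ('g \<Rightarrow> real) \<Rightarrow> ('g \<Rightarrow> real) \<Rightarrow> real" where
  "l1_dist G \<mu> \<nu> = (\<Sum>\<^sub>\<infinity>t\<in>carrier G. \<bar>\<mu> t - \<nu> t\<bar>)"

definition amenable_action ::
  "('g, 'm) monoid_scheme \<Rightarrow> 'o topology \<Rightarrow> ('g \<Rightarrow> 'o \<Rightarrow> 'o) \<Rightarrow> bool" where
  "amenable_action G X a \<longleftrightarrow>
     compact_space X \<and> Hausdorff_space X \<and>
     group_action G (topspace X) a \<and> (\<forall>g\<in>carrier G. homeomorphic_map X X (a g)) \<and>
     (\<forall>F \<epsilon>. finite F \<and> F \<subseteq> carrier G \<and> (\<epsilon>::real) > 0 \<longrightarrow>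
        (\<exists>\<mu>. continuous_map X (prob_topology G) \<mu> \<and>
             (\<forall>s\<in>F. \<forall>\<omega>\<in>topspace X. l1_dist G (translate G s (\<mu> \<omega>)) (\<mu> (a s \<omega>)) \<le> \<epsilon>)))"

text \<open>A definition cannot quantify over all types, so the space is taken inside the fixed type
  \<open>'g set set\<close>. This is no restriction: by \<open>exact_groupI\<close> below, an amenable action on a nonempty
  compact Hausdorff space of any type suffices, because the closure of an orbit embeds into
  \<open>'g set set\<close>.\<close>

definition exact_group :: "('g, 'm) monoid_scheme \<Rightarrow> bool" where
  "exact_group G \<longleftrightarrow>
     (\<exists>(X :: 'g set set topology) a. topspace X \<noteq> {} \<and> amenable_action G X a)"

lemma exact_groupI:
  fixes G :: "('g, 'm) monoid_scheme" and X :: "'o topology"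
  assumes ne: "topspace X \<noteq> {}" and am: "amenable_action G X a"
  shows "exact_group G"
proof -
  have cX: "compact_space X" and hX: "Hausdorff_space X"
    and ga: "group_action G (topspace X) a"
    and hom: "\<And>g. g \<in> carrier G \<Longrightarrow> homeomorphic_map X X (a g)"
    using am by (auto simp: amenable_action_def)
  interpret A: group_action G "topspace X" a by (rule ga)
  interpret H: group_hom G "BijGroup (topspace X)" a by (rule A.group_hom)
  obtain w0 where w0: "w0 \<in> topspace X" using ne by blast
  define p where "p = (\<lambda>g. a g w0)"
  define C where "C = X closure_of (p ` carrier G)"
  define f where "f w = {B. B \<subseteq> carrier G \<and> w \<in> X closure_of (p ` B)}" for w
  have p_in: "p ` B \<subseteq> topspace X" if "B \<subseteq> carrier G" for B
    using that w0 A.element_image unfolding p_def by blast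
  have CX: "C \<subseteq> topspace X" unfolding C_def by (rule closure_of_subset_topspace)
  have C_ne: "C \<noteq> {}"
  proof -
    have "p ` carrier G \<subseteq> C" unfolding C_def by (rule closure_of_subset) (use p_in in auto)
    then show ?thesis using H.G.one_closed by blast
  qed
  have inj: "inj_on f C"
  proof (rule inj_onI, rule ccontr)
    fix w w' assume w: "w \<in> C" "w' \<in> C" and eq: "f w = f w'" and neq: "w \<noteq> w'"
    have "w \<in> topspace X" "w' \<in> topspace X" using w CX by auto
    then have "\<exists>U U'. openin X U \<and> openin X U' \<and> w \<in> U \<and> w' \<in> U' \<and> disjnt U U'"
      using hX neq unfolding Hausdorff_space_def by simp
    then obtain U U' where
      U: "openin X U" "openin X U'" "w \<in> U" "w' \<in> U'" "disjnt U U'" by auto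
    define B where "B = {g \<in> carrier G. p g \<in> U}"
    have "w \<in> X closure_of (p ` B)"
    proof -
      have "w \<in> topspace X" using w CX by blast
      moreover have "\<exists>y\<in>p ` B. y \<in> T" if T: "w \<in> T" "openin X T" for T
      proof -
        have "openin X (T \<inter> U)" "w \<in> T \<inter> U" using T U by auto
        then have "\<exists>y\<in>p ` carrier G. y \<in> T \<inter> U"
          using w(1) unfolding C_def in_closure_of by blast
        then show ?thesis unfolding B_def by blast
      qed
      ultimately show ?thesis unfolding in_closure_of by blast
    qed
    then have "B \<in> f w" unfolding f_def B_def by auto
    then have "w' \<in> X closure_of (p ` B)" using eq unfolding f_def by auto
    then have "\<exists>y\<in>p ` B. y \<in> U'" using U unfolding in_closure_of by blast
    then show False using U(5) unfolding B_def disjnt_def by blast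
  qed
  have aC: "a g ` C = C" if g: "g \<in> carrier G" for g
  proof -
    have "a g ` (p ` carrier G) = p ` carrier G"
    proof
      show "a g ` (p ` carrier G) \<subseteq> p ` carrier G"
      proof
        fix y assume "y \<in> a g ` (p ` carrier G)"
        then obtain k where k: "k \<in> carrier G" "y = a g (p k)" by blast
        then have "y = p (g \<otimes>\<^bsub>G\<^esub> k)" using g w0 by (simp add: p_def A.composition_rule del: H.hom_mult)
        then show "y \<in> p ` carrier G" using g k by auto
      qed
      show "p ` carrier G \<subseteq> a g ` (p ` carrier G)"
      proof
        fix y assume "y \<in> p ` carrier G"
        then obtain k where k: "k \<in> carrier G" "y = p k" by blast
        have "a g (p (inv\<^bsub>G\<^esub> g \<otimes>\<^bsub>G\<^esub> k)) = a (g \<otimes>\<^bsub>G\<^esub> (inv\<^bsub>G\<^esub> g \<otimes>\<^bsub>G\<^esub> k)) w0"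
          unfolding p_def using g k w0 by (simp add: A.composition_rule del: H.hom_mult)
        also have "\<dots> = y" using g k by (simp add: p_def flip: H.G.m_assoc)
        finally have "y = a g (p (inv\<^bsub>G\<^esub> g \<otimes>\<^bsub>G\<^esub> k))" by simp
        moreover have "inv\<^bsub>G\<^esub> g \<otimes>\<^bsub>G\<^esub> k \<in> carrier G" using g k by simp
        ultimately show "y \<in> a g ` (p ` carrier G)" by blast
      qed
    qed
    then show ?thesis
      using homeomorphic_map_closure_of[OF hom[OF g] p_in[of "carrier G"]] by (simp add: C_def)
  qed
  define h where "h = inv_into C f"
  have hf: "h (f w) = w" if "w \<in> C" for w using that inj by (simp add: h_def)
  have hC: "h y \<in> C" if "y \<in> f ` C" for y
    using that unfolding h_def by (rule inv_into_into)
  have fh: "f (h y) = y" if "y \<in> f ` C" for y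
    using that unfolding h_def by (rule f_inv_into_f)
  define XC where "XC = subtopology X C"
  define Y where "Y = pullback_topology (f ` C) h XC"
  have tXC: "topspace XC = C" unfolding XC_def using CX by auto
  have tY: "topspace Y = f ` C"
    unfolding Y_def topspace_pullback_topology tXC using hC by auto
  have ch: "continuous_map Y XC h"
    unfolding Y_def using continuous_map_pullback[OF continuous_map_id] by (simp add: id_def o_def)
  have cf: "continuous_map XC Y f"
    unfolding Y_def
  proof (rule continuous_map_pullback')
    show "continuous_map XC XC (h \<circ> f)"
      by (rule continuous_map_eq[OF continuous_map_id]) (simp add: tXC hf)
  qed (auto simp: tXC)
  have hmaps: "homeomorphic_maps XC Y f h"
    unfolding homeomorphic_maps_def using ch cf by (auto simp: tXC tY hf fh)
  have hs: "XC homeomorphic_space Y" using hmaps by (auto simp: homeomorphic_space_def)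
  have cY: "compact_space Y"
  proof -
    have "compact_space XC"
      unfolding XC_def C_def
      by (simp add: cX closedin_compact_space compact_space_subtopology)
    then show ?thesis using homeomorphic_compact_space[OF hs] by blast
  qed
  have hY: "Hausdorff_space Y"
    using homeomorphic_Hausdorff_space[OF hs] Hausdorff_space_subtopology[OF hX, of C]
    by (simp add: XC_def)
  define b where "b g = (\<lambda>y\<in>f ` C. f (a g (h y)))" for g
  have haC: "a g (h y) \<in> C" if "g \<in> carrier G" "y \<in> f ` C" for g y
    using aC that hC by blast
  have bB: "b g \<in> Bij (f ` C)" if g: "g \<in> carrier G" for g
  proof -
    have "bij_betw (\<lambda>y. f (a g (h y))) (f ` C) (f ` C)"
      unfolding bij_betw_def
    proof
      show "inj_on (\<lambda>y. f (a g (h y))) (f ` C)"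
      proof (rule inj_onI)
        fix y y' assume y: "y \<in> f ` C" "y' \<in> f ` C" "f (a g (h y)) = f (a g (h y'))"
        then have "a g (h y) = a g (h y')" using inj haC[OF g] by (auto dest: inj_onD)
        then have "h y = h y'"
          using A.inj_prop[OF g] hC[OF y(1)] hC[OF y(2)] CX by (meson inj_onD subsetD)
        then show "y = y'" using fh y by metis
      qed
      have "h ` f ` C = C" using hf by force
      then show "(\<lambda>y. f (a g (h y))) ` f ` C = f ` C"
        using aC[OF g] by (metis (no_types, lifting) image_cong image_image)
    qed
    then have "bij_betw (b g) (f ` C) (f ` C)"
      by (subst bij_betw_cong[where g = "\<lambda>y. f (a g (h y))"]) (auto simp: b_def)
    then show ?thesis by (auto simp: Bij_def b_def)
  qed
  have gb: "group_action G (topspace Y) b"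
  proof -
    have "b \<in> hom G (BijGroup (f ` C))"
    proof (rule homI)
      fix g assume "g \<in> carrier G" then show "b g \<in> carrier (BijGroup (f ` C))"
        using bB by (simp add: BijGroup_def)
    next
      fix g k assume gk: "g \<in> carrier G" "k \<in> carrier G"
      have "b (g \<otimes>\<^bsub>G\<^esub> k) = compose (f ` C) (b g) (b k)"
      proof
        fix y show "b (g \<otimes>\<^bsub>G\<^esub> k) y = compose (f ` C) (b g) (b k) y"
        proof (cases "y \<in> f ` C")
          case True
          then have "h y \<in> topspace X" using hC CX by blast
          then show ?thesis
            using True gk haC[OF gk(2) True] by (simp add: b_def compose_def hf A.composition_rule del: H.hom_mult)
        qed (simp add: b_def compose_def)
      qed
      then show "b (g \<otimes>\<^bsub>G\<^esub> k) = b g \<otimes>\<^bsub>BijGroup (f ` C)\<^esub> b k"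
        using bB gk by (simp add: BijGroup_def)
    qed
    then show ?thesis
      unfolding group_action_def tY
      by (simp add: group_hom_def group_hom_axioms_def group_BijGroup H.G.is_group)
  qed
  have hb: "homeomorphic_map Y Y (b g)" if g: "g \<in> carrier G" for g
  proof -
    have "homeomorphic_map XC XC (a g)"
      unfolding XC_def
      using homeomorphic_map_subtopologies[OF hom[OF g], of C C] aC[OF g] CX
      by (simp add: Int_absorb1)
    moreover have "homeomorphic_map XC Y f" "homeomorphic_map Y XC h"
      using hmaps homeomorphic_maps_map by blast+
    ultimately have "homeomorphic_map Y Y (f \<circ> (a g \<circ> h))"
      by (meson homeomorphic_map_compose)
    then show ?thesis
      by (rule homeomorphic_map_eq) (simp add: tY b_def)
  qed
  have approx: "\<exists>\<mu>. continuous_map Y (prob_topology G) \<mu> \<and>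
      (\<forall>s\<in>F. \<forall>\<omega>\<in>topspace Y. l1_dist G (translate G s (\<mu> \<omega>)) (\<mu> (b s \<omega>)) \<le> \<epsilon>)"
    if F: "finite F \<and> F \<subseteq> carrier G \<and> (\<epsilon>::real) > 0" for F \<epsilon>
  proof -
    obtain \<mu> where \<mu>: "continuous_map X (prob_topology G) \<mu>"
      "\<forall>s\<in>F. \<forall>\<omega>\<in>topspace X. l1_dist G (translate G s (\<mu> \<omega>)) (\<mu> (a s \<omega>)) \<le> \<epsilon>"
      using am F unfolding amenable_action_def by blast
    have "continuous_map Y (prob_topology G) (\<mu> \<circ> h)"
      using ch \<mu>(1) unfolding XC_def
      by (meson continuous_map_compose continuous_map_from_subtopology)
    moreover have "l1_dist G (translate G s ((\<mu> \<circ> h) \<omega>)) ((\<mu> \<circ> h) (b s \<omega>)) \<le> \<epsilon>"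
      if "s \<in> F" "\<omega> \<in> topspace Y" for s \<omega>
    proof -
      have "s \<in> carrier G" "\<omega> \<in> f ` C" using that F tY by auto
      then show ?thesis using \<mu>(2) that(1) haC[of s \<omega>] hC[of \<omega>] CX by (auto simp: b_def hf)
    qed
    ultimately show ?thesis by blast
  qed
  have "amenable_action G Y b"
    unfolding amenable_action_def
    by (intro conjI ballI allI impI cY hY gb hb approx) simp_all
  moreover have "topspace Y \<noteq> {}" using C_ne tY by simp
  ultimately show ?thesis unfolding exact_group_def by blast
qed

end

theory Submission
  imports Defs
begin

text \<open>Exactness is replaced by property A: there are finitely supported probability measures
  \<open>\<kappa> g\<close> on \<open>g S\<close>, with \<open>S\<close> finite, such that \<open>\<kappa> g\<close> and \<open>\<kappa> (g f)\<close> are uniformly close for \<open>f\<close>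
  in a given finite set. An amenable action gives such measures by evaluating along an orbit, tightness
  being a consequence of compactness; conversely, the space of all solutions of these inequalities is
  compact by Tychonoff's theorem and the group acts on it by shifting the variable \<open>g\<close>.

  Property A makes sense for subsets of the group, and it passes from the pieces of a partition of unity
  with small variation to the whole set. Fix a base vertex \<open>b\<close>.
  First, the set of group elements which move an orbit representative into the ball of radius \<open>n\<close> about
  \<open>b\<close> has property A, by induction on \<open>n\<close>: the cosets of stabilizers that belong to different vertices
  of the sphere of radius \<open>n + 1\<close> are far from each other outside a neighbourhood of the set for
  \<open>n\<close>, because by fineness only finitely many circuits of a given length pass through a given edge.
  Second, hyperbolicity and fineness bound the number of points at a given level on geodesics from \<open>b\<close>
  to the points near \<open>x\<close>; averaging uniform measures on these sets gives measures \<open>\<eta> x\<close> on the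
  vertices, supported at bounded distance from \<open>x\<close>, that vary slowly with \<open>x\<close>. Pulled back along
  the orbit map of \<open>b\<close>, they form a partition of unity of the group whose pieces are translates of
  subsets of the first kind.\<close>

section \<open>Finitely supported functions\<close>

text \<open>The obstacle is that the graph need not be locally finite: balls and vertex stabilizers
  may be infinite, so a slowly varying measure on the vertices cannot be turned directly into one
  supported on \<open>g <# S\<close> with \<open>S\<close> finite. It only provides weights, and
  infinitely many pieces have to share one \<open>S\<close>. This is why property A is stated for
  families of sets. Closeness of \<open>g\<close> and \<open>g \<otimes> f\<close> is invariant
  under left multiplication, so all left translates of a set share \<open>S\<close>; finitely many
  orbits then leave finitely many stabilizers and uniform constants to deal with. In the hyperbolic
  part no points at infinity are used: levels are counted from \<open>x\<close> back towards
  \<open>b\<close> and cut off at \<open>b\<close>.\<close>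

definition supp :: "('i \<Rightarrow> real) \<Rightarrow> 'i set" where
  "supp f = {i. f i \<noteq> 0}"

text \<open>A finite sum over the support, so the value is 0 if the support is infinite; this is why
  finiteness of supports accompanies the estimates below.\<close>

definition l1 :: "('i \<Rightarrow> real) \<Rightarrow> real" where
  "l1 f = (\<Sum>i\<in>supp f. \<bar>f i\<bar>)"

definition fin_prob :: "('i \<Rightarrow> real) \<Rightarrow> bool" where
  "fin_prob p \<longleftrightarrow> finite (supp p) \<and> (\<forall>i. 0 \<le> p i) \<and> (\<Sum>i\<in>supp p. p i) = 1"

lemma l1_eq: "finite A \<Longrightarrow> supp f \<subseteq> A \<Longrightarrow> l1 f = (\<Sum>i\<in>A. \<bar>f i\<bar>)"
  unfolding l1_def by (rule sum.mono_neutral_left) (auto simp: supp_def)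

lemma supp_sum_subset: "supp (\<lambda>i. \<Sum>j\<in>J. f j i) \<subseteq> (\<Union>j\<in>J. supp (f j))"
proof
  fix i assume "i \<in> supp (\<lambda>i. \<Sum>j\<in>J. f j i)"
  then have "(\<Sum>j\<in>J. f j i) \<noteq> 0" by (simp add: supp_def)
  then obtain j where "j \<in> J" "f j i \<noteq> 0" by (rule sum.not_neutral_contains_not_neutral)
  then show "i \<in> (\<Union>j\<in>J. supp (f j))" by (auto simp: supp_def)
qed

lemma supp_diff_subset: "supp (\<lambda>i. f i - g i) \<subseteq> supp f \<union> supp g"
  by (auto simp: supp_def)

lemma supp_cmult_subset: "supp (\<lambda>i. c * f i) \<subseteq> supp f"
  by (auto simp: supp_def)

lemma finite_supp_diff: "finite (supp f) \<Longrightarrow> finite (supp g) \<Longrightarrow> finite (supp (\<lambda>i. f i - g i))"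
  by (rule finite_subset[OF supp_diff_subset]) simp

lemma finite_supp_cmult: "finite (supp f) \<Longrightarrow> finite (supp (\<lambda>i. c * f i))"
  by (rule finite_subset[OF supp_cmult_subset])

lemma finite_supp_sum:
  "finite J \<Longrightarrow> (\<And>j. j \<in> J \<Longrightarrow> finite (supp (f j))) \<Longrightarrow> finite (supp (\<lambda>i. \<Sum>j\<in>J. f j i))"
  by (rule finite_subset[OF supp_sum_subset]) simp

lemma l1_cmult: assumes "finite (supp f)" shows "l1 (\<lambda>i. c * f i) = \<bar>c\<bar> * l1 f"
  unfolding l1_eq[OF assms supp_cmult_subset]
  by (simp add: l1_def abs_mult sum_distrib_left)

lemma l1_sum_le:
  assumes "finite J" "\<And>j. j \<in> J \<Longrightarrow> finite (supp (f j))"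
  shows "l1 (\<lambda>i. \<Sum>j\<in>J. f j i) \<le> (\<Sum>j\<in>J. l1 (f j))"
proof -
  define A where "A = (\<Union>j\<in>J. supp (f j))"
  have A: "finite A" "\<And>j. j \<in> J \<Longrightarrow> supp (f j) \<subseteq> A" using assms by (auto simp: A_def)
  have "l1 (\<lambda>i. \<Sum>j\<in>J. f j i) = (\<Sum>i\<in>A. \<bar>\<Sum>j\<in>J. f j i\<bar>)"
    by (rule l1_eq) (use A supp_sum_subset[of f J] in \<open>auto simp: A_def\<close>)
  also have "\<dots> \<le> (\<Sum>i\<in>A. \<Sum>j\<in>J. \<bar>f j i\<bar>)" by (intro sum_mono sum_abs)
  also have "\<dots> = (\<Sum>j\<in>J. \<Sum>i\<in>A. \<bar>f j i\<bar>)" by (rule sum.swap)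
  also have "\<dots> = (\<Sum>j\<in>J. l1 (f j))" by (intro sum.cong refl l1_eq[symmetric] A)
  finally show ?thesis .
qed

lemma l1_triangle:
  assumes "finite (supp f)" "finite (supp g)" "finite (supp h)"
  shows "l1 (\<lambda>i. f i - h i) \<le> l1 (\<lambda>i. f i - g i) + l1 (\<lambda>i. g i - h i)"
proof -
  define A where "A = supp f \<union> supp g \<union> supp h"
  have A: "finite A" using assms by (simp add: A_def)
  have *: "l1 (\<lambda>i. p i - q i) = (\<Sum>i\<in>A. \<bar>p i - q i\<bar>)" if "supp p \<union> supp q \<subseteq> A" for p q
    by (rule l1_eq[OF A]) (use that supp_diff_subset[of p q] in auto)
  have "(\<Sum>i\<in>A. \<bar>f i - h i\<bar>) \<le> (\<Sum>i\<in>A. \<bar>f i - g i\<bar> + \<bar>g i - h i\<bar>)"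
    by (rule sum_mono) auto
  moreover have "supp f \<union> supp h \<subseteq> A" "supp f \<union> supp g \<subseteq> A" "supp g \<union> supp h \<subseteq> A"
    by (auto simp: A_def)
  ultimately show ?thesis by (simp only: * sum.distrib)
qed

lemma l1_add_le:
  assumes "finite (supp f)" "finite (supp g)"
  shows "l1 (\<lambda>i. f i + g i) \<le> l1 f + l1 g"
proof -
  let ?A = "supp f \<union> supp g"
  have A: "finite ?A" using assms by simp
  have "l1 (\<lambda>i. f i + g i) = (\<Sum>i\<in>?A. \<bar>f i + g i\<bar>)"
    by (rule l1_eq[OF A]) (auto simp: supp_def)
  also have "\<dots> \<le> (\<Sum>i\<in>?A. \<bar>f i\<bar> + \<bar>g i\<bar>)" by (rule sum_mono) auto
  also have "\<dots> = l1 f + l1 g" by (simp add: sum.distrib l1_eq[OF A])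
  finally show ?thesis .
qed

lemma finite_supp_add: "finite (supp f) \<Longrightarrow> finite (supp g) \<Longrightarrow> finite (supp (\<lambda>i. f i + g i))"
  by (rule finite_subset[of _ "supp f \<union> supp g"]) (auto simp: supp_def)

lemma fin_probD:
  assumes "fin_prob p"
  shows "finite (supp p)" "0 \<le> p i"
    "finite A \<Longrightarrow> supp p \<subseteq> A \<Longrightarrow> (\<Sum>i\<in>A. p i) = 1"
proof -
  show "finite (supp p)" "0 \<le> p i" using assms by (auto simp: fin_prob_def)
  assume "finite A" "supp p \<subseteq> A"
  then have "(\<Sum>i\<in>A. p i) = (\<Sum>i\<in>supp p. p i)"
    by (intro sum.mono_neutral_right) (auto simp: supp_def)
  then show "(\<Sum>i\<in>A. p i) = 1" using assms by (simp add: fin_prob_def)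
qed

lemma fin_probI:
  assumes "finite A" "\<And>i. i \<notin> A \<Longrightarrow> p i = 0" "\<And>i. i \<in> A \<Longrightarrow> 0 \<le> p i" "(\<Sum>i\<in>A. p i) = 1"
  shows "fin_prob p"
proof -
  have s: "supp p \<subseteq> A" using assms(2) by (auto simp: supp_def)
  have "(\<Sum>i\<in>A. p i) = (\<Sum>i\<in>supp p. p i)"
    by (intro sum.mono_neutral_right) (use assms(1) s in \<open>auto simp: supp_def\<close>)
  moreover have "0 \<le> p i" for i using assms(2)[of i] assms(3)[of i] by (cases "i \<in> A") auto
  ultimately show ?thesis unfolding fin_prob_def
    using finite_subset[OF s assms(1)] assms(4) by simp
qed

lemma l1_fin_prob: "fin_prob p \<Longrightarrow> l1 p = 1"
  by (simp add: l1_def fin_prob_def)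

lemma l1_fin_prob_diff_le:
  assumes "fin_prob p" "fin_prob q" shows "l1 (\<lambda>i. p i - q i) \<le> 2"
proof -
  let ?A = "supp p \<union> supp q"
  have A: "finite ?A" using assms by (simp add: fin_probD(1))
  have "l1 (\<lambda>i. p i - q i) = (\<Sum>i\<in>?A. \<bar>p i - q i\<bar>)"
    by (rule l1_eq[OF A supp_diff_subset])
  also have "\<dots> \<le> (\<Sum>i\<in>?A. p i + q i)"
    by (intro sum_mono) (use assms fin_probD(2) in \<open>smt (verit)\<close>)
  also have "\<dots> = 2"
    using assms A by (simp add: sum.distrib fin_probD(3))
  finally show ?thesis .
qed

text \<open>Meant for left multiplications as \<open>\<pi>\<close>: measures can be moved about the
  group without change of mass or mutual distance. The functions may be signed, so differences are
  covered.\<close>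

lemma l1_reindex:
  assumes "bij_betw \<pi> B C" "supp f \<subseteq> C" "finite (supp f)"
    "\<And>x. x \<in> B \<Longrightarrow> g x = f (\<pi> x)" "supp g \<subseteq> B"
  shows "finite (supp g)" "l1 g = l1 f" "(\<Sum>x\<in>supp g. g x) = (\<Sum>x\<in>supp f. f x)"
proof -
  have inj: "inj_on \<pi> (supp g)" using assms(1,5) by (meson bij_betw_imp_inj_on inj_on_subset)
  have im: "\<pi> ` supp g = supp f"
  proof
    show "\<pi> ` supp g \<subseteq> supp f" using assms(4,5) by (auto simp: supp_def)
    show "supp f \<subseteq> \<pi> ` supp g"
    proof
      fix y assume y: "y \<in> supp f"
      then obtain x where "x \<in> B" "y = \<pi> x" using assms(1,2) unfolding bij_betw_def by blast
      then show "y \<in> \<pi> ` supp g" using y assms(4)[of x] by (auto simp: supp_def)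
    qed
  qed
  show "finite (supp g)" using finite_imageD[of \<pi> "supp g"] im inj assms(3) by simp
  have c: "g x = f (\<pi> x)" if "x \<in> supp g" for x using that assms(4,5) by blast
  show "l1 g = l1 f" unfolding l1_def im[symmetric] sum.reindex[OF inj] by (simp add: c)
  show "(\<Sum>x\<in>supp g. g x) = (\<Sum>x\<in>supp f. f x)"
    unfolding im[symmetric] sum.reindex[OF inj] by (simp add: c)
qed

lemma fin_prob_average:
  assumes "finite J" "J \<noteq> {}" "\<And>j. j \<in> J \<Longrightarrow> fin_prob (p j)"
  shows "fin_prob (\<lambda>i. (1 / real (card J)) * (\<Sum>j\<in>J. p j i))"
proof (rule fin_probI)
  let ?A = "\<Union>j\<in>J. supp (p j)"
  show A: "finite ?A" using assms fin_probD(1) by blast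
  show "(1 / real (card J)) * (\<Sum>j\<in>J. p j i) = 0" if "i \<notin> ?A" for i
    using that by (simp add: supp_def)
  show "0 \<le> (1 / real (card J)) * (\<Sum>j\<in>J. p j i)" for i
    using assms(3) by (simp add: sum_nonneg fin_probD(2))
  have "(\<Sum>i\<in>?A. (\<Sum>j\<in>J. p j i)) = (\<Sum>j\<in>J. \<Sum>i\<in>?A. p j i)" by (rule sum.swap)
  also have "\<dots> = (\<Sum>j\<in>J. 1)" by (rule sum.cong[OF refl], rule fin_probD(3)) (use assms A in auto)
  finally show "(\<Sum>i\<in>?A. (1 / real (card J)) * (\<Sum>j\<in>J. p j i)) = 1"
    using assms(1,2) unfolding sum_distrib_left[symmetric] by simp
qed

definition unif :: "'i set \<Rightarrow> 'i \<Rightarrow> real" where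
  "unif A i = (if i \<in> A then 1 / real (card A) else 0)"

lemma fin_prob_unif: "finite A \<Longrightarrow> A \<noteq> {} \<Longrightarrow> fin_prob (unif A)"
  by (rule fin_probI[of A]) (auto simp: unif_def)

text \<open>If \<open>A\<close> and \<open>C\<close> differ, the right side is at least 2, which
  bounds the distance of any two probability measures. This crude bound is enough because the gaps
  between cardinalities will telescope.\<close>

lemma l1_unif_diff_le:
  assumes "finite C" "A \<noteq> {}" "A \<subseteq> B" "B \<subseteq> C" "A \<subseteq> B'" "B' \<subseteq> C"
  shows "l1 (\<lambda>i. unif B i - unif B' i) \<le> 2 * (real (card C) - real (card A))"
proof (cases "A = C")
  case True
  then have "B = B'" using assms by auto
  then show ?thesis using True by (simp add: l1_def)
next
  case False
  then have "card A < card C" using assms by (intro psubset_card_mono) auto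
  moreover have "finite B" "finite B'" using assms(1,4,6) by (simp_all add: finite_subset)
  then have "l1 (\<lambda>i. unif B i - unif B' i) \<le> 2"
    using assms by (intro l1_fin_prob_diff_le fin_prob_unif) auto
  ultimately show ?thesis by (simp add: algebra_simps)
qed

section \<open>Uniformly exact families of subsets of a group\<close>

text \<open>For \<open>\<W> = {carrier G}\<close> this is Yu's property A of \<open>G\<close> in Reiter form; the finite set \<open>S\<close>
  does not depend on the member \<open>W\<close> of the family.\<close>

definition unif_exact :: "('g, 'm) monoid_scheme \<Rightarrow> 'g set set \<Rightarrow> bool" where
  "unif_exact G \<W> \<longleftrightarrow> (\<forall>F \<epsilon>. finite F \<and> F \<subseteq> carrier G \<and> (\<epsilon>::real) > 0 \<longrightarrow>
     (\<exists>S. finite S \<and> S \<subseteq> carrier G \<and> (\<forall>W\<in>\<W>. \<exists>\<kappa>.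
        (\<forall>g\<in>W. fin_prob (\<kappa> g) \<and> supp (\<kappa> g) \<subseteq> g <#\<^bsub>G\<^esub> S) \<and>
        (\<forall>g\<in>W. \<forall>f\<in>F. g \<otimes>\<^bsub>G\<^esub> f \<in> W \<longrightarrow> l1 (\<lambda>x. \<kappa> g x - \<kappa> (g \<otimes>\<^bsub>G\<^esub> f) x) \<le> \<epsilon>))))"

lemma unif_exactE:
  assumes "unif_exact G \<W>" "finite F" "F \<subseteq> carrier G" "(\<epsilon>::real) > 0"
  obtains S \<kappa> where "finite S" "S \<subseteq> carrier G"
    "\<And>W g. W \<in> \<W> \<Longrightarrow> g \<in> W \<Longrightarrow> fin_prob (\<kappa> W g)"
    "\<And>W g. W \<in> \<W> \<Longrightarrow> g \<in> W \<Longrightarrow> supp (\<kappa> W g) \<subseteq> g <#\<^bsub>G\<^esub> S"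
    "\<And>W g f. W \<in> \<W> \<Longrightarrow> g \<in> W \<Longrightarrow> f \<in> F \<Longrightarrow> g \<otimes>\<^bsub>G\<^esub> f \<in> W \<Longrightarrow>
       l1 (\<lambda>x. \<kappa> W g x - \<kappa> W (g \<otimes>\<^bsub>G\<^esub> f) x) \<le> \<epsilon>"
proof -
  obtain S where S: "finite S" "S \<subseteq> carrier G" "\<forall>W\<in>\<W>. \<exists>\<kappa>.
        (\<forall>g\<in>W. fin_prob (\<kappa> g) \<and> supp (\<kappa> g) \<subseteq> g <#\<^bsub>G\<^esub> S) \<and>
        (\<forall>g\<in>W. \<forall>f\<in>F. g \<otimes>\<^bsub>G\<^esub> f \<in> W \<longrightarrow> l1 (\<lambda>x. \<kappa> g x - \<kappa> (g \<otimes>\<^bsub>G\<^esub> f) x) \<le> \<epsilon>)"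
    using assms(1)[unfolded unif_exact_def, rule_format, of F \<epsilon>] assms(2-4) by auto
  obtain \<kappa> where \<kappa>: "\<forall>W\<in>\<W>. (\<forall>g\<in>W. fin_prob (\<kappa> W g) \<and> supp (\<kappa> W g) \<subseteq> g <#\<^bsub>G\<^esub> S) \<and>
        (\<forall>g\<in>W. \<forall>f\<in>F. g \<otimes>\<^bsub>G\<^esub> f \<in> W \<longrightarrow> l1 (\<lambda>x. \<kappa> W g x - \<kappa> W (g \<otimes>\<^bsub>G\<^esub> f) x) \<le> \<epsilon>)"
    using bchoice[OF S(3)] by blast
  show thesis by (rule that[OF S(1,2), of \<kappa>]) (use \<kappa> in auto)
qed

lemma unif_exact_Un:
  assumes "unif_exact G \<A>" "unif_exact G \<B>"
  shows "unif_exact G (\<A> \<union> \<B>)"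
  unfolding unif_exact_def
proof (intro allI impI)
  fix F :: "'a set" and \<epsilon> :: real assume "finite F \<and> F \<subseteq> carrier G \<and> \<epsilon> > 0"
  then have F': "finite F" "F \<subseteq> carrier G" "\<epsilon> > 0" by auto
  obtain S \<kappa> where S: "finite S" "S \<subseteq> carrier G"
    "\<And>W g. W \<in> \<A> \<Longrightarrow> g \<in> W \<Longrightarrow> fin_prob (\<kappa> W g)"
    "\<And>W g. W \<in> \<A> \<Longrightarrow> g \<in> W \<Longrightarrow> supp (\<kappa> W g) \<subseteq> g <#\<^bsub>G\<^esub> S"
    "\<And>W g f. W \<in> \<A> \<Longrightarrow> g \<in> W \<Longrightarrow> f \<in> F \<Longrightarrow> g \<otimes>\<^bsub>G\<^esub> f \<in> W \<Longrightarrow>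
       l1 (\<lambda>x. \<kappa> W g x - \<kappa> W (g \<otimes>\<^bsub>G\<^esub> f) x) \<le> \<epsilon>"
    by (rule unif_exactE[OF assms(1) F']) (rule that)
  obtain S' \<kappa>' where S': "finite S'" "S' \<subseteq> carrier G"
    "\<And>W g. W \<in> \<B> \<Longrightarrow> g \<in> W \<Longrightarrow> fin_prob (\<kappa>' W g)"
    "\<And>W g. W \<in> \<B> \<Longrightarrow> g \<in> W \<Longrightarrow> supp (\<kappa>' W g) \<subseteq> g <#\<^bsub>G\<^esub> S'"
    "\<And>W g f. W \<in> \<B> \<Longrightarrow> g \<in> W \<Longrightarrow> f \<in> F \<Longrightarrow> g \<otimes>\<^bsub>G\<^esub> f \<in> W \<Longrightarrow>
       l1 (\<lambda>x. \<kappa>' W g x - \<kappa>' W (g \<otimes>\<^bsub>G\<^esub> f) x) \<le> \<epsilon>"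
    by (rule unif_exactE[OF assms(2) F']) (rule that)
  have m: "g <#\<^bsub>G\<^esub> S \<subseteq> g <#\<^bsub>G\<^esub> (S \<union> S')" "g <#\<^bsub>G\<^esub> S' \<subseteq> g <#\<^bsub>G\<^esub> (S \<union> S')" for g
    by (auto simp: l_coset_def)
  show "\<exists>S. finite S \<and> S \<subseteq> carrier G \<and> (\<forall>W\<in>\<A> \<union> \<B>. \<exists>\<kappa>.
        (\<forall>g\<in>W. fin_prob (\<kappa> g) \<and> supp (\<kappa> g) \<subseteq> g <#\<^bsub>G\<^esub> S) \<and>
        (\<forall>g\<in>W. \<forall>f\<in>F. g \<otimes>\<^bsub>G\<^esub> f \<in> W \<longrightarrow> l1 (\<lambda>x. \<kappa> g x - \<kappa> (g \<otimes>\<^bsub>G\<^esub> f) x) \<le> \<epsilon>))"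
  proof (rule exI[of _ "S \<union> S'"], intro conjI ballI)
    fix W assume "W \<in> \<A> \<union> \<B>"
    then show "\<exists>\<kappa>. (\<forall>g\<in>W. fin_prob (\<kappa> g) \<and> supp (\<kappa> g) \<subseteq> g <#\<^bsub>G\<^esub> (S \<union> S')) \<and>
        (\<forall>g\<in>W. \<forall>f\<in>F. g \<otimes>\<^bsub>G\<^esub> f \<in> W \<longrightarrow> l1 (\<lambda>x. \<kappa> g x - \<kappa> (g \<otimes>\<^bsub>G\<^esub> f) x) \<le> \<epsilon>)"
    proof
      assume W: "W \<in> \<A>"
      show ?thesis
        by (rule exI[of _ "\<kappa> W"]) (use S(3-5)[OF W] m(1) in blast)
    next
      assume W: "W \<in> \<B>"
      show ?thesis
        by (rule exI[of _ "\<kappa>' W"]) (use S'(3-5)[OF W] m(2) in blast)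
    qed
  qed (use S S' in auto)
qed

lemma unif_exact_empty: "unif_exact G {}"
  unfolding unif_exact_def by (auto intro: exI[of _ "{}"])

lemma unif_exact_finite_UN:
  "finite I \<Longrightarrow> (\<And>i. i \<in> I \<Longrightarrow> unif_exact G (\<A> i)) \<Longrightarrow> unif_exact G (\<Union>i\<in>I. \<A> i)"
  by (induction I rule: finite_induct) (auto intro: unif_exact_Un unif_exact_empty)

section \<open>Translates, neighbourhoods and partitions of unity\<close>

context group
begin

lemma bij_betw_mult_left: "h \<in> carrier G \<Longrightarrow> bij_betw (\<lambda>x. h \<otimes> x) (carrier G) (carrier G)"
  by (rule bij_betw_byWitness[where f' = "\<lambda>x. inv h \<otimes> x"]) (auto simp: m_assoc[symmetric])

lemma mult_inv_cancel:
  assumes "a \<in> carrier G" "b \<in> carrier G"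
  shows "a \<otimes> (inv a \<otimes> b) = b" "inv a \<otimes> (a \<otimes> b) = b"
  using assms by (simp_all add: m_assoc[symmetric])

lemma l_coset_subset_carrier: "g \<in> carrier G \<Longrightarrow> S \<subseteq> carrier G \<Longrightarrow> g <# S \<subseteq> carrier G"
  by (auto simp: l_coset_def)

lemma mem_l_coset_iff:
  "g \<in> carrier G \<Longrightarrow> S \<subseteq> carrier G \<Longrightarrow> x \<in> carrier G \<Longrightarrow> x \<in> g <# S \<longleftrightarrow> inv g \<otimes> x \<in> S"
  unfolding l_coset_def using mult_inv_cancel[of g]
  by (auto simp: subset_iff) metis

text \<open>A left translate needs no new \<open>S\<close>, since all conditions are left invariant.
  A right factor from the finite set \<open>T\<close> displaces a point boundedly and is absorbed by
  enlarging \<open>F\<close> and \<open>S\<close>. Thus infinitely many sets \<open>U\<close> are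
  controlled by few sets \<open>W\<close>.\<close>

lemma unif_exact_coarse:
  assumes ex: "unif_exact G \<W>" and T: "finite T" "T \<subseteq> carrier G"
    and W: "\<And>W. W \<in> \<W> \<Longrightarrow> W \<subseteq> carrier G"
    and cov: "\<And>U. U \<in> \<U> \<Longrightarrow> \<exists>h\<in>carrier G. \<exists>W\<in>\<W>. \<forall>g\<in>U. \<exists>w\<in>W. \<exists>t\<in>T. g = h \<otimes> w \<otimes> t"
  shows "unif_exact G \<U>"
  unfolding unif_exact_def
proof (intro allI impI)
  fix F :: "'a set" and \<epsilon> :: real assume F: "finite F \<and> F \<subseteq> carrier G \<and> \<epsilon> > 0"
  \<comment> \<open>If \<open>h \<otimes> w \<otimes> t \<otimes> f = h \<otimes> w' \<otimes>
    t'\<close>, then \<open>w'\<close> is \<open>w\<close> times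
    \<open>t \<otimes> f \<otimes> inv t'\<close>.\<close>
  define F' where "F' = (\<lambda>(t, f, t'). t \<otimes> f \<otimes> inv t') ` (T \<times> F \<times> T)"
  have F': "finite F'" "F' \<subseteq> carrier G" unfolding F'_def using F T by (auto simp: subset_iff)
  obtain S \<kappa> where S: "finite S" "S \<subseteq> carrier G"
    and pr: "\<And>W g. W \<in> \<W> \<Longrightarrow> g \<in> W \<Longrightarrow> fin_prob (\<kappa> W g)"
    and su: "\<And>W g. W \<in> \<W> \<Longrightarrow> g \<in> W \<Longrightarrow> supp (\<kappa> W g) \<subseteq> g <# S"
    and le: "\<And>W g f. W \<in> \<W> \<Longrightarrow> g \<in> W \<Longrightarrow> f \<in> F' \<Longrightarrow> g \<otimes> f \<in> W \<Longrightarrow>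
       l1 (\<lambda>x. \<kappa> W g x - \<kappa> W (g \<otimes> f) x) \<le> \<epsilon>"
    by (rule unif_exactE[OF ex F' conjunct2[OF conjunct2[OF F]]]) (rule that)
  \<comment> \<open>For \<open>g = h \<otimes> w \<otimes> t\<close>, a point
    \<open>w \<otimes> s\<close> of the support moves to
    \<open>h \<otimes> w \<otimes> s = g \<otimes> (inv t \<otimes> s)\<close>.\<close>
  define S' where "S' = (\<lambda>(t, s). inv t \<otimes> s) ` (T \<times> S)"
  have S': "finite S'" "S' \<subseteq> carrier G" unfolding S'_def using S T by (auto simp: subset_iff)
  show "\<exists>S. finite S \<and> S \<subseteq> carrier G \<and> (\<forall>W\<in>\<U>. \<exists>\<kappa>.
        (\<forall>g\<in>W. fin_prob (\<kappa> g) \<and> supp (\<kappa> g) \<subseteq> g <# S) \<and>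
        (\<forall>g\<in>W. \<forall>f\<in>F. g \<otimes> f \<in> W \<longrightarrow> l1 (\<lambda>x. \<kappa> g x - \<kappa> (g \<otimes> f) x) \<le> \<epsilon>))"
  proof (intro exI[of _ S'] conjI ballI S')
    fix U assume "U \<in> \<U>"
    then obtain h W where h: "h \<in> carrier G" and WW: "W \<in> \<W>"
      and dec: "\<forall>g\<in>U. \<exists>w. \<exists>t. w \<in> W \<and> t \<in> T \<and> g = h \<otimes> w \<otimes> t" using cov by meson
    obtain \<pi> where "\<forall>g\<in>U. \<exists>t. \<pi> g \<in> W \<and> t \<in> T \<and> g = h \<otimes> \<pi> g \<otimes> t"
      using bchoice[OF dec] by blast
    from bchoice[OF this] obtain \<tau> where
      pt: "\<And>g. g \<in> U \<Longrightarrow> \<pi> g \<in> W \<and> \<tau> g \<in> T \<and> g = h \<otimes> \<pi> g \<otimes> \<tau> g" by blast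
    have ptc: "\<pi> g \<in> carrier G" "\<tau> g \<in> carrier G" if "g \<in> U" for g
      using pt[OF that] W[OF WW] T by auto
    have Uc: "g \<in> carrier G" if "g \<in> U" for g
      using pt[OF that] ptc[OF that] h by (metis m_closed)
    define \<nu> where "\<nu> g x = (if x \<in> carrier G then \<kappa> W (\<pi> g) (inv h \<otimes> x) else 0)" for g x
    have bij: "bij_betw (\<lambda>x. inv h \<otimes> x) (carrier G) (carrier G)"
      using h by (intro bij_betw_mult_left) auto
    have suc: "supp (\<kappa> W (\<pi> g)) \<subseteq> carrier G" if "g \<in> U" for g
      using su[OF WW, of "\<pi> g"] pt[OF that] l_coset_subset_carrier[OF ptc(1)[OF that] S(2)] by blast
    have nuc: "supp (\<nu> g) \<subseteq> carrier G" for g by (auto simp: \<nu>_def supp_def)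
    have p: "fin_prob (\<kappa> W (\<pi> g))" if "g \<in> U" for g using pr[OF WW] pt[OF that] by blast
    have 1: "fin_prob (\<nu> g)" if g: "g \<in> U" for g
    proof -
      note r = l1_reindex[OF bij suc[OF g] fin_probD(1)[OF p[OF g]] _ nuc, of g]
      have "finite (supp (\<nu> g))" by (rule r(1)) (auto simp: \<nu>_def)
      moreover have "(\<Sum>x\<in>supp (\<nu> g). \<nu> g x) = 1"
        using r(3) p[OF g] by (auto simp: \<nu>_def fin_prob_def)
      ultimately show ?thesis using fin_probD(2)[OF p[OF g]] by (simp add: fin_prob_def \<nu>_def)
    qed
    have 2: "supp (\<nu> g) \<subseteq> g <# S'" if g: "g \<in> U" for g
    proof
      fix x assume x: "x \<in> supp (\<nu> g)"
      then have xc: "x \<in> carrier G" using nuc by blast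
      then have "inv h \<otimes> x \<in> supp (\<kappa> W (\<pi> g))" using x by (simp add: \<nu>_def supp_def)
      then have "inv h \<otimes> x \<in> \<pi> g <# S" using su[OF WW] pt[OF g] by blast
      then obtain s where s: "s \<in> S" "inv h \<otimes> x = \<pi> g \<otimes> s" by (auto simp: l_coset_def)
      then have sc: "s \<in> carrier G" using S by blast
      have "x = h \<otimes> (\<pi> g \<otimes> s)" using s(2) xc h by (metis inv_closed inv_inv inv_solve_left m_closed)
      also have "\<dots> = (h \<otimes> \<pi> g \<otimes> \<tau> g) \<otimes> (inv (\<tau> g) \<otimes> s)"
        using h ptc[OF g] sc by (simp add: m_assoc mult_inv_cancel)
      finally have "x = g \<otimes> (inv (\<tau> g) \<otimes> s)" using pt[OF g] by simp
      then show "x \<in> g <# S'" using s(1) pt[OF g] by (auto simp: l_coset_def S'_def)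
    qed
    have 3: "l1 (\<lambda>x. \<nu> g x - \<nu> (g \<otimes> f) x) \<le> \<epsilon>" if g: "g \<in> U" "f \<in> F" "g \<otimes> f \<in> U" for g f
    proof -
      let ?f = "\<tau> g \<otimes> f \<otimes> inv (\<tau> (g \<otimes> f))"
      have fc: "f \<in> carrier G" using g F by blast
      have a: "h \<otimes> \<pi> g \<otimes> \<tau> g = g" "h \<otimes> \<pi> (g \<otimes> f) \<otimes> \<tau> (g \<otimes> f) = g \<otimes> f"
        using pt g by auto
      note c = ptc[OF g(1)] ptc[OF g(3)]
      have "\<pi> (g \<otimes> f) = inv h \<otimes> (g \<otimes> f) \<otimes> inv (\<tau> (g \<otimes> f))"
        using c h by (subst a(2)[symmetric]) (simp add: m_assoc mult_inv_cancel)
      also have "\<dots> = inv h \<otimes> (h \<otimes> \<pi> g \<otimes> \<tau> g \<otimes> f) \<otimes> inv (\<tau> (g \<otimes> f))"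
        by (simp add: a(1))
      also have "\<dots> = \<pi> g \<otimes> ?f" using c h fc by (simp add: m_assoc mult_inv_cancel)
      finally have e: "\<pi> (g \<otimes> f) = \<pi> g \<otimes> ?f" .
      have "?f \<in> F'" unfolding F'_def using pt g by (auto intro!: image_eqI[where x = "(\<tau> g, f, \<tau> (g \<otimes> f))"])
      then have l: "l1 (\<lambda>x. \<kappa> W (\<pi> g) x - \<kappa> W (\<pi> (g \<otimes> f)) x) \<le> \<epsilon>"
        using le[OF WW, of "\<pi> g" ?f] pt g unfolding e by (metis e)
      have "l1 (\<lambda>x. \<nu> g x - \<nu> (g \<otimes> f) x) = l1 (\<lambda>x. \<kappa> W (\<pi> g) x - \<kappa> W (\<pi> (g \<otimes> f)) x)"
      proof (rule l1_reindex(2)[OF bij])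
        show "supp (\<lambda>x. \<kappa> W (\<pi> g) x - \<kappa> W (\<pi> (g \<otimes> f)) x) \<subseteq> carrier G"
          using suc g supp_diff_subset[of "\<kappa> W (\<pi> g)" "\<kappa> W (\<pi> (g \<otimes> f))"] by blast
        show "finite (supp (\<lambda>x. \<kappa> W (\<pi> g) x - \<kappa> W (\<pi> (g \<otimes> f)) x))"
          using p g by (intro finite_supp_diff fin_probD(1)) auto
        show "supp (\<lambda>x. \<nu> g x - \<nu> (g \<otimes> f) x) \<subseteq> carrier G"
          using nuc supp_diff_subset[of "\<nu> g" "\<nu> (g \<otimes> f)"] by blast
      qed (simp add: \<nu>_def)
      then show ?thesis using l by simp
    qed
    show "\<exists>\<kappa>. (\<forall>g\<in>U. fin_prob (\<kappa> g) \<and> supp (\<kappa> g) \<subseteq> g <# S') \<and>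
        (\<forall>g\<in>U. \<forall>f\<in>F. g \<otimes> f \<in> U \<longrightarrow> l1 (\<lambda>x. \<kappa> g x - \<kappa> (g \<otimes> f) x) \<le> \<epsilon>)"
      by (rule exI[of _ \<nu>]) (use 1 2 3 in blast)
  qed
qed

lemma unif_exact_mono:
  assumes "unif_exact G \<W>" "\<And>W. W \<in> \<W> \<Longrightarrow> W \<subseteq> carrier G"
    and "\<And>U. U \<in> \<U> \<Longrightarrow> \<exists>W\<in>\<W>. U \<subseteq> W"
  shows "unif_exact G \<U>"
proof (rule unif_exact_coarse[OF assms(1), of "{\<one>}"])
  fix U assume "U \<in> \<U>"
  then obtain W where W: "W \<in> \<W>" "U \<subseteq> W" using assms(3) by blast
  have "g = \<one> \<otimes> g \<otimes> \<one>" if "g \<in> U" for g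
  proof -
    have "g \<in> carrier G" using that W assms(2) by blast
    then show ?thesis by simp
  qed
  then show "\<exists>h\<in>carrier G. \<exists>W\<in>\<W>. \<forall>g\<in>U. \<exists>w\<in>W. \<exists>t\<in>{\<one>}. g = h \<otimes> w \<otimes> t"
    using W by (intro bexI[of _ \<one>] bexI[of _ W]) auto
qed (use assms(2) in auto)

text \<open>With \<open>m = min (w g) (w g')\<close>, the difference of the averages
  \<open>\<Sum>i. w g i * \<kappa> i g\<close> and \<open>\<Sum>i. w g' i * \<kappa> i g'\<close> splits into the parts with weights
  \<open>w g - m\<close> and \<open>w g' - m\<close>, and \<open>m\<close> times \<open>\<kappa> i g - \<kappa> i g'\<close>, which only involves pieces containing
  both points.\<close>

lemma unif_exact_combine:
  assumes W: "W \<subseteq> carrier G"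
    and part: "\<And>F \<epsilon>. finite F \<Longrightarrow> F \<subseteq> carrier G \<Longrightarrow> (\<epsilon>::real) > 0 \<Longrightarrow>
      \<exists>w :: 'a \<Rightarrow> 'i \<Rightarrow> real. (\<forall>g\<in>W. fin_prob (w g)) \<and>
        (\<forall>g\<in>W. \<forall>f\<in>F. g \<otimes> f \<in> W \<longrightarrow> l1 (\<lambda>i. w g i - w (g \<otimes> f) i) \<le> \<epsilon>) \<and>
        unif_exact G (range (\<lambda>i. {g \<in> W. w g i \<noteq> 0}))"
  shows "unif_exact G {W}"
  unfolding unif_exact_def
proof (intro allI impI)
  fix F :: "'a set" and \<epsilon> :: real assume "finite F \<and> F \<subseteq> carrier G \<and> \<epsilon> > 0"
  then have F: "finite F" "F \<subseteq> carrier G" "\<epsilon> > 0" "\<epsilon> / 2 > 0" by auto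
  \<comment> \<open>Half of \<open>\<epsilon>\<close> is spent on the weights, half on the measures
    of the pieces.\<close>
  obtain w :: "'a \<Rightarrow> 'i \<Rightarrow> real" where w: "\<And>g. g \<in> W \<Longrightarrow> fin_prob (w g)"
    and wle: "\<And>g f. g \<in> W \<Longrightarrow> f \<in> F \<Longrightarrow> g \<otimes> f \<in> W \<Longrightarrow> l1 (\<lambda>i. w g i - w (g \<otimes> f) i) \<le> \<epsilon> / 2"
    and uex: "unif_exact G (range (\<lambda>i. {g \<in> W. w g i \<noteq> 0}))"
    using part[OF F(1,2,4)] by blast
  define P where "P = (\<lambda>i. {g \<in> W. w g i \<noteq> 0})"
  obtain S \<kappa> where S: "finite S" "S \<subseteq> carrier G"
    and pr: "\<And>W g. W \<in> range P \<Longrightarrow> g \<in> W \<Longrightarrow> fin_prob (\<kappa> W g)"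
    and su: "\<And>W g. W \<in> range P \<Longrightarrow> g \<in> W \<Longrightarrow> supp (\<kappa> W g) \<subseteq> g <# S"
    and le: "\<And>W g f. W \<in> range P \<Longrightarrow> g \<in> W \<Longrightarrow> f \<in> F \<Longrightarrow> g \<otimes> f \<in> W \<Longrightarrow>
       l1 (\<lambda>x. \<kappa> W g x - \<kappa> W (g \<otimes> f) x) \<le> \<epsilon> / 2"
    by (rule unif_exactE[OF uex F(1,2,4), folded P_def]) (rule that)
  \<comment> \<open>Set to 0 off the piece, so that the sums for two points can be taken over one
    index set.\<close>
  define \<mu> where "\<mu> i g = (if g \<in> P i then \<kappa> (P i) g else (\<lambda>_. 0))" for i g
  have \<mu>1: "fin_prob (\<mu> i g)" if "g \<in> P i" for i g using pr[of "P i" g] that by (simp add: \<mu>_def)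
  have fin: "finite (supp (\<mu> i g))" for i g
  proof (cases "g \<in> P i")
    case True then show ?thesis using \<mu>1 fin_probD(1) by blast
  qed (simp add: \<mu>_def supp_def)
  have l1\<mu>: "l1 (\<mu> i g) \<le> 1" for i g
  proof (cases "g \<in> P i")
    case True then show ?thesis using \<mu>1 l1_fin_prob by force
  qed (simp add: \<mu>_def supp_def l1_def)
  have su\<mu>: "supp (\<mu> i g) \<subseteq> g <# S" for i g
  proof (cases "g \<in> P i")
    case True then show ?thesis using su[of "P i" g] by (simp add: \<mu>_def)
  qed (simp add: \<mu>_def supp_def)
  define p where "p g x = (\<Sum>i\<in>supp (w g). w g i * \<mu> i g x)" for g x
  have p_eq: "p g x = (\<Sum>i\<in>A. w g i * \<mu> i g x)" if "finite A" "supp (w g) \<subseteq> A" for g x A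
    unfolding p_def by (rule sum.mono_neutral_left[OF that]) (auto simp: supp_def)
  have 1: "fin_prob (p g)" if g: "g \<in> W" for g
  proof (rule fin_probI)
    let ?I = "supp (w g)"
    let ?A = "\<Union>i\<in>?I. supp (\<mu> i g)"
    have I: "finite ?I" using w[OF g] fin_probD(1) by blast
    show A: "finite ?A" using I fin by blast
    show "p g x = 0" if "x \<notin> ?A" for x
      unfolding p_def by (rule sum.neutral) (use that in \<open>auto simp: supp_def\<close>)
    have "0 \<le> \<mu> i g x" for i x
      using \<mu>1[of g i] fin_probD(2) by (cases "g \<in> P i") (auto simp: \<mu>_def)
    then show "0 \<le> p g x" for x
      unfolding p_def using fin_probD(2)[OF w[OF g]] by (intro sum_nonneg mult_nonneg_nonneg)
    have "(\<Sum>x\<in>?A. p g x) = (\<Sum>i\<in>?I. \<Sum>x\<in>?A. w g i * \<mu> i g x)"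
      unfolding p_def by (rule sum.swap)
    also have "\<dots> = (\<Sum>i\<in>?I. w g i)"
    proof (rule sum.cong[OF refl])
      fix i assume i: "i \<in> ?I"
      then have "g \<in> P i" using g by (simp add: P_def supp_def)
      then have "(\<Sum>x\<in>?A. \<mu> i g x) = 1"
        using fin_probD(3)[OF \<mu>1, of g i ?A] A i by blast
      then show "(\<Sum>x\<in>?A. w g i * \<mu> i g x) = w g i" by (simp add: sum_distrib_left[symmetric])
    qed
    also have "\<dots> = 1" using w[OF g] by (simp add: fin_prob_def)
    finally show "(\<Sum>x\<in>?A. p g x) = 1" .
  qed
  have 2: "supp (p g) \<subseteq> g <# S" if g: "g \<in> W" for g
  proof -
    have "supp (p g) \<subseteq> (\<Union>i\<in>supp (w g). supp (\<lambda>x. w g i * \<mu> i g x))"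
      using supp_sum_subset[of "\<lambda>i x. w g i * \<mu> i g x" "supp (w g)"] by (simp add: p_def[abs_def])
    also have "\<dots> \<subseteq> g <# S"
      by (rule UN_least) (rule order_trans[OF supp_cmult_subset su\<mu>])
    finally show ?thesis .
  qed
  have 3: "l1 (\<lambda>x. p g x - p (g \<otimes> f) x) \<le> \<epsilon>" if g: "g \<in> W" "f \<in> F" "g \<otimes> f \<in> W" for g f
  proof -
    define h where "h = g \<otimes> f"
    let ?I = "supp (w g) \<union> supp (w h)"
    have h: "h \<in> W" using g by (simp add: h_def)
    have I: "finite ?I" using w[OF g(1)] w[OF h] fin_probD(1) by blast
    define m where "m i = min (w g i) (w h i)" for i
    have m0: "0 \<le> m i" for i using fin_probD(2)[OF w[OF g(1)]] fin_probD(2)[OF w[OF h]] by (simp add: m_def)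
    define u where "u i x = (w g i - m i) * \<mu> i g x + (- (w h i - m i)) * \<mu> i h x" for i x
    define v where "v i x = m i * (\<mu> i g x - \<mu> i h x)" for i x
    have fd: "finite (supp (\<lambda>x. \<mu> i g x - \<mu> i h x))" for i by (intro finite_supp_diff fin)
    have fu: "finite (supp (u i))" for i
      unfolding u_def[abs_def] by (intro finite_supp_add finite_supp_cmult fin)
    have fv: "finite (supp (v i))" for i
      unfolding v_def[abs_def] by (intro finite_supp_cmult fd)
    have lu: "l1 (u i) \<le> \<bar>w g i - w h i\<bar>" for i
    proof -
      have "l1 (u i) \<le> l1 (\<lambda>x. (w g i - m i) * \<mu> i g x) + l1 (\<lambda>x. (- (w h i - m i)) * \<mu> i h x)"
        unfolding u_def[abs_def] by (intro l1_add_le finite_supp_cmult fin)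
      also have "\<dots> = \<bar>w g i - m i\<bar> * l1 (\<mu> i g) + \<bar>w h i - m i\<bar> * l1 (\<mu> i h)"
        by (subst (1 2) l1_cmult[OF fin]) (simp add: abs_minus_commute)
      also have "\<dots> \<le> \<bar>w g i - m i\<bar> * 1 + \<bar>w h i - m i\<bar> * 1"
        by (intro add_mono mult_left_mono l1\<mu>) auto
      \<comment> \<open>\<open>m i\<close> is the smaller weight, so one of the two differences is
        0.\<close>
      also have "\<dots> = \<bar>w g i - w h i\<bar>" by (simp add: m_def min_def)
      finally show ?thesis .
    qed
    have lv: "l1 (v i) \<le> m i * (\<epsilon> / 2)" for i
    proof (cases "m i = 0")
      case True then show ?thesis by (simp add: v_def[abs_def] l1_def)
    next
      case False
      then have "w g i \<noteq> 0" "w h i \<noteq> 0"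
        using fin_probD(2)[OF w[OF g(1)], of i] fin_probD(2)[OF w[OF h], of i] by (auto simp: m_def min_def split: if_splits)
      then have "g \<in> P i" "h \<in> P i" using g h by (auto simp: P_def)
      then have "l1 (\<lambda>x. \<mu> i g x - \<mu> i h x) \<le> \<epsilon> / 2"
        using le[of "P i" g f] g by (simp add: \<mu>_def h_def)
      from mult_left_mono[OF this m0[of i]] show ?thesis
        unfolding v_def[abs_def] l1_cmult[OF fd] using m0[of i] by simp
    qed
    have pgh: "p g x = (\<Sum>i\<in>?I. w g i * \<mu> i g x)" "p h x = (\<Sum>i\<in>?I. w h i * \<mu> i h x)" for x
      by (rule p_eq[OF I], simp)+
    have "p g x - p h x = (\<Sum>i\<in>?I. u i x + v i x)" for x
      unfolding pgh sum_subtractf[symmetric]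
      by (rule sum.cong) (simp_all add: u_def v_def algebra_simps)
    then have "l1 (\<lambda>x. p g x - p h x) \<le> (\<Sum>i\<in>?I. l1 (\<lambda>x. u i x + v i x))"
      using l1_sum_le[OF I, of "\<lambda>i x. u i x + v i x"] finite_supp_add[OF fu fv] by simp
    also have "\<dots> \<le> (\<Sum>i\<in>?I. \<bar>w g i - w h i\<bar> + m i * (\<epsilon> / 2))"
      by (intro sum_mono order_trans[OF l1_add_le[OF fu fv]] add_mono lu lv)
    also have "\<dots> = l1 (\<lambda>i. w g i - w h i) + (\<Sum>i\<in>?I. m i) * (\<epsilon> / 2)"
      by (simp only: sum.distrib sum_distrib_right l1_eq[OF I supp_diff_subset])
    also have "\<dots> \<le> \<epsilon> / 2 + 1 * (\<epsilon> / 2)"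
    proof (intro add_mono mult_right_mono)
      show "l1 (\<lambda>i. w g i - w h i) \<le> \<epsilon> / 2" using wle g by (simp add: h_def)
      have "(\<Sum>i\<in>?I. m i) \<le> (\<Sum>i\<in>?I. w g i)" by (intro sum_mono) (simp add: m_def)
      also have "\<dots> = 1" by (rule fin_probD(3)[OF w[OF g(1)] I]) simp
      finally show "(\<Sum>i\<in>?I. m i) \<le> 1" .
    qed (use F in auto)
    finally show ?thesis by (simp add: h_def)
  qed
  show "\<exists>S. finite S \<and> S \<subseteq> carrier G \<and> (\<forall>W\<in>{W}. \<exists>\<kappa>.
        (\<forall>g\<in>W. fin_prob (\<kappa> g) \<and> supp (\<kappa> g) \<subseteq> g <# S) \<and>
        (\<forall>g\<in>W. \<forall>f\<in>F. g \<otimes> f \<in> W \<longrightarrow> l1 (\<lambda>x. \<kappa> g x - \<kappa> (g \<otimes> f) x) \<le> \<epsilon>))"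
    using S 1 2 3 by (intro exI[of _ S] conjI ballI exI[of _ p] impI) simp_all
qed

text \<open>The partition of unity on \<open>W\<close> is a function \<open>\<rho> / N\<close> of the number \<open>\<rho>\<close> of steps needed to
  reach \<open>Y\<close>, capped at \<open>N\<close>; off \<open>Y\<close> the pieces \<open>X i\<close> do not interact.\<close>

lemma unif_exact_union:
  fixes X :: "'i \<Rightarrow> 'a set"
  assumes W: "W \<subseteq> carrier G" and cov: "\<And>g. g \<in> W \<Longrightarrow> g \<in> Y0 \<or> (\<exists>i\<in>I. g \<in> X i)"
    and X: "\<And>i. i \<in> I \<Longrightarrow> X i \<subseteq> carrier G" and uX: "unif_exact G (X ` I)"
    and sep: "\<And>F. finite F \<Longrightarrow> F \<subseteq> carrier G \<Longrightarrow> \<exists>Y. Y0 \<subseteq> Y \<and> Y \<subseteq> carrier G \<and> unif_exact G {Y} \<and>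
       (\<forall>g f i j. i \<in> I \<longrightarrow> j \<in> I \<longrightarrow> g \<in> X i \<longrightarrow> f \<in> F \<longrightarrow> g \<otimes> f \<in> X j \<longrightarrow> i \<noteq> j \<longrightarrow> g \<in> Y)"
  shows "unif_exact G {W}"
proof (rule unif_exact_combine[OF W, where 'i = "'i option"])
  fix F :: "'a set" and \<epsilon> :: real assume F: "finite F" "F \<subseteq> carrier G" "\<epsilon> > 0"
  from sep[OF F(1,2)] obtain Y where Y: "Y0 \<subseteq> Y" "Y \<subseteq> carrier G" "unif_exact G {Y}"
    and "\<forall>g f i j. i \<in> I \<longrightarrow> j \<in> I \<longrightarrow> g \<in> X i \<longrightarrow> f \<in> F \<longrightarrow> g \<otimes> f \<in> X j \<longrightarrow> i \<noteq> j \<longrightarrow> g \<in> Y"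
    by (elim exE conjE) (rule that)
  then have sepY: "\<And>g f i j. i \<in> I \<Longrightarrow> j \<in> I \<Longrightarrow> g \<in> X i \<Longrightarrow> f \<in> F \<Longrightarrow> g \<otimes> f \<in> X j \<Longrightarrow> i \<noteq> j \<Longrightarrow> g \<in> Y"
    by simp
  \<comment> \<open>Neighbours will have weights at distance at most \<open>2 / N\<close>.\<close>
  define N where "N = Suc (nat \<lceil>2 / \<epsilon>\<rceil>)"
  have N: "N > 0" "2 / real N \<le> \<epsilon>"
  proof -
    have "2 / \<epsilon> \<le> real N" unfolding N_def by linarith
    moreover show "0 < N" by (simp add: N_def)
    ultimately show "2 / real N \<le> \<epsilon>" using F(3) by (simp add: divide_le_eq mult.commute)
  qed
  \<comment> \<open>Inverses make the step count change by at most one in both directions, and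
    \<open>\<one>\<close> makes the sets \<open>Z k\<close> increase.\<close>
  define E where "E = F \<union> m_inv G ` F \<union> {\<one>}"
  have E: "finite E" "E \<subseteq> carrier G" using F by (auto simp: E_def)
  define Z where "Z k = ((\<lambda>A. A <#> E) ^^ k) Y" for k :: nat
  have ZSuc: "Z (Suc k) = Z k <#> E" for k by (simp add: Z_def)
  have Zc: "Z k \<subseteq> carrier G" for k
  proof (induction k)
    case 0 then show ?case using Y by (simp add: Z_def)
  next
    case (Suc k) then show ?case using E by (simp add: ZSuc set_mult_closed)
  qed
  have Zu: "unif_exact G {Z k}" for k
  proof (induction k)
    case 0 then show ?case using Y by (simp add: Z_def)
  next
    case (Suc k)
    show ?case
    proof (rule unif_exact_coarse[OF Suc E])
      fix U assume U: "U \<in> {Z (Suc k)}"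
      have "\<exists>w\<in>Z k. \<exists>t\<in>E. g = \<one> \<otimes> w \<otimes> t" if g: "g \<in> U" for g
      proof -
        obtain y e where "y \<in> Z k" "e \<in> E" "g = y \<otimes> e"
          using g U by (auto simp: ZSuc set_mult_def)
        moreover have "\<one> \<otimes> y = y" using Zc[of k] \<open>y \<in> Z k\<close> by (intro l_one) blast
        ultimately show ?thesis by metis
      qed
      then show "\<exists>h\<in>carrier G. \<exists>W\<in>{Z k}. \<forall>g\<in>U. \<exists>w\<in>W. \<exists>t\<in>E. g = h \<otimes> w \<otimes> t"
        by (intro bexI[of _ \<one>] bexI[of _ "Z k"]) auto
    qed (use Zc in auto)
  qed
  have Zstep: "g \<otimes> e \<in> Z (Suc k)" if "g \<in> Z k" "e \<in> E" for g e k
    using that by (auto simp: ZSuc set_mult_def)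
  have Zmono1: "Z k \<subseteq> Z (Suc k)" for k
  proof
    fix g assume g: "g \<in> Z k"
    then have "g \<otimes> \<one> \<in> Z (Suc k)" by (intro Zstep) (auto simp: E_def)
    moreover have "g \<otimes> \<one> = g" using g Zc[of k] by (intro r_one) blast
    ultimately show "g \<in> Z (Suc k)" by simp
  qed
  have Zmono: "Z j \<subseteq> Z k" if "j \<le> k" for j k
    by (rule lift_Suc_mono_le[of Z]) (use that Zmono1 in auto)
  \<comment> \<open>As the \<open>Z k\<close> increase, this is the first \<open>k\<close> with
    \<open>g \<in> Z k\<close>, or \<open>N\<close> if there is none below \<open>N\<close>.\<close>
  define \<rho> where "\<rho> g = card {k. k < N \<and> g \<notin> Z k}" for g
  have \<rho>_le: "\<rho> g \<le> N" for g
    unfolding \<rho>_def using card_mono[of "{..<N}" "{k. k < N \<and> g \<notin> Z k}"] by auto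
  have \<rho>0: "\<rho> g = 0" if "g \<in> Y" for g
    using that Zmono[of 0] by (auto simp: \<rho>_def Z_def)
  have \<rho>N: "g \<in> Z N" if "\<rho> g \<noteq> N" for g
  proof (rule ccontr)
    assume "g \<notin> Z N"
    then have "g \<notin> Z k" if "k < N" for k using Zmono[of k N] that by auto
    then have "{k. k < N \<and> g \<notin> Z k} = {..<N}" by auto
    then show False using that by (simp add: \<rho>_def)
  qed
  have \<rho>Suc: "\<rho> g \<le> Suc (\<rho> h)" if "\<And>k. h \<in> Z k \<Longrightarrow> g \<in> Z (Suc k)" for g h
  proof -
    have "{k. k < N \<and> g \<notin> Z k} \<subseteq> insert 0 (Suc ` {k. k < N \<and> h \<notin> Z k})"
    proof
      fix k assume k: "k \<in> {k. k < N \<and> g \<notin> Z k}"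
      show "k \<in> insert 0 (Suc ` {k. k < N \<and> h \<notin> Z k})"
        using k that by (cases k) auto
    qed
    then have "\<rho> g \<le> card (insert 0 (Suc ` {k. k < N \<and> h \<notin> Z k}))"
      unfolding \<rho>_def by (intro card_mono) auto
    also have "\<dots> \<le> Suc (card (Suc ` {k. k < N \<and> h \<notin> Z k}))" by (rule card_insert_le_m1) auto
    also have "\<dots> = Suc (\<rho> h)" by (simp add: \<rho>_def card_image)
    finally show ?thesis .
  qed
  have \<rho>dist: "\<bar>real (\<rho> g) - real (\<rho> (g \<otimes> f))\<bar> \<le> 1" if g: "g \<in> carrier G" "f \<in> F" for g f
  proof -
    have f: "f \<in> carrier G" using g F by blast
    have "g \<otimes> f \<in> Z (Suc k)" if "g \<in> Z k" for k using Zstep[OF that, of f] g by (auto simp: E_def)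
    then have 1: "\<rho> (g \<otimes> f) \<le> Suc (\<rho> g)" by (rule \<rho>Suc)
    have "g \<in> Z (Suc k)" if "g \<otimes> f \<in> Z k" for k
      using Zstep[OF that, of "inv f"] g f by (auto simp: E_def m_assoc)
    then have "\<rho> g \<le> Suc (\<rho> (g \<otimes> f))" by (rule \<rho>Suc)
    then show ?thesis using 1 by linarith
  qed
  define v where "v g = (SOME i. i \<in> I \<and> g \<in> X i)" for g
  have v: "v g \<in> I" "g \<in> X (v g)" if "g \<in> W" "g \<notin> Y" for g
  proof -
    have "\<exists>i. i \<in> I \<and> g \<in> X i" using cov that Y(1) by blast
    from someI_ex[OF this] show "v g \<in> I" "g \<in> X (v g)" by (auto simp: v_def)
  qed
  \<comment> \<open>\<open>None\<close> carries the weight of the neighbourhood \<open>Z N\<close>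
    of \<open>Y\<close>, \<open>Some i\<close> that of \<open>X i\<close>.\<close>
  define w where "w g = (\<lambda>j. case j of None \<Rightarrow> 1 - real (\<rho> g) / real N
     | Some i \<Rightarrow> if i = v g then real (\<rho> g) / real N else 0)" for g
  have w_out: "w g j = 0" if "j \<notin> {None, Some (v g)}" for g j
    using that by (auto simp: w_def split: option.splits)
  have 1: "fin_prob (w g)" for g
    by (rule fin_probI[of "{None, Some (v g)}"])
       (use w_out \<rho>_le[of g] N in \<open>auto simp: w_def split: option.splits\<close>)
  have 2: "l1 (\<lambda>j. w g j - w (g \<otimes> f) j) \<le> \<epsilon>" if g: "g \<in> W" "f \<in> F" "g \<otimes> f \<in> W" for g f
  proof -
    let ?A = "{None, Some (v g), Some (v (g \<otimes> f))}"
    have s: "supp (\<lambda>j. w g j - w (g \<otimes> f) j) \<subseteq> ?A"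
    proof
      fix j assume "j \<in> supp (\<lambda>j. w g j - w (g \<otimes> f) j)"
      then have "w g j \<noteq> 0 \<or> w (g \<otimes> f) j \<noteq> 0" by (auto simp: supp_def)
      then show "j \<in> ?A" using w_out[of j g] w_out[of j "g \<otimes> f"] by blast
    qed
    have l: "l1 (\<lambda>j. w g j - w (g \<otimes> f) j) = (\<Sum>j\<in>?A. \<bar>w g j - w (g \<otimes> f) j\<bar>)"
      by (rule l1_eq[OF _ s]) simp
    have gc: "g \<in> carrier G" using g W by blast
    define t where "t = real (\<rho> g) / real N"
    define t' where "t' = real (\<rho> (g \<otimes> f)) / real N"
    have tt: "0 \<le> t" "0 \<le> t'" by (auto simp: t_def t'_def)
    have "\<bar>t - t'\<bar> = \<bar>real (\<rho> g) - real (\<rho> (g \<otimes> f))\<bar> / real N"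
      by (simp add: t_def t'_def diff_divide_distrib[symmetric])
    also have "\<dots> \<le> 1 / real N" using \<rho>dist[OF gc g(2)] by (intro divide_right_mono) auto
    finally have "2 * \<bar>t - t'\<bar> \<le> 2 / real N" by simp
    then have d: "2 * \<bar>t - t'\<bar> \<le> \<epsilon>" using N(2) by (rule order_trans)
    have "l1 (\<lambda>j. w g j - w (g \<otimes> f) j) = 2 * \<bar>t - t'\<bar>"
    proof (cases "v g = v (g \<otimes> f)")
      case True
      then show ?thesis unfolding l by (simp add: w_def t_def t'_def)
    next
      case False
      have "g \<in> Y \<or> g \<otimes> f \<in> Y"
      proof (rule ccontr)
        assume n: "\<not> (g \<in> Y \<or> g \<otimes> f \<in> Y)"
        then have "g \<in> Y"
          using v[of g] v[of "g \<otimes> f"] g False by (intro sepY[of "v g" "v (g \<otimes> f)" g f]) simp_all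
        then show False using n by simp
      qed
      \<comment> \<open>The chosen piece changes only where one of \<open>t\<close>,
        \<open>t'\<close> is 0, and then \<open>t + t'\<close> equals
        \<open>\<bar>t - t'\<bar>\<close>.\<close>
      then have "t = 0 \<or> t' = 0" using \<rho>0 by (auto simp: t_def t'_def)
      moreover have "l1 (\<lambda>j. w g j - w (g \<otimes> f) j) = \<bar>t - t'\<bar> + t + t'"
        unfolding l using False tt by (simp add: w_def t_def[symmetric] t'_def[symmetric])
      ultimately show ?thesis using tt by auto
    qed
    then show ?thesis using d by simp
  qed
  have 3: "unif_exact G (range (\<lambda>j. {g \<in> W. w g j \<noteq> 0}))"
  proof (rule unif_exact_mono[OF unif_exact_Un[OF Zu[of N] uX]])
    fix U assume "U \<in> range (\<lambda>j. {g \<in> W. w g j \<noteq> 0})"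
    then obtain j where U: "U = {g \<in> W. w g j \<noteq> 0}" by blast
    show "\<exists>W\<in>{Z N} \<union> X ` I. U \<subseteq> W"
    proof (cases j)
      case None
      have "U \<subseteq> Z N"
      proof
        fix g assume "g \<in> U"
        then have "\<rho> g \<noteq> N" using N(1) by (auto simp: U None w_def)
        then show "g \<in> Z N" by (rule \<rho>N)
      qed
      then show ?thesis by blast
    next
      case (Some i)
      have "i \<in> I \<and> g \<in> X i" if "g \<in> U" for g
      proof -
        have g: "g \<in> W" "i = v g" "\<rho> g \<noteq> 0" using that by (auto simp: U Some w_def split: if_splits)
        then have "g \<notin> Y" using \<rho>0 by auto
        then show ?thesis using v[of g] g by simp
      qed
      then have "U \<subseteq> X i" by blast
      show ?thesis
      proof (cases "U = {}")
        case False
        then have "i \<in> I" using \<open>\<And>g. g \<in> U \<Longrightarrow> i \<in> I \<and> g \<in> X i\<close> by blast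
        then show ?thesis using \<open>U \<subseteq> X i\<close> by blast
      qed blast
    qed
  qed (use Zc X in blast)
  show "\<exists>w :: 'a \<Rightarrow> 'i option \<Rightarrow> real. (\<forall>g\<in>W. fin_prob (w g)) \<and>
        (\<forall>g\<in>W. \<forall>f\<in>F. g \<otimes> f \<in> W \<longrightarrow> l1 (\<lambda>i. w g i - w (g \<otimes> f) i) \<le> \<epsilon>) \<and>
        unif_exact G (range (\<lambda>i. {g \<in> W. w g i \<noteq> 0}))"
    using 1 2 3 by (intro exI[of _ w] conjI ballI impI) simp_all
qed

end

section \<open>Exactness and property A\<close>

text \<open>\<open>Z\<close> is the intersection of the closed sets containing it. For a set cut out
  by infinitely many closed conditions it is then enough to look at one violated condition.\<close>

lemma closedin_separate:
  assumes "Z \<subseteq> topspace T"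
    and "\<And>\<omega>. \<omega> \<in> topspace T \<Longrightarrow> \<omega> \<notin> Z \<Longrightarrow> \<exists>K. closedin T K \<and> Z \<subseteq> K \<and> \<omega> \<notin> K"
  shows "closedin T Z"
proof -
  have "closedin T (\<Inter>{K. closedin T K \<and> Z \<subseteq> K})"
    by (rule closedin_Inter) (use assms(1) in auto)
  moreover have "\<Inter>{K. closedin T K \<and> Z \<subseteq> K} = Z"
    using assms closedin_topspace[of T] by blast
  ultimately show ?thesis by simp
qed

text \<open>A point of the space is a whole family of measures: \<open>\<omega> (i, t, x)\<close> is
  the mass at \<open>x\<close> of the measure attached to \<open>t\<close>, for the tolerance
  \<open>i\<close>. Supports lie in a fixed finite set \<open>S i\<close>, so total mass 1 survives
  limits. The measure attached to \<open>\<one>\<close> is the required map: since \<open>s\<close>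
  shifts \<open>\<one>\<close> to \<open>s\<close>, the condition at \<open>t = \<one>\<close> is
  the inequality in the definition of amenability.\<close>

lemma (in group) exact_group_if_unif_exact:
  assumes ex: "unif_exact G {carrier G}"
  shows "exact_group G"
proof -
  \<comment> \<open>One space has to serve all finite sets and all \<open>\<epsilon>\<close>, so a
    point contains a solution for every pair.\<close>
  define Idx where "Idx = {(F, n :: nat). finite F \<and> F \<subseteq> carrier G}"
  define eps where "eps i = 1 / real (Suc (snd i))" for i :: "'a set \<times> nat"
  have "\<exists>S \<mu>. finite S \<and> S \<subseteq> carrier G \<and> (\<forall>t\<in>carrier G. (\<forall>x. 0 \<le> \<mu> t x) \<and> (\<forall>x. x \<notin> S \<longrightarrow> \<mu> t x = 0)
      \<and> (\<Sum>x\<in>S. \<mu> t x) = 1 \<and>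
      (\<forall>s\<in>fst i. (\<Sum>x\<in>S \<union> (s <# S). \<bar>\<mu> t (inv s \<otimes> x) - \<mu> (s \<otimes> t) x\<bar>) \<le> eps i))"
    if i: "i \<in> Idx" for i
  proof -
    \<comment> \<open>Inversion turns \<open>s \<otimes> t\<close> into
      \<open>inv t \<otimes> inv s\<close>, so the right factors in property A are inverses.\<close>
    let ?F = "m_inv G ` fst i"
    have F: "finite ?F" "?F \<subseteq> carrier G" "eps i > 0" "fst i \<subseteq> carrier G"
      using i by (auto simp: Idx_def eps_def)
    obtain S \<kappa> where S: "finite S" "S \<subseteq> carrier G"
      and pr: "\<And>W g. W \<in> {carrier G} \<Longrightarrow> g \<in> W \<Longrightarrow> fin_prob (\<kappa> W g)"
      and su: "\<And>W g. W \<in> {carrier G} \<Longrightarrow> g \<in> W \<Longrightarrow> supp (\<kappa> W g) \<subseteq> g <# S"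
      and le: "\<And>W g f. W \<in> {carrier G} \<Longrightarrow> g \<in> W \<Longrightarrow> f \<in> ?F \<Longrightarrow> g \<otimes> f \<in> W \<Longrightarrow>
         l1 (\<lambda>x. \<kappa> W g x - \<kappa> W (g \<otimes> f) x) \<le> eps i"
      by (rule unif_exactE[OF ex F(1-3)]) (rule that)
    define k where "k = \<kappa> (carrier G)"
    have pr: "fin_prob (k g)" if "g \<in> carrier G" for g using pr that by (simp add: k_def)
    have su: "supp (k g) \<subseteq> g <# S" if "g \<in> carrier G" for g using su that by (simp add: k_def)
    have le: "l1 (\<lambda>x. k g x - k (g \<otimes> f) x) \<le> eps i" if "g \<in> carrier G" "f \<in> ?F" for g f
      using le[of "carrier G" g f] that F by (auto simp: k_def subset_iff)
    \<comment> \<open>The measure at \<open>inv t\<close> lives on \<open>inv t <# S\<close>;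
      translated back by \<open>t\<close>, it lives on the same \<open>S\<close> for all
      \<open>t\<close>.\<close>
    define \<mu> where "\<mu> t x = (if x \<in> S then k (inv t) (inv t \<otimes> x) else 0)" for t x
    have mu: "\<mu> t x = k (inv t) (inv t \<otimes> x)" if t: "t \<in> carrier G" "x \<in> carrier G" for t x
    proof (cases "x \<in> S")
      case False
      have "inv t \<otimes> x \<notin> inv t <# S"
        using False t S by (subst mem_l_coset_iff) (auto simp: mult_inv_cancel)
      then have "inv t \<otimes> x \<notin> supp (k (inv t))" using su[of "inv t"] t by blast
      then show ?thesis using False by (simp add: \<mu>_def supp_def)
    qed (simp add: \<mu>_def)
    have bij: "bij_betw (\<lambda>x. inv t \<otimes> x) (carrier G) (carrier G)" if "t \<in> carrier G" for t
      using that by (intro bij_betw_mult_left) auto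
    have suc: "supp (k g) \<subseteq> carrier G" if "g \<in> carrier G" for g
      using su[OF that] l_coset_subset_carrier[OF that S(2)] by blast
    have 1: "(\<forall>x. 0 \<le> \<mu> t x) \<and> (\<forall>x. x \<notin> S \<longrightarrow> \<mu> t x = 0) \<and> (\<Sum>x\<in>S. \<mu> t x) = 1"
      if t: "t \<in> carrier G" for t
    proof (intro conjI allI impI)
      have p: "fin_prob (k (inv t))" using pr t by simp
      show "0 \<le> \<mu> t x" for x using fin_probD(2)[OF p] by (simp add: \<mu>_def)
      show "\<mu> t x = 0" if "x \<notin> S" for x using that by (simp add: \<mu>_def)
      then have s: "supp (\<mu> t) \<subseteq> S" by (auto simp: supp_def)
      have "(\<Sum>x\<in>S. \<mu> t x) = (\<Sum>x\<in>supp (\<mu> t). \<mu> t x)"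
        by (rule sum.mono_neutral_right[OF S(1) s]) (auto simp: supp_def)
      also have "\<dots> = (\<Sum>x\<in>supp (k (inv t)). k (inv t) x)"
        by (rule l1_reindex(3)[OF bij[OF t]]) (use suc t p fin_probD(1) mu s S in auto)
      also have "\<dots> = 1" using p by (simp add: fin_prob_def)
      finally show "(\<Sum>x\<in>S. \<mu> t x) = 1" .
    qed
    have 2: "(\<Sum>x\<in>S \<union> (s <# S). \<bar>\<mu> t (inv s \<otimes> x) - \<mu> (s \<otimes> t) x\<bar>) \<le> eps i"
      if t: "t \<in> carrier G" and s: "s \<in> fst i" for s t
    proof -
      have sc: "s \<in> carrier G" using s F by blast
      have st: "inv (s \<otimes> t) = inv t \<otimes> inv s" using sc t by (rule inv_mult_group)
      \<comment> \<open>Off \<open>S \<union> (s <# S)\<close> both terms vanish, so the finite sum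
        is a full \<open>l1\<close> norm and can be translated.\<close>
      define D where "D x = (if x \<in> S \<union> (s <# S) then \<mu> t (inv s \<otimes> x) - \<mu> (s \<otimes> t) x else 0)" for x
      have fS: "finite (S \<union> (s <# S))" using S by (simp add: l_coset_def)
      have Sc: "S \<union> (s <# S) \<subseteq> carrier G" using S l_coset_subset_carrier[OF sc] by simp
      have De: "D x = k (inv t) (inv (s \<otimes> t) \<otimes> x) - k (inv (s \<otimes> t)) (inv (s \<otimes> t) \<otimes> x)"
        if x: "x \<in> carrier G" for x
      proof -
        have a: "\<mu> t (inv s \<otimes> x) = k (inv t) (inv (s \<otimes> t) \<otimes> x)"
          using mu[of t "inv s \<otimes> x"] t sc x by (simp add: st m_assoc)
        have b: "\<mu> (s \<otimes> t) x = k (inv (s \<otimes> t)) (inv (s \<otimes> t) \<otimes> x)"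
          using mu[of "s \<otimes> t" x] t sc x by simp
        have "\<mu> t (inv s \<otimes> x) = 0 \<and> \<mu> (s \<otimes> t) x = 0" if "x \<notin> S \<union> (s <# S)"
          using that mem_l_coset_iff[OF sc S(2) x] by (simp add: \<mu>_def)
        then show ?thesis unfolding a[symmetric] b[symmetric] by (auto simp: D_def)
      qed
      have "(\<Sum>x\<in>S \<union> (s <# S). \<bar>\<mu> t (inv s \<otimes> x) - \<mu> (s \<otimes> t) x\<bar>) = l1 D"
        by (subst l1_eq[OF fS]) (auto simp: D_def supp_def)
      also have "\<dots> = l1 (\<lambda>x. k (inv t) x - k (inv (s \<otimes> t)) x)"
      proof (rule l1_reindex(2)[OF bij[of "s \<otimes> t"]])
        show "supp (\<lambda>x. k (inv t) x - k (inv (s \<otimes> t)) x) \<subseteq> carrier G"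
          by (rule order_trans[OF supp_diff_subset]) (use suc t sc in auto)
        show "finite (supp (\<lambda>x. k (inv t) x - k (inv (s \<otimes> t)) x))"
          using pr t sc by (intro finite_supp_diff fin_probD(1)) auto
        show "supp D \<subseteq> carrier G" using Sc by (auto simp: D_def supp_def split: if_splits)
      qed (use De t sc in auto)
      also have "\<dots> \<le> eps i" using le[of "inv t" "inv s"] t s by (simp add: st)
      finally show ?thesis .
    qed
    show ?thesis
      by (intro exI[of _ S] exI[of _ \<mu>] conjI S ballI) (use 1 2 in simp_all)
  qed
  then have "\<forall>i\<in>Idx. \<exists>S. \<exists>\<mu>. finite S \<and> S \<subseteq> carrier G \<and> (\<forall>t\<in>carrier G. (\<forall>x. 0 \<le> \<mu> t x) \<and> (\<forall>x. x \<notin> S \<longrightarrow> \<mu> t x = 0)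
      \<and> (\<Sum>x\<in>S. \<mu> t x) = 1 \<and>
      (\<forall>s\<in>fst i. (\<Sum>x\<in>S \<union> (s <# S). \<bar>\<mu> t (inv s \<otimes> x) - \<mu> (s \<otimes> t) x\<bar>) \<le> eps i))" by simp
  from bchoice[OF this] obtain S where "\<forall>i\<in>Idx. \<exists>\<mu>. finite (S i) \<and> S i \<subseteq> carrier G \<and> (\<forall>t\<in>carrier G. (\<forall>x. 0 \<le> \<mu> t x) \<and> (\<forall>x. x \<notin> S i \<longrightarrow> \<mu> t x = 0)
      \<and> (\<Sum>x\<in>S i. \<mu> t x) = 1 \<and>
      (\<forall>s\<in>fst i. (\<Sum>x\<in>S i \<union> (s <# S i). \<bar>\<mu> t (inv s \<otimes> x) - \<mu> (s \<otimes> t) x\<bar>) \<le> eps i))" ..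
  from bchoice[OF this] obtain \<mu> where S\<mu>: "\<forall>i\<in>Idx. finite (S i) \<and> S i \<subseteq> carrier G \<and> (\<forall>t\<in>carrier G. (\<forall>x. 0 \<le> \<mu> i t x) \<and> (\<forall>x. x \<notin> S i \<longrightarrow> \<mu> i t x = 0)
      \<and> (\<Sum>x\<in>S i. \<mu> i t x) = 1 \<and>
      (\<forall>s\<in>fst i. (\<Sum>x\<in>S i \<union> (s <# S i). \<bar>\<mu> i t (inv s \<otimes> x) - \<mu> i (s \<otimes> t) x\<bar>) \<le> eps i))" ..
  have S: "finite (S i)" "S i \<subseteq> carrier G" if "i \<in> Idx" for i using S\<mu> that by auto
  have fS: "finite (S i \<union> (s <# S i))" "S i \<union> (s <# S i) \<subseteq> carrier G" if "i \<in> Idx" "s \<in> fst i" for i s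
  proof -
    have sc: "s \<in> carrier G" using that by (auto simp: Idx_def)
    show "finite (S i \<union> (s <# S i))" using S(1)[OF that(1)] by (simp add: l_coset_def)
    show "S i \<union> (s <# S i) \<subseteq> carrier G" using S(2)[OF that(1)] l_coset_subset_carrier[OF sc] by simp
  qed
  define J where "J = Idx \<times> (carrier G \<times> carrier G)"
  define T where "T = powertop_real J"
  define C where "C = (\<lambda>i t x. {\<omega> \<in> topspace T. \<omega> (i, t, x) \<in> {0..1}})"
  define C1 where "C1 i t x = {\<omega> \<in> topspace T. \<omega> (i, t, x) \<in> {0}}" for i t x
  define C2 where "C2 i t = {\<omega> \<in> topspace T. (\<Sum>x\<in>S i. \<omega> (i, t, x)) \<in> {1}}" for i t
  define C3 where "C3 i t s = {\<omega> \<in> topspace T.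
     (\<Sum>x\<in>S i \<union> (s <# S i). \<bar>\<omega> (i, t, inv s \<otimes> x) - \<omega> (i, s \<otimes> t, x)\<bar>) \<in> {..eps i}}" for i t s
  define Z where "Z = {\<omega> \<in> topspace T. \<forall>i\<in>Idx. \<forall>t\<in>carrier G.
      (\<forall>x\<in>carrier G. \<omega> (i, t, x) \<in> {0..1}) \<and>
      (\<forall>x\<in>carrier G - S i. \<omega> (i, t, x) = 0) \<and>
      (\<Sum>x\<in>S i. \<omega> (i, t, x)) = 1 \<and>
      (\<forall>s\<in>fst i. (\<Sum>x\<in>S i \<union> (s <# S i). \<bar>\<omega> (i, t, inv s \<otimes> x) - \<omega> (i, s \<otimes> t, x)\<bar>) \<le> eps i)}"
  have tT: "topspace T = extensional J" by (simp add: T_def PiE_def)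
  have proj: "continuous_map T euclideanreal (\<lambda>\<omega>. \<omega> (i, t, x))"
    if "i \<in> Idx" "t \<in> carrier G" "x \<in> carrier G" for i t x
    unfolding T_def using that by (intro continuous_map_product_projection) (simp add: J_def)
  have clos: "closedin T Z"
  proof -
    have c1: "closedin T (C1 i t x)" if "i \<in> Idx" "t \<in> carrier G" "x \<in> carrier G" for i t x
      unfolding C1_def by (rule closedin_continuous_map_preimage[OF proj[OF that]]) simp
    have c2: "closedin T (C2 i t)" if "i \<in> Idx" "t \<in> carrier G" for i t
      unfolding C2_def
    proof (rule closedin_continuous_map_preimage[OF continuous_map_sum[OF S(1)[OF that(1)]]])
      show "continuous_map T euclideanreal (\<lambda>\<omega>. \<omega> (i, t, x))" if "x \<in> S i" for x
        by (rule proj) (use that \<open>i \<in> Idx\<close> \<open>t \<in> carrier G\<close> S(2)[OF \<open>i \<in> Idx\<close>] in auto)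
    qed simp
    have c3: "closedin T (C3 i t s)" if i: "i \<in> Idx" "t \<in> carrier G" "s \<in> fst i" for i t s
    proof -
      have s: "s \<in> carrier G" using i by (auto simp: Idx_def)
      have "continuous_map T euclideanreal (\<lambda>\<omega>. \<bar>\<omega> (i, t, inv s \<otimes> x) - \<omega> (i, s \<otimes> t, x)\<bar>)"
        if "x \<in> S i \<union> (s <# S i)" for x
        using fS(2)[OF i(1,3)] that i s
        by (intro continuous_map_real_abs continuous_map_diff proj) auto
      then show ?thesis unfolding C3_def
        by (intro closedin_continuous_map_preimage[OF continuous_map_sum[OF fS(1)[OF i(1,3)]]]) auto
    qed
    have c0: "closedin T (C i t x)" if "i \<in> Idx" "t \<in> carrier G" "x \<in> carrier G" for i t x
      unfolding C_def by (rule closedin_continuous_map_preimage[OF proj[OF that]]) simp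
    show ?thesis
    proof (rule closedin_separate)
      show "Z \<subseteq> topspace T" by (auto simp: Z_def)
      fix \<omega> assume \<omega>: "\<omega> \<in> topspace T" "\<omega> \<notin> Z"
      then have "\<not> (\<forall>i\<in>Idx. \<forall>t\<in>carrier G.
          (\<forall>x\<in>carrier G. \<omega> (i, t, x) \<in> {0..1}) \<and>
          (\<forall>x\<in>carrier G - S i. \<omega> (i, t, x) = 0) \<and>
          (\<Sum>x\<in>S i. \<omega> (i, t, x)) = 1 \<and>
          (\<forall>s\<in>fst i. (\<Sum>x\<in>S i \<union> (s <# S i). \<bar>\<omega> (i, t, inv s \<otimes> x) - \<omega> (i, s \<otimes> t, x)\<bar>) \<le> eps i))"
        by (simp only: Z_def mem_Collect_eq simp_thms)
      then obtain i t where i: "i \<in> Idx" "t \<in> carrier G" and "\<not> (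
          (\<forall>x\<in>carrier G. \<omega> (i, t, x) \<in> {0..1}) \<and>
          (\<forall>x\<in>carrier G - S i. \<omega> (i, t, x) = 0) \<and>
          (\<Sum>x\<in>S i. \<omega> (i, t, x)) = 1 \<and>
          (\<forall>s\<in>fst i. (\<Sum>x\<in>S i \<union> (s <# S i). \<bar>\<omega> (i, t, inv s \<otimes> x) - \<omega> (i, s \<otimes> t, x)\<bar>) \<le> eps i))"
        by meson
      then consider x where "x \<in> carrier G" "\<omega> (i, t, x) \<notin> {0..1}"
        | x where "x \<in> carrier G - S i" "\<omega> (i, t, x) \<noteq> 0"
        | "(\<Sum>x\<in>S i. \<omega> (i, t, x)) \<noteq> 1"
        | s where "s \<in> fst i"
            "\<not> (\<Sum>x\<in>S i \<union> (s <# S i). \<bar>\<omega> (i, t, inv s \<otimes> x) - \<omega> (i, s \<otimes> t, x)\<bar>) \<le> eps i"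
        by meson
      then show "\<exists>K. closedin T K \<and> Z \<subseteq> K \<and> \<omega> \<notin> K"
      proof cases
        case (1 x)
        then show ?thesis using c0[OF i 1(1)] i
          by (intro exI[of _ "C i t x"]) (auto simp: C_def Z_def)
      next
        case (2 x)
        then show ?thesis using c1[OF i, of x] i
          by (intro exI[of _ "C1 i t x"]) (auto simp: C1_def Z_def)
      next
        case 3
        then show ?thesis using c2[OF i] i
          by (intro exI[of _ "C2 i t"]) (auto simp: C2_def Z_def)
      next
        case (4 s)
        then show ?thesis using c3[OF i 4(1)] i
          by (intro exI[of _ "C3 i t s"]) (auto simp: C3_def Z_def)
      qed
    qed
  qed
  have Zsub: "Z \<subseteq> topspace T" by (auto simp: Z_def)
  have comp: "compactin T Z"
  proof (rule closed_compactin[OF _ _ clos])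
    show "compactin T (Pi\<^sub>E J (\<lambda>_. {0..1}))" unfolding T_def by (simp add: compactin_PiE)
    show "Z \<subseteq> Pi\<^sub>E J (\<lambda>_. {0..1})"
    proof
      fix \<omega> assume "\<omega> \<in> Z"
      then have "\<omega> \<in> extensional J" "\<And>i t x. i \<in> Idx \<Longrightarrow> t \<in> carrier G \<Longrightarrow> x \<in> carrier G \<Longrightarrow> \<omega> (i, t, x) \<in> {0..1}"
        unfolding Z_def tT by blast+
      then show "\<omega> \<in> Pi\<^sub>E J (\<lambda>_. {0..1})" by (auto simp: PiE_def J_def)
    qed
  qed
  define X where "X = subtopology T Z"
  have tX: "topspace X = Z" using Zsub by (simp add: X_def Int_absorb1)
  have cX: "compact_space X" using comp by (simp add: X_def compact_space_subtopology)
  have hX: "Hausdorff_space X" unfolding X_def T_def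
    by (rule Hausdorff_space_subtopology) (simp add: Hausdorff_space_product_topology)
  \<comment> \<open>Right multiplication of the argument gives a left action: applying
    \<open>h\<close> and then \<open>g\<close> replaces \<open>t\<close> by
    \<open>t \<otimes> g \<otimes> h\<close>.\<close>
  define act where "act g \<omega> = (\<lambda>(i, t, x)\<in>J. \<omega> (i, t \<otimes> g, x))" for g and \<omega> :: "('a set \<times> nat) \<times> 'a \<times> 'a \<Rightarrow> real"
  have act_apply: "act g \<omega> (i, t, x) = \<omega> (i, t \<otimes> g, x)"
    if "i \<in> Idx" "t \<in> carrier G" "x \<in> carrier G" for g \<omega> i t x
    using that by (simp add: act_def J_def)
  have act_Z: "act g \<omega> \<in> Z" if g: "g \<in> carrier G" and \<omega>: "\<omega> \<in> Z" for g \<omega>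
    unfolding Z_def
  proof (intro CollectI conjI ballI)
    show "act g \<omega> \<in> topspace T" by (simp add: tT act_def)
    fix i t assume i: "i \<in> Idx" "t \<in> carrier G"
    have tg: "t \<otimes> g \<in> carrier G" using i g by simp
    show "act g \<omega> (i, t, x) \<in> {0..1}" if "x \<in> carrier G" for x
      unfolding act_apply[OF i that] using \<omega> tg i that unfolding Z_def by blast
    show "act g \<omega> (i, t, x) = 0" if "x \<in> carrier G - S i" for x
      using \<omega> tg i that act_apply[OF i, of x] unfolding Z_def by auto
    have "(\<Sum>x\<in>S i. act g \<omega> (i, t, x)) = (\<Sum>x\<in>S i. \<omega> (i, t \<otimes> g, x))"
      using act_apply[OF i] S[OF i(1)] by (intro sum.cong) auto
    also have "\<dots> = 1" using \<omega> tg i unfolding Z_def by blast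
    finally show "(\<Sum>x\<in>S i. act g \<omega> (i, t, x)) = 1" .
    fix s assume s: "s \<in> fst i"
    then have sc: "s \<in> carrier G" using i by (auto simp: Idx_def)
    have "(\<Sum>x\<in>S i \<union> (s <# S i). \<bar>act g \<omega> (i, t, inv s \<otimes> x) - act g \<omega> (i, s \<otimes> t, x)\<bar>)
        = (\<Sum>x\<in>S i \<union> (s <# S i). \<bar>\<omega> (i, t \<otimes> g, inv s \<otimes> x) - \<omega> (i, s \<otimes> (t \<otimes> g), x)\<bar>)"
    proof (rule sum.cong[OF refl])
      fix x assume "x \<in> S i \<union> (s <# S i)"
      then have "x \<in> carrier G" using fS(2)[OF i(1) s] by blast
      then show "\<bar>act g \<omega> (i, t, inv s \<otimes> x) - act g \<omega> (i, s \<otimes> t, x)\<bar>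
          = \<bar>\<omega> (i, t \<otimes> g, inv s \<otimes> x) - \<omega> (i, s \<otimes> (t \<otimes> g), x)\<bar>"
        using i sc g by (simp add: act_apply m_assoc)
    qed
    also have "\<dots> \<le> eps i" using \<omega> tg i s unfolding Z_def by blast
    finally show "(\<Sum>x\<in>S i \<union> (s <# S i). \<bar>act g \<omega> (i, t, inv s \<otimes> x) - act g \<omega> (i, s \<otimes> t, x)\<bar>) \<le> eps i" .
  qed
  have act_comp: "act g (act h \<omega>) = act (g \<otimes> h) \<omega>" if "g \<in> carrier G" "h \<in> carrier G" for g h \<omega>
    using that by (auto simp: act_def J_def m_assoc fun_eq_iff restrict_def)
  have act_one: "act \<one> \<omega> = \<omega>" if "\<omega> \<in> Z" for \<omega>
  proof
    have e: "\<omega> \<in> extensional J" using that Zsub tT by blast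
    fix j show "act \<one> \<omega> j = \<omega> j"
      using extensional_arb[OF e, of j] by (cases j) (auto simp: act_def J_def)
  qed
  have act_cont: "continuous_map X X (act g)" if g: "g \<in> carrier G" for g
  proof -
    have "continuous_map X T (act g)"
      unfolding T_def continuous_map_componentwise
    proof (intro conjI ballI)
      show "act g ` topspace X \<subseteq> extensional J" by (auto simp: act_def)
      fix j assume "j \<in> J"
      then obtain i t x where j: "j = (i, t, x)" "i \<in> Idx" "t \<in> carrier G" "x \<in> carrier G"
        by (auto simp: J_def)
      have "continuous_map X euclideanreal (\<lambda>\<omega>. \<omega> (i, t \<otimes> g, x))"
        unfolding X_def by (rule continuous_map_from_subtopology) (use proj j g in simp)
      then show "continuous_map X euclideanreal (\<lambda>\<omega>. act g \<omega> j)"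
        using j by (simp add: act_apply)
    qed
    then show ?thesis using act_Z[OF g] tX
      unfolding X_def continuous_map_in_subtopology by (auto simp: X_def)
  qed
  define a where "a g = restrict (act g) Z" for g
  have aZ: "a g \<omega> = act g \<omega>" if "\<omega> \<in> Z" for g \<omega> using that by (simp add: a_def)
  have homeo: "homeomorphic_maps X X (a g) (a (inv g))" if g: "g \<in> carrier G" for g
  proof -
    have "continuous_map X X (a g)" if "g \<in> carrier G" for g
      by (rule continuous_map_eq[OF act_cont[OF that]]) (simp add: tX aZ)
    then show ?thesis using g
      by (auto simp: homeomorphic_maps_def tX aZ act_Z act_comp act_one)
  qed
  have aB: "a g \<in> Bij Z" if g: "g \<in> carrier G" for g
  proof -
    have "bij_betw (a g) Z Z"
      by (rule bij_betw_byWitness[where f' = "a (inv g)"])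
         (use g in \<open>auto simp: aZ act_Z act_comp act_one\<close>)
    then show ?thesis by (simp add: Bij_def a_def)
  qed
  have ga: "group_action G (topspace X) a"
  proof -
    have "a \<in> hom G (BijGroup Z)"
    proof (rule homI)
      show "a g \<in> carrier (BijGroup Z)" if "g \<in> carrier G" for g
        using aB[OF that] by (simp add: BijGroup_def)
      show "a (g \<otimes> h) = a g \<otimes>\<^bsub>BijGroup Z\<^esub> a h" if "g \<in> carrier G" "h \<in> carrier G" for g h
        using aB that by (auto simp: BijGroup_def compose_def a_def act_Z act_comp fun_eq_iff)
    qed
    then show ?thesis
      unfolding group_action_def tX
      by (simp add: group_hom_def group_hom_axioms_def group_BijGroup is_group)
  qed
  have ne: "topspace X \<noteq> {}"
  proof -
    define \<omega>0 where "\<omega>0 = (\<lambda>(i, t, x)\<in>J. \<mu> i t x)"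
    have ap: "\<omega>0 (i, t, x) = \<mu> i t x" if "i \<in> Idx" "t \<in> carrier G" "x \<in> carrier G" for i t x
      using that by (simp add: \<omega>0_def J_def)
    have "\<omega>0 \<in> Z" unfolding Z_def
    proof (intro CollectI conjI ballI)
      show "\<omega>0 \<in> topspace T" by (simp add: tT \<omega>0_def)
      fix i t assume i: "i \<in> Idx" "t \<in> carrier G"
      then have m: "\<And>x. 0 \<le> \<mu> i t x" "\<And>x. x \<notin> S i \<Longrightarrow> \<mu> i t x = 0" "(\<Sum>x\<in>S i. \<mu> i t x) = 1"
        "\<And>s. s \<in> fst i \<Longrightarrow> (\<Sum>x\<in>S i \<union> (s <# S i). \<bar>\<mu> i t (inv s \<otimes> x) - \<mu> i (s \<otimes> t) x\<bar>) \<le> eps i"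
        using S\<mu> by simp_all
      show "\<omega>0 (i, t, x) \<in> {0..1}" if "x \<in> carrier G" for x
      proof (cases "x \<in> S i")
        case True
        then have "\<mu> i t x \<le> (\<Sum>x\<in>S i. \<mu> i t x)" by (rule member_le_sum) (use m S[OF i(1)] in auto)
        then show ?thesis using m by (simp add: ap i that)
      qed (simp add: ap i that m)
      show "\<omega>0 (i, t, x) = 0" if "x \<in> carrier G - S i" for x using that m by (simp add: ap i)
      have "(\<Sum>x\<in>S i. \<omega>0 (i, t, x)) = (\<Sum>x\<in>S i. \<mu> i t x)"
        using S[OF i(1)] i by (intro sum.cong) (auto simp: ap)
      then show "(\<Sum>x\<in>S i. \<omega>0 (i, t, x)) = 1" using m by simp
      fix s assume s: "s \<in> fst i"
      then have sc: "s \<in> carrier G" using i by (auto simp: Idx_def)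
      have "(\<Sum>x\<in>S i \<union> (s <# S i). \<bar>\<omega>0 (i, t, inv s \<otimes> x) - \<omega>0 (i, s \<otimes> t, x)\<bar>)
        = (\<Sum>x\<in>S i \<union> (s <# S i). \<bar>\<mu> i t (inv s \<otimes> x) - \<mu> i (s \<otimes> t) x\<bar>)"
      proof (rule sum.cong[OF refl])
        fix x assume "x \<in> S i \<union> (s <# S i)"
        then have "x \<in> carrier G" using fS(2)[OF i(1) s] by blast
        then show "\<bar>\<omega>0 (i, t, inv s \<otimes> x) - \<omega>0 (i, s \<otimes> t, x)\<bar> = \<bar>\<mu> i t (inv s \<otimes> x) - \<mu> i (s \<otimes> t) x\<bar>"
          using i sc by (simp add: ap)
      qed
      then show "(\<Sum>x\<in>S i \<union> (s <# S i). \<bar>\<omega>0 (i, t, inv s \<otimes> x) - \<omega>0 (i, s \<otimes> t, x)\<bar>) \<le> eps i"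
        using m(4)[OF s] by simp
    qed
    then show ?thesis using tX by blast
  qed
  have approx: "\<exists>\<nu>. continuous_map X (prob_topology G) \<nu> \<and>
      (\<forall>s\<in>F. \<forall>\<omega>\<in>topspace X. l1_dist G (translate G s (\<nu> \<omega>)) (\<nu> (a s \<omega>)) \<le> \<epsilon>)"
    if F: "finite F \<and> F \<subseteq> carrier G \<and> (\<epsilon>::real) > 0" for F \<epsilon>
  proof -
    obtain n :: nat where n: "1 / real (Suc n) < \<epsilon>" using F nat_approx_posE by blast
    define i where "i = (F, n)"
    have i: "i \<in> Idx" "fst i = F" "eps i \<le> \<epsilon>" using F n by (auto simp: i_def Idx_def eps_def)
    define \<nu> where "\<nu> \<omega> = (\<lambda>x\<in>carrier G. \<omega> (i, \<one>, x))" for \<omega> :: "('a set \<times> nat) \<times> 'a \<times> 'a \<Rightarrow> real"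
    have Zi: "(\<forall>x\<in>carrier G. \<omega> (i, t, x) \<in> {0..1})" "(\<forall>x\<in>carrier G - S i. \<omega> (i, t, x) = 0)"
      "(\<Sum>x\<in>S i. \<omega> (i, t, x)) = 1"
      "(\<forall>s\<in>F. (\<Sum>x\<in>S i \<union> (s <# S i). \<bar>\<omega> (i, t, inv s \<otimes> x) - \<omega> (i, s \<otimes> t, x)\<bar>) \<le> eps i)"
      if "\<omega> \<in> Z" "t \<in> carrier G" for \<omega> t
      using that i(1) i(2) unfolding Z_def by blast+
    have prob: "\<nu> \<omega> \<in> prob_on G" if \<omega>: "\<omega> \<in> Z" for \<omega>
    proof -
      have "(\<nu> \<omega> has_sum (\<Sum>x\<in>S i. \<nu> \<omega> x)) (S i)" using S(1)[OF i(1)] by (rule has_sum_finite)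
      also have "(\<Sum>x\<in>S i. \<nu> \<omega> x) = (\<Sum>x\<in>S i. \<omega> (i, \<one>, x))"
        using S(2)[OF i(1)] by (intro sum.cong) (auto simp: \<nu>_def)
      also have "\<dots> = 1" using Zi(3)[OF \<omega>] by simp
      finally have "(\<nu> \<omega> has_sum 1) (S i)" .
      then have "(\<nu> \<omega> has_sum 1) (carrier G)"
        by (rule has_sum_cong_neutral[THEN iffD1, rotated -1])
           (use S(2)[OF i(1)] Zi(2)[OF \<omega>, of \<one>] in \<open>auto simp: \<nu>_def\<close>)
      then show ?thesis using Zi(1)[OF \<omega>, of \<one>] by (auto simp: prob_on_def \<nu>_def)
    qed
    have "continuous_map X (prob_topology G) \<nu>"
      unfolding prob_topology_def continuous_map_in_subtopology continuous_map_componentwise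
    proof (intro conjI ballI)
      show "\<nu> ` topspace X \<subseteq> extensional (carrier G)" by (auto simp: \<nu>_def)
      show "\<nu> \<in> topspace X \<rightarrow> prob_on G" using prob tX by blast
      fix x assume x: "x \<in> carrier G"
      have "continuous_map X euclideanreal (\<lambda>\<omega>. \<omega> (i, \<one>, x))"
        unfolding X_def by (rule continuous_map_from_subtopology) (use proj i x in simp)
      then show "continuous_map X euclideanreal (\<lambda>\<omega>. \<nu> \<omega> x)" using x by (simp add: \<nu>_def)
    qed
    moreover have "l1_dist G (translate G s (\<nu> \<omega>)) (\<nu> (a s \<omega>)) \<le> \<epsilon>" if s: "s \<in> F" and \<omega>: "\<omega> \<in> Z" for s \<omega>
    proof -
      let ?A = "S i \<union> (s <# S i)"
      have sc: "s \<in> carrier G" using s F by blast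
      have A: "finite ?A" "?A \<subseteq> carrier G" using fS[OF i(1), of s] s i(2) by auto
      have e: "\<bar>translate G s (\<nu> \<omega>) x - \<nu> (a s \<omega>) x\<bar> = \<bar>\<omega> (i, \<one>, inv s \<otimes> x) - \<omega> (i, s \<otimes> \<one>, x)\<bar>"
        if "x \<in> carrier G" for x
        using that sc i \<omega> by (simp add: translate_def \<nu>_def aZ act_apply)
      have z: "\<bar>\<omega> (i, \<one>, inv s \<otimes> x) - \<omega> (i, s \<otimes> \<one>, x)\<bar> = 0" if x: "x \<in> carrier G - ?A" for x
      proof -
        have "inv s \<otimes> x \<in> carrier G - S i"
          using x sc mem_l_coset_iff[OF sc S(2)[OF i(1)], of x] by auto
        then show ?thesis using Zi(2)[OF \<omega>, of \<one>] Zi(2)[OF \<omega>, of s] x sc by simp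
      qed
      have "l1_dist G (translate G s (\<nu> \<omega>)) (\<nu> (a s \<omega>))
          = (\<Sum>\<^sub>\<infinity>x\<in>carrier G. \<bar>\<omega> (i, \<one>, inv s \<otimes> x) - \<omega> (i, s \<otimes> \<one>, x)\<bar>)"
        unfolding l1_dist_def using e by (rule infsum_cong)
      also have "\<dots> = (\<Sum>\<^sub>\<infinity>x\<in>?A. \<bar>\<omega> (i, \<one>, inv s \<otimes> x) - \<omega> (i, s \<otimes> \<one>, x)\<bar>)"
        by (rule infsum_cong_neutral) (use z A(2) in auto)
      also have "\<dots> = (\<Sum>x\<in>?A. \<bar>\<omega> (i, \<one>, inv s \<otimes> x) - \<omega> (i, s \<otimes> \<one>, x)\<bar>)"
        using A(1) by (rule infsum_finite)
      also have "\<dots> \<le> eps i" using Zi(4)[OF \<omega>, of \<one>] s by blast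
      finally show ?thesis using i(3) by simp
    qed
    ultimately show ?thesis using tX by blast
  qed
  have "amenable_action G X a"
    unfolding amenable_action_def
  proof (intro conjI cX hX ga ballI allI impI)
    show "\<exists>\<nu>. continuous_map X (prob_topology G) \<nu> \<and>
      (\<forall>s\<in>F. \<forall>\<omega>\<in>topspace X. l1_dist G (translate G s (\<nu> \<omega>)) (\<nu> (a s \<omega>)) \<le> \<epsilon>)"
      if "finite F \<and> F \<subseteq> carrier G \<and> (\<epsilon>::real) > 0" for F \<epsilon>
      by (rule approx[OF that])
    show "homeomorphic_map X X (a g)" if "g \<in> carrier G" for g
      using homeo[OF that] homeomorphic_maps_map by blast
  qed
  then show ?thesis by (rule exact_groupI[OF ne])
qed

section \<open>From amenable actions back to property A\<close>

lemma prob_on_tight: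
  assumes X: "compact_space X" and \<mu>: "continuous_map X (prob_topology G) \<mu>" and \<delta>: "(\<delta>::real) > 0"
  obtains S where "finite S" "S \<subseteq> carrier G" "\<And>\<omega>. \<omega> \<in> topspace X \<Longrightarrow> (\<Sum>x\<in>S. \<mu> \<omega> x) > 1 - \<delta>"
proof -
  have \<mu>': "continuous_map X (powertop_real (carrier G)) \<mu>" and pr: "\<And>\<omega>. \<omega> \<in> topspace X \<Longrightarrow> \<mu> \<omega> \<in> prob_on G"
    using \<mu> unfolding prob_topology_def continuous_map_in_subtopology by auto
  have proj: "continuous_map X euclideanreal (\<lambda>\<omega>. \<mu> \<omega> x)" if "x \<in> carrier G" for x
    using \<mu>' that unfolding continuous_map_componentwise by blast
  \<comment> \<open>Finite sums are continuous in the pointwise topology, so these sets are open for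
    finite \<open>A\<close>; they cover the space because each \<open>\<mu> \<omega>\<close> has
    total mass 1.\<close>
  define U where "U A = {\<omega> \<in> topspace X. (\<Sum>x\<in>A. \<mu> \<omega> x) \<in> {1 - \<delta><..}}" for A
  define \<A> where "\<A> = {A. finite A \<and> A \<subseteq> carrier G}"
  have op: "openin X (U A)" if "A \<in> \<A>" for A
    unfolding U_def
    by (rule openin_continuous_map_preimage[OF continuous_map_sum])
       (use that proj in \<open>auto simp: \<A>_def\<close>)
  have cov: "topspace X \<subseteq> \<Union>(U ` \<A>)"
  proof
    fix \<omega> assume \<omega>: "\<omega> \<in> topspace X"
    have "(\<mu> \<omega> has_sum 1) (carrier G)" using pr[OF \<omega>] by (simp add: prob_on_def)
    then have "(sum (\<mu> \<omega>) \<longlongrightarrow> 1) (finite_subsets_at_top (carrier G))" by (simp add: has_sum_def)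
    then have "eventually (\<lambda>A. sum (\<mu> \<omega>) A > 1 - \<delta>) (finite_subsets_at_top (carrier G))"
      by (rule order_tendstoD(1)) (use \<delta> in simp)
    then obtain A where "finite A" "A \<subseteq> carrier G" "sum (\<mu> \<omega>) A > 1 - \<delta>"
      unfolding eventually_finite_subsets_at_top by blast
    then show "\<omega> \<in> \<Union>(U ` \<A>)" using \<omega> by (auto simp: U_def \<A>_def)
  qed
  have "\<exists>\<F>. finite \<F> \<and> \<F> \<subseteq> U ` \<A> \<and> topspace X \<subseteq> \<Union>\<F>"
    using X cov op unfolding compact_space_def compactin_def by auto
  then obtain \<B> where \<B>: "finite \<B>" "\<B> \<subseteq> \<A>" "topspace X \<subseteq> \<Union>(U ` \<B>)"
    by (metis finite_subset_image)
  show thesis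
  proof (rule that[of "\<Union>\<B>"])
    show fin: "finite (\<Union>\<B>)" and sub: "\<Union>\<B> \<subseteq> carrier G" using \<B>(1,2) by (auto simp: \<A>_def)
    fix \<omega> assume \<omega>: "\<omega> \<in> topspace X"
    then obtain A where A: "A \<in> \<B>" "\<omega> \<in> U A" using \<B>(3) by blast
    have "1 - \<delta> < (\<Sum>x\<in>A. \<mu> \<omega> x)" using A(2) by (simp add: U_def)
    also have "\<dots> \<le> (\<Sum>x\<in>\<Union>\<B>. \<mu> \<omega> x)"
      by (rule sum_mono2[OF fin]) (use A(1) sub pr[OF \<omega>] in \<open>auto simp: prob_on_def\<close>)
    finally show "(\<Sum>x\<in>\<Union>\<B>. \<mu> \<omega> x) > 1 - \<delta>" .
  qed
qed

text \<open>The mass missing from \<open>S\<close> is put on the point \<open>e\<close>. The error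
  is at most this mass plus the equal mass that \<open>m\<close> has outside
  \<open>S\<close>.\<close>

lemma truncate_prob:
  assumes m: "m \<in> prob_on H" and S: "finite S" "S \<subseteq> carrier H" "e \<in> S"
    and \<delta>: "(\<Sum>x\<in>S. m x) > 1 - (\<delta>::real)"
  defines "\<nu> \<equiv> (\<lambda>x. if x \<in> S then m x + (if x = e then 1 - (\<Sum>x\<in>S. m x) else 0) else 0)"
  shows "fin_prob \<nu>" "finite A \<Longrightarrow> A \<subseteq> carrier H \<Longrightarrow> (\<Sum>x\<in>A. \<bar>\<nu> x - m x\<bar>) \<le> 2 * \<delta>"
proof -
  have m0: "0 \<le> m x" if "x \<in> carrier H" for x using m that by (simp add: prob_on_def)
  have le1: "(\<Sum>x\<in>B. m x) \<le> 1" if "finite B" "B \<subseteq> carrier H" for B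
    by (rule finite_sum_le_has_sum[where A = "carrier H"]) (use m that in \<open>auto simp: prob_on_def\<close>)
  have S1: "(\<Sum>x\<in>S. m x) \<le> 1" using le1 S by blast
  show "fin_prob \<nu>"
  proof (rule fin_probI[OF S(1)])
    show "0 \<le> \<nu> x" if "x \<in> S" for x using S1 m0 S(2) that by (auto simp: \<nu>_def)
    have "(\<Sum>x\<in>S. \<nu> x) = (\<Sum>x\<in>S. m x) + (\<Sum>x\<in>S. if x = e then 1 - (\<Sum>x\<in>S. m x) else 0)"
      by (simp add: \<nu>_def sum.distrib)
    then show "(\<Sum>x\<in>S. \<nu> x) = 1" using S by simp
  qed (simp add: \<nu>_def)
  assume A: "finite A" "A \<subseteq> carrier H"
  have "(\<Sum>x\<in>A. \<bar>\<nu> x - m x\<bar>) \<le> (\<Sum>x\<in>A \<union> S. \<bar>\<nu> x - m x\<bar>)"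
    by (rule sum_mono2) (use A S in auto)
  also have "\<dots> = (\<Sum>x\<in>A - S. \<bar>\<nu> x - m x\<bar>) + (\<Sum>x\<in>S. \<bar>\<nu> x - m x\<bar>)"
    using A(1) S(1) by (metis Diff_disjoint Int_commute Un_Diff_cancel2 finite_Diff sum.union_disjoint)
  also have "(\<Sum>x\<in>S. \<bar>\<nu> x - m x\<bar>) = (\<Sum>x\<in>S. if x = e then 1 - (\<Sum>x\<in>S. m x) else 0)"
    using S1 by (intro sum.cong) (auto simp: \<nu>_def)
  also have "\<dots> = 1 - (\<Sum>x\<in>S. m x)" using S by simp
  also have "(\<Sum>x\<in>A - S. \<bar>\<nu> x - m x\<bar>) = (\<Sum>x\<in>A - S. m x)"
  proof (rule sum.cong[OF refl])
    fix x assume "x \<in> A - S"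
    then have "0 \<le> m x" "\<nu> x = 0" using m0 A(2) by (auto simp: \<nu>_def)
    then show "\<bar>\<nu> x - m x\<bar> = m x" by simp
  qed
  also have "\<dots> = (\<Sum>x\<in>(A - S) \<union> S. m x) - (\<Sum>x\<in>S. m x)"
    using A(1) S(1) by (subst sum.union_disjoint) auto
  also have "(\<Sum>x\<in>(A - S) \<union> S. m x) \<le> 1" by (rule le1) (use A S in auto)
  finally show "(\<Sum>x\<in>A. \<bar>\<nu> x - m x\<bar>) \<le> 2 * \<delta>" using \<delta> by simp
qed

text \<open>Along the orbit of one point, \<open>m (s \<otimes> t)\<close> is close to the translate
  of \<open>m t\<close> by \<open>s\<close>. Tightness yields one \<open>S\<close> for all
  \<open>t\<close>, and translation by \<open>inv t\<close> turns the truncation of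
  \<open>m t\<close> into a measure on \<open>inv t <# S\<close>.\<close>

lemma (in group) unif_exact_if_exact_subgroup:
  assumes K: "subgroup K G" and ex: "exact_group (G\<lparr>carrier := K\<rparr>)"
  shows "unif_exact G {K}"
  unfolding unif_exact_def
proof (intro allI impI)
  fix F :: "'a set" and \<epsilon> :: real assume F: "finite F \<and> F \<subseteq> carrier G \<and> \<epsilon> > 0"
  let ?H = "G\<lparr>carrier := K\<rparr>"
  have Kc: "x \<in> carrier G" if "x \<in> K" for x using subgroup.mem_carrier[OF K that] .
  have Ki: "inv x \<in> K" if "x \<in> K" for x using subgroup.m_inv_closed[OF K that] .
  have Km: "x \<otimes> y \<in> K" if "x \<in> K" "y \<in> K" for x y using subgroup.m_closed[OF K that] .
  have Kone: "\<one> \<in> K" using subgroup.one_closed[OF K] .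
  obtain X :: "'a set set topology" and a where ne: "topspace X \<noteq> {}" and am: "amenable_action ?H X a"
    using ex unfolding exact_group_def by blast
  have cX: "compact_space X" and ga: "group_action ?H (topspace X) a"
    using am by (auto simp: amenable_action_def)
  \<comment> \<open>If \<open>g\<close> and \<open>g \<otimes> f\<close> lie in \<open>K\<close>,
    then so does \<open>f\<close>; hence the intersection with \<open>K\<close>.\<close>
  define F' where "F' = m_inv G ` (F \<inter> K)"
  have F': "finite F' \<and> F' \<subseteq> carrier ?H \<and> \<epsilon> / 2 > 0" using F Ki by (auto simp: F'_def)
  obtain \<mu> where \<mu>: "continuous_map X (prob_topology ?H) \<mu>"
    and \<mu>le: "\<And>s \<omega>. s \<in> F' \<Longrightarrow> \<omega> \<in> topspace X \<Longrightarrow> l1_dist ?H (translate ?H s (\<mu> \<omega>)) (\<mu> (a s \<omega>)) \<le> \<epsilon> / 2"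
    using am[unfolded amenable_action_def, THEN conjunct2, THEN conjunct2, THEN conjunct2, THEN conjunct2,
      rule_format, OF F'] by blast
  \<comment> \<open>Two truncations cost \<open>2 * \<delta>\<close> each, and
    \<open>\<epsilon> / 2 + 4 * \<delta> = \<epsilon>\<close>.\<close>
  define \<delta> where "\<delta> = \<epsilon> / 8"
  have \<delta>: "\<delta> > 0" using F by (simp add: \<delta>_def)
  obtain S0 where S0: "finite S0" "S0 \<subseteq> carrier ?H" "\<And>\<omega>. \<omega> \<in> topspace X \<Longrightarrow> (\<Sum>x\<in>S0. \<mu> \<omega> x) > 1 - \<delta>"
    by (rule prob_on_tight[OF cX \<mu> \<delta>]) (rule that)
  have pr: "\<mu> \<omega> \<in> prob_on ?H" if "\<omega> \<in> topspace X" for \<omega>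
    using \<mu> that unfolding prob_topology_def continuous_map_in_subtopology by auto
  \<comment> \<open>\<open>\<one>\<close> is added as the place that receives the missing
    mass.\<close>
  define S where "S = insert \<one> S0"
  have S: "finite S" "S \<subseteq> K" "\<one> \<in> S" using S0 Kone by (auto simp: S_def)
  have Sc: "S \<subseteq> carrier G" using S(2) Kc by blast
  have S\<delta>: "(\<Sum>x\<in>S. \<mu> \<omega> x) > 1 - \<delta>" if \<omega>: "\<omega> \<in> topspace X" for \<omega>
  proof -
    have "(\<Sum>x\<in>S0. \<mu> \<omega> x) \<le> (\<Sum>x\<in>S. \<mu> \<omega> x)"
      by (rule sum_mono2) (use S pr[OF \<omega>] Kone in \<open>auto simp: S_def prob_on_def\<close>)
    then show ?thesis using S0(3)[OF \<omega>] by simp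
  qed
  obtain \<omega>0 where \<omega>0: "\<omega>0 \<in> topspace X" using ne by blast
  define m where "m t = \<mu> (a t \<omega>0)" for t
  have at: "a t \<omega>0 \<in> topspace X" if "t \<in> K" for t
    using group_action.element_image[OF ga, of t \<omega>0] that \<omega>0 by simp
  have mp: "m t \<in> prob_on ?H" if "t \<in> K" for t using pr[OF at[OF that]] by (simp add: m_def)
  define \<nu> where "\<nu> t = (\<lambda>x. if x \<in> S then m t x + (if x = \<one> then 1 - (\<Sum>x\<in>S. m t x) else 0) else 0)" for t
  have \<nu>: "fin_prob (\<nu> t)" "\<And>A. finite A \<Longrightarrow> A \<subseteq> K \<Longrightarrow> (\<Sum>x\<in>A. \<bar>\<nu> t x - m t x\<bar>) \<le> 2 * \<delta>"
    if t: "t \<in> K" for t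
    using truncate_prob[OF mp[OF t], of S \<one> \<delta>] S S\<delta>[OF at[OF t]] by (simp_all add: \<nu>_def m_def)
  have su\<nu>: "supp (\<nu> t) \<subseteq> S" for t by (auto simp: supp_def \<nu>_def split: if_splits)
  have mle: "(\<Sum>y\<in>A. \<bar>m t (inv s \<otimes> y) - m (s \<otimes> t) y\<bar>) \<le> \<epsilon> / 2"
    if A: "finite A" "A \<subseteq> K" and s: "s \<in> F'" and t: "t \<in> K" for A s t
  proof -
    have sK: "s \<in> K" using s F' by auto
    let ?f = "\<lambda>y. \<bar>translate ?H s (m t) y - m (s \<otimes> t) y\<bar>"
    have st: "a s (a t \<omega>0) = a (s \<otimes> t) \<omega>0"
      using group_action.composition_rule[OF ga \<omega>0, of s t] sK t by simp
    have tr: "translate ?H s (m t) y = m t (inv s \<otimes> y)" if "y \<in> K" for y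
      using that m_inv_consistent[OF K sK] by (simp add: translate_def)
    have bij: "bij_betw (\<lambda>y. inv s \<otimes> y) K K"
      by (rule bij_betw_byWitness[where f' = "\<lambda>y. s \<otimes> y"])
         (use sK Ki Km Kc in \<open>auto simp: m_assoc[symmetric]\<close>)
    \<comment> \<open>\<open>l1_dist\<close> is an infinite sum and bounds its partial sums only if
      it is summable, which follows by comparison with two probability measures.\<close>
    have "(\<lambda>y. m t (inv s \<otimes> y)) summable_on K"
      unfolding summable_on_reindex_bij_betw[OF bij, of "m t"]
      using mp[OF t] by (auto simp: prob_on_def intro: has_sum_imp_summable)
    moreover have "m (s \<otimes> t) summable_on K"
      using mp[OF Km[OF sK t]] by (auto simp: prob_on_def intro: has_sum_imp_summable)
    ultimately have "(\<lambda>y. m t (inv s \<otimes> y) + m (s \<otimes> t) y) summable_on K" by (rule summable_on_add)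
    then have sm: "?f summable_on K"
    proof (rule summable_on_comparison_test)
      fix y assume y: "y \<in> K"
      have "0 \<le> m t (inv s \<otimes> y)" "0 \<le> m (s \<otimes> t) y"
        using mp[OF t] mp[OF Km[OF sK t]] y Km[OF Ki[OF sK] y] by (auto simp: prob_on_def)
      then show "?f y \<le> m t (inv s \<otimes> y) + m (s \<otimes> t) y" using tr[OF y] by simp
    qed simp
    have "(\<Sum>y\<in>A. \<bar>m t (inv s \<otimes> y) - m (s \<otimes> t) y\<bar>) = (\<Sum>y\<in>A. ?f y)"
      using A(2) by (intro sum.cong refl) (simp add: tr subset_iff)
    also have "\<dots> \<le> infsum ?f K" by (rule finite_sum_le_infsum[OF sm A]) simp
    also have "\<dots> = l1_dist ?H (translate ?H s (\<mu> (a t \<omega>0))) (\<mu> (a s (a t \<omega>0)))"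
      by (simp add: l1_dist_def m_def st)
    also have "\<dots> \<le> \<epsilon> / 2" by (rule \<mu>le[OF s at[OF t]])
    finally show ?thesis .
  qed
  define \<kappa> where "\<kappa> g x = (if x \<in> carrier G then \<nu> (inv g) (inv g \<otimes> x) else 0)" for g x
  have bijG: "bij_betw (\<lambda>x. t \<otimes> x) (carrier G) (carrier G)" if "t \<in> K" for t
    using bij_betw_mult_left[OF Kc[OF that]] .
  have su\<kappa>: "supp (\<kappa> g) \<subseteq> carrier G" for g by (auto simp: supp_def \<kappa>_def)
  have 1: "fin_prob (\<kappa> g)" if g: "g \<in> K" for g
  proof -
    have p: "fin_prob (\<nu> (inv g))" using \<nu> Ki g by blast
    note r = l1_reindex[OF bijG[OF Ki[OF g]] _ fin_probD(1)[OF p] _ su\<kappa>, of g]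
    have "finite (supp (\<kappa> g))" by (rule r(1)) (use su\<nu>[of "inv g"] Sc in \<open>auto simp: \<kappa>_def\<close>)
    moreover have "(\<Sum>x\<in>supp (\<kappa> g). \<kappa> g x) = (\<Sum>x\<in>supp (\<nu> (inv g)). \<nu> (inv g) x)"
      by (rule r(3)) (use su\<nu>[of "inv g"] Sc in \<open>auto simp: \<kappa>_def\<close>)
    ultimately show ?thesis using p by (simp add: fin_prob_def \<kappa>_def)
  qed
  have 2: "supp (\<kappa> g) \<subseteq> g <# S" if g: "g \<in> K" for g
  proof
    fix x assume x: "x \<in> supp (\<kappa> g)"
    then have xc: "x \<in> carrier G" using su\<kappa> by blast
    then have "inv g \<otimes> x \<in> supp (\<nu> (inv g))" using x by (simp add: \<kappa>_def supp_def)
    then show "x \<in> g <# S" using mem_l_coset_iff[OF Kc[OF g] Sc xc] su\<nu> by blast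
  qed
  have 3: "l1 (\<lambda>x. \<kappa> g x - \<kappa> (g \<otimes> f) x) \<le> \<epsilon>" if g: "g \<in> K" "f \<in> F" "g \<otimes> f \<in> K" for g f
  proof -
    have fc: "f \<in> carrier G" "g \<in> carrier G" using g F Kc by auto
    have "f = inv g \<otimes> (g \<otimes> f)" using fc by (simp add: mult_inv_cancel)
    then have fK: "f \<in> K" using Km[OF Ki[OF g(1)] g(3)] by simp
    define s where "s = inv f"
    define t where "t = inv g"
    have sK: "s \<in> K" "s \<in> F'" and tK: "t \<in> K" using fK g Ki by (auto simp: s_def t_def F'_def)
    have st: "inv (g \<otimes> f) = s \<otimes> t" using fc by (simp add: s_def t_def inv_mult_group)
    have sc: "s \<in> carrier G" "t \<in> carrier G" using sK tK Kc by auto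
    \<comment> \<open>The estimate for \<open>m\<close> is available on \<open>K\<close>; off
      \<open>K\<close> the truncated measures vanish.\<close>
    define D where "D y = (if y \<in> K then \<nu> t (inv s \<otimes> y) - \<nu> (s \<otimes> t) y else 0)" for y
    have suD: "supp D \<subseteq> S \<union> (s <# S)"
    proof
      fix y assume "y \<in> supp D"
      then have y: "y \<in> K" "\<nu> t (inv s \<otimes> y) \<noteq> 0 \<or> \<nu> (s \<otimes> t) y \<noteq> 0"
        by (auto simp: D_def supp_def split: if_splits)
      then have "inv s \<otimes> y \<in> S \<or> y \<in> S" using su\<nu> by (auto simp: supp_def)
      then show "y \<in> S \<union> (s <# S)" using mem_l_coset_iff[OF sc(1) Sc Kc[OF y(1)]] by blast
    qed
    have fin: "finite (supp D)" by (rule finite_subset[OF suD]) (use S(1) in \<open>simp add: l_coset_def\<close>)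
    define A where "A = supp D"
    have A: "finite A" "A \<subseteq> K" using fin by (auto simp: A_def D_def supp_def split: if_splits)
    have Dout: "\<nu> t (inv s \<otimes> y) - \<nu> (s \<otimes> t) y = 0" if "y \<in> carrier G" "y \<notin> K" for y
    proof -
      have "inv s \<otimes> y \<notin> K"
        using that Km[OF sK(1), of "inv s \<otimes> y"] sc by (auto simp: mult_inv_cancel)
      then have "inv s \<otimes> y \<notin> S" "y \<notin> S" using that S(2) by auto
      then show ?thesis using su\<nu>[of t] su\<nu>[of "s \<otimes> t"] by (auto simp: \<nu>_def)
    qed
    have "l1 (\<lambda>x. \<kappa> g x - \<kappa> (g \<otimes> f) x) = l1 D"
    proof (rule l1_reindex(2)[OF bijG[OF Km[OF sK(1) tK]] _ fin])
      show "supp D \<subseteq> carrier G" using A(2) Kc by (auto simp: A_def)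
      show "supp (\<lambda>x. \<kappa> g x - \<kappa> (g \<otimes> f) x) \<subseteq> carrier G"
        by (rule order_trans[OF supp_diff_subset]) (use su\<kappa> in blast)
      fix x assume x: "x \<in> carrier G"
      have "\<kappa> g x = \<nu> t (inv s \<otimes> (s \<otimes> t \<otimes> x))"
        using x sc by (simp add: \<kappa>_def t_def[symmetric] m_assoc mult_inv_cancel)
      moreover have "\<kappa> (g \<otimes> f) x = \<nu> (s \<otimes> t) (s \<otimes> t \<otimes> x)"
        using x by (simp add: \<kappa>_def st)
      ultimately show "\<kappa> g x - \<kappa> (g \<otimes> f) x = D (s \<otimes> t \<otimes> x)"
        using Dout[of "s \<otimes> t \<otimes> x"] x sc by (simp add: D_def)
    qed
    also have "\<dots> = (\<Sum>y\<in>A. \<bar>\<nu> t (inv s \<otimes> y) - \<nu> (s \<otimes> t) y\<bar>)"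
      unfolding l1_def A_def[symmetric] using A(2) by (intro sum.cong refl) (auto simp: D_def)
    also have "\<dots> \<le> (\<Sum>y\<in>A. \<bar>\<nu> t (inv s \<otimes> y) - m t (inv s \<otimes> y)\<bar>
        + \<bar>m t (inv s \<otimes> y) - m (s \<otimes> t) y\<bar> + \<bar>\<nu> (s \<otimes> t) y - m (s \<otimes> t) y\<bar>)"
      by (rule sum_mono) linarith
    also have "\<dots> = (\<Sum>y\<in>A. \<bar>\<nu> t (inv s \<otimes> y) - m t (inv s \<otimes> y)\<bar>)
        + (\<Sum>y\<in>A. \<bar>m t (inv s \<otimes> y) - m (s \<otimes> t) y\<bar>) + (\<Sum>y\<in>A. \<bar>\<nu> (s \<otimes> t) y - m (s \<otimes> t) y\<bar>)"
      by (simp add: sum.distrib)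
    also have "(\<Sum>y\<in>A. \<bar>\<nu> t (inv s \<otimes> y) - m t (inv s \<otimes> y)\<bar>) =
        (\<Sum>z\<in>(\<lambda>y. inv s \<otimes> y) ` A. \<bar>\<nu> t z - m t z\<bar>)"
    proof (subst sum.reindex)
      show "inj_on (\<lambda>y. inv s \<otimes> y) A"
        using bij_betw_imp_inj_on[OF bijG[OF Ki[OF sK(1)]]] A(2) Kc by (meson inj_on_subset subsetI subsetD)
    qed simp
    also have "\<dots> \<le> 2 * \<delta>" by (rule \<nu>(2)[OF tK]) (use A Km Ki sK in auto)
    also have "(\<Sum>y\<in>A. \<bar>m t (inv s \<otimes> y) - m (s \<otimes> t) y\<bar>) \<le> \<epsilon> / 2" by (rule mle[OF A sK(2) tK])
    also have "(\<Sum>y\<in>A. \<bar>\<nu> (s \<otimes> t) y - m (s \<otimes> t) y\<bar>) \<le> 2 * \<delta>" by (rule \<nu>(2)[OF Km[OF sK(1) tK] A])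
    finally show ?thesis by (simp add: \<delta>_def)
  qed
  show "\<exists>S. finite S \<and> S \<subseteq> carrier G \<and> (\<forall>W\<in>{K}. \<exists>\<kappa>.
        (\<forall>g\<in>W. fin_prob (\<kappa> g) \<and> supp (\<kappa> g) \<subseteq> g <# S) \<and>
        (\<forall>g\<in>W. \<forall>f\<in>F. g \<otimes> f \<in> W \<longrightarrow> l1 (\<lambda>x. \<kappa> g x - \<kappa> (g \<otimes> f) x) \<le> \<epsilon>))"
    using S(1) Sc 1 2 3 by (intro exI[of _ S] conjI ballI exI[of _ \<kappa>] impI) simp_all
qed

section \<open>Walks, circuits and slices in graphs\<close>

text \<open>The vertex set \<open>A\<close> is varied while \<open>E\<close> stays fixed: arcs kept
  in disjoint sets cannot meet, which is how the circuits below become simple.\<close>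

definition walk_within :: "'v set set \<Rightarrow> 'v set \<Rightarrow> nat \<Rightarrow> 'v \<Rightarrow> 'v \<Rightarrow> bool" where
  "walk_within E A n x y \<longleftrightarrow> (\<exists>xs. path_between A E x y xs \<and> length xs \<le> Suc n)"

lemma walk_withinI: "path_between A E x y xs \<Longrightarrow> length xs \<le> Suc n \<Longrightarrow> walk_within E A n x y"
  by (auto simp: walk_within_def)

lemma path_between_append:
  assumes "path_between A E x y xs" "path_between B E y z ys"
  shows "path_between (A \<union> B) E x z (xs @ tl ys)"
proof -
  obtain ys' where ys: "ys = y # ys'" using assms(2)
    by (cases ys) (auto simp: path_between_def graph_path_def)
  have xs: "xs \<noteq> []" "hd xs = x" "last xs = y" using assms(1)
    by (auto simp: path_between_def graph_path_def)
  show ?thesis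
    using assms xs unfolding ys path_between_def graph_path_def
    by (cases ys') (auto simp: successively_append_iff)
qed

lemma path_between_mono: "path_between A E x y xs \<Longrightarrow> A \<subseteq> B \<Longrightarrow> path_between B E x y xs"
  by (auto simp: path_between_def graph_path_def)

lemma path_between_ends: "path_between A E x y xs \<Longrightarrow> x \<in> A \<and> y \<in> A"
  by (auto simp: path_between_def graph_path_def)

lemma path_between_rev: "path_between A E x y xs \<Longrightarrow> path_between A E y x (rev xs)"
proof -
  assume xs: "path_between A E x y xs"
  have "(\<lambda>x y. y = x \<or> {y, x} \<in> E) = (\<lambda>x y. x = y \<or> {x, y} \<in> E)"
    by (auto simp: insert_commute fun_eq_iff)
  then have "successively (\<lambda>x y. x = y \<or> {x, y} \<in> E) (rev xs)"
    unfolding successively_rev using xs by (simp only: path_between_def graph_path_def)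
  then show "path_between A E y x (rev xs)"
    using xs by (auto simp: path_between_def graph_path_def hd_rev last_rev)
qed

lemma path_between_nth:
  assumes "path_between A E x y xs" "length xs = Suc n"
  shows "xs \<noteq> []" "set xs \<subseteq> A" "xs ! 0 = x" "xs ! n = y"
  using assms by (auto simp: path_between_def graph_path_def hd_conv_nth last_conv_nth)

lemma walk_within_refl: "x \<in> A \<Longrightarrow> walk_within E A n x x"
  by (rule walk_withinI[of _ _ _ _ "[x]"]) (auto simp: path_between_def graph_path_def)

lemma walk_within_edge: "x \<in> A \<Longrightarrow> y \<in> A \<Longrightarrow> {x, y} \<in> E \<Longrightarrow> walk_within E A 1 x y"
  by (rule walk_withinI[of _ _ _ _ "[x, y]"]) (auto simp: path_between_def graph_path_def)

lemma walk_within_sym: "walk_within E A n x y \<Longrightarrow> walk_within E A n y x"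
  unfolding walk_within_def using path_between_rev by (metis length_rev)

lemma walk_within_mono: "walk_within E A m x y \<Longrightarrow> A \<subseteq> B \<Longrightarrow> m \<le> n \<Longrightarrow> walk_within E B n x y"
  unfolding walk_within_def by (meson Suc_le_mono order_trans path_between_mono)

lemma walk_within_trans:
  assumes "walk_within E A m x y" "walk_within E A n y z" shows "walk_within E A (m + n) x z"
proof -
  obtain xs ys where xs: "path_between A E x y xs" "length xs \<le> Suc m"
    and ys: "path_between A E y z ys" "length ys \<le> Suc n"
    using assms by (auto simp: walk_within_def)
  have "ys \<noteq> []" using ys by (auto simp: path_between_def graph_path_def)
  then have "length (xs @ tl ys) \<le> Suc (m + n)" using xs(2) ys(2) by (cases ys) auto
  then show ?thesis using path_between_append[OF xs(1) ys(1)] by (auto intro: walk_withinI)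
qed

text \<open>The part between two occurrences of a vertex can be cut out; equal neighbours, which
  paths may have, are a case of this.\<close>

lemma distinct_path_exists:
  assumes "path_between A E x y xs"
  shows "\<exists>ys. path_between A E x y ys \<and> distinct ys \<and> length ys \<le> length xs"
  using assms
proof (induction xs rule: length_induct)
  case (1 xs)
  show ?case
  proof (cases "distinct xs")
    case False
    then obtain as bs cs u where xs: "xs = as @ [u] @ bs @ [u] @ cs"
      using not_distinct_decomp by blast
    have s: "successively (\<lambda>x y. x = y \<or> {x, y} \<in> E) (as @ [u] @ bs @ [u] @ cs)" and sub: "set xs \<subseteq> A"
      and e: "hd xs = x" "last xs = y"
      using 1(2) by (auto simp: path_between_def graph_path_def xs)
    have "successively (\<lambda>x y. x = y \<or> {x, y} \<in> E) (as @ [u] @ cs)"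
      using s by (auto simp: successively_append_iff successively_Cons)
    moreover have "hd (as @ [u] @ cs) = x" using e by (cases as) (auto simp: xs)
    moreover have "last (as @ [u] @ cs) = y" using e by (cases cs) (auto simp: xs)
    ultimately have "path_between A E x y (as @ [u] @ cs)"
      using sub by (auto simp: path_between_def graph_path_def xs)
    moreover have "length (as @ [u] @ cs) < length xs" by (simp add: xs)
    ultimately obtain ys where "path_between A E x y ys" "distinct ys" "length ys \<le> length (as @ [u] @ cs)"
      using 1(1) by blast
    then show ?thesis using \<open>length (as @ [u] @ cs) < length xs\<close>
      by (intro exI[of _ ys]) simp
  qed (use 1 in blast)
qed

text \<open>Fineness is used only through the finiteness of these sets.\<close>

definition circuit_vertices :: "'v set \<Rightarrow> 'v set set \<Rightarrow> nat \<Rightarrow> 'v set \<Rightarrow> 'v set" where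
  "circuit_vertices V E n e =
     {v. \<exists>xs. circuit V E xs \<and> path_length xs \<le> n \<and> path_contains_edge xs e \<and> v \<in> set xs}"

lemma finite_circuit_vertices:
  assumes "fine_graph V E" "e \<in> E" shows "finite (circuit_vertices V E n e)"
proof -
  have "circuit_vertices V E n e =
      (\<Union>xs\<in>{xs. circuit V E xs \<and> path_length xs \<le> n \<and> path_contains_edge xs e}. set xs)"
    by (auto simp: circuit_vertices_def)
  then show ?thesis using assms by (auto simp: fine_graph_def)
qed

text \<open>Two walks from \<open>p\<close> to \<open>v\<close> and from \<open>v\<close> to \<open>q\<close> that live in sets meeting at most in \<open>v\<close> can
  be shortened to simple paths whose concatenation is simple, and the edge from \<open>q\<close> to \<open>p\<close> closes the
  circuit.\<close>

lemma mem_circuit_vertices: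
  assumes e: "{p, q} \<in> E" and A: "A \<subseteq> V" "B \<subseteq> V" "A \<inter> B \<subseteq> {v}"
    and w: "walk_within E A m p v" "walk_within E B n v q"
  shows "v \<in> circuit_vertices V E (m + n + 1) {p, q}"
proof -
  obtain xs where xs: "path_between A E p v xs" "distinct xs" "length xs \<le> Suc m"
    using w(1) distinct_path_exists unfolding walk_within_def by (metis order_trans)
  obtain ys where ys: "path_between B E v q ys" "distinct ys" "length ys \<le> Suc n"
    using w(2) distinct_path_exists unfolding walk_within_def by (metis order_trans)
  obtain ys' where ys': "ys = v # ys'" using ys(1)
    by (cases ys) (auto simp: path_between_def graph_path_def)
  define zs where "zs = xs @ ys'"
  have z: "path_between (A \<union> B) E p q zs"
    using path_between_append[OF xs(1) ys(1)] by (simp add: zs_def ys')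
  have ne: "xs \<noteq> []" and vx: "v \<in> set xs"
    using xs(1) by (auto simp: path_between_def graph_path_def)
  have dz: "distinct zs"
  proof -
    have "set xs \<subseteq> A" "set ys' \<subseteq> B" using xs(1) ys(1)
      by (auto simp: path_between_def graph_path_def ys')
    then show ?thesis using xs(2) ys(2) A(3) by (auto simp: zs_def ys')
  qed
  have zV: "path_between V E p q zs" by (rule path_between_mono[OF z]) (use A in auto)
  then have zp: "zs \<noteq> []" "hd zs = p" "last zs = q" "set zs \<subseteq> V"
    "successively (\<lambda>x y. x = y \<or> {x, y} \<in> E) zs"
    by (auto simp: path_between_def graph_path_def)
  have "p \<in> V" using path_between_ends[OF zV] by simp
  \<comment> \<open>Only the entries before the last must be distinct, so even the path
    \<open>p, q, p\<close> is a circuit; it may arise when \<open>v\<close> is an end of the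
    edge.\<close>
  have "circuit V E (zs @ [p])"
    using zp \<open>p \<in> V\<close> dz e by (auto simp: circuit_def graph_path_def successively_append_iff insert_commute)
  moreover have "path_length (zs @ [p]) \<le> m + n + 1"
    using xs(3) ys(3) by (simp add: path_length_def zs_def ys')
  moreover have "path_contains_edge (zs @ [p]) {p, q}"
    unfolding path_contains_edge_def
    by (rule exI[of _ "length zs - 1"])
       (use zp in \<open>auto simp: nth_append last_conv_nth insert_commute\<close>)
  moreover have "v \<in> set (zs @ [p])" using vx by (simp add: zs_def)
  ultimately show ?thesis unfolding circuit_vertices_def by blast
qed

section \<open>The path metric\<close>

locale connected_simple_graph =
  fixes V :: "'v set" and E :: "'v set set"
  assumes conn: "connected_graph V E"
begin

abbreviation d :: "'v \<Rightarrow> 'v \<Rightarrow> nat" where "d \<equiv> graph_dist V E"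

lemma d_le: assumes "walk_within E V n x y" shows "d x y \<le> n"
proof -
  obtain xs where xs: "path_between V E x y xs" "length xs \<le> Suc n"
    using assms by (auto simp: walk_within_def)
  have "d x y \<le> path_length xs" unfolding graph_dist_def by (rule Least_le) (use xs in blast)
  then show ?thesis using xs(2) by (simp add: path_length_def)
qed

lemma shortest_path:
  assumes "x \<in> V" "y \<in> V"
  obtains xs where "path_between V E x y xs" "length xs = Suc (d x y)"
proof -
  have "\<exists>n. \<exists>xs. path_between V E x y xs \<and> path_length xs = n"
    using conn assms by (auto simp: connected_graph_def)
  from LeastI_ex[OF this] obtain xs where xs: "path_between V E x y xs" "path_length xs = d x y"
    unfolding graph_dist_def by auto
  then have "xs \<noteq> []" by (auto simp: path_between_def graph_path_def)
  then show thesis using that[OF xs(1)] xs(2) by (cases xs) (auto simp: path_length_def)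
qed

lemma walk_d: "x \<in> V \<Longrightarrow> y \<in> V \<Longrightarrow> walk_within E V (d x y) x y"
  by (rule shortest_path[of x y]) (auto intro: walk_withinI)

lemma d_self: "x \<in> V \<Longrightarrow> d x x = 0"
  using d_le[OF walk_within_refl, of x 0] by simp

lemma d_eq_0: assumes "x \<in> V" "y \<in> V" "d x y = 0" shows "x = y"
proof -
  obtain xs where "path_between V E x y xs" "length xs = Suc 0" using shortest_path assms by metis
  then show ?thesis by (auto simp: length_Suc_conv path_between_def)
qed

lemma d_sym: "x \<in> V \<Longrightarrow> y \<in> V \<Longrightarrow> d x y = d y x"
  by (intro antisym d_le walk_within_sym[OF walk_d]) auto

lemma d_triangle: "x \<in> V \<Longrightarrow> y \<in> V \<Longrightarrow> z \<in> V \<Longrightarrow> d x z \<le> d x y + d y z"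
  by (intro d_le walk_within_trans[of _ _ _ _ y] walk_d)

lemma d_edge:
  assumes "x \<in> V" "y \<in> V" "d x y = 1" shows "{x, y} \<in> E"
proof -
  obtain xs where xs: "path_between V E x y xs" "length xs = Suc 1" using shortest_path assms by metis
  then obtain a b where "xs = [a, b]" by (auto simp: length_Suc_conv)
  moreover have "x \<noteq> y" using assms d_self by auto
  ultimately show ?thesis using xs by (auto simp: path_between_def graph_path_def)
qed

lemma path_between_sub:
  assumes xs: "path_between A E x y xs" and ij: "i \<le> j" "j < length xs"
  shows "walk_within E A (j - i) (xs ! i) (xs ! j)"
proof -
  let ?ys = "take (Suc (j - i)) (drop i xs)"
  have l: "length ?ys = Suc (j - i)" using ij by simp
  have "successively (\<lambda>x y. x = y \<or> {x, y} \<in> E) xs" "set xs \<subseteq> A"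
    using xs by (auto simp: path_between_def graph_path_def)
  then have "successively (\<lambda>x y. x = y \<or> {x, y} \<in> E) ?ys" "set ?ys \<subseteq> A"
  proof -
    assume s: "successively (\<lambda>x y. x = y \<or> {x, y} \<in> E) xs" "set xs \<subseteq> A"
    show "successively (\<lambda>x y. x = y \<or> {x, y} \<in> E) ?ys"
      using s(1) l ij by (auto simp: successively_conv_nth)
    show "set ?ys \<subseteq> A" using s(2) by (meson order_trans set_drop_subset set_take_subset)
  qed
  moreover have "?ys \<noteq> []" using l by auto
  moreover have "hd ?ys = xs ! i" using ij by (simp add: hd_conv_nth l)
  moreover have "last ?ys = xs ! j" using ij l \<open>?ys \<noteq> []\<close> by (simp add: last_conv_nth)
  ultimately have "path_between A E (xs ! i) (xs ! j) ?ys"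
    unfolding path_between_def graph_path_def by blast
  then show ?thesis by (rule walk_withinI) (simp add: l)
qed

lemma shortest_path_nth:
  assumes xs: "path_between V E x y xs" "length xs = Suc (d x y)"
    and ij: "i \<le> j" "j < length xs"
  shows "d (xs ! i) (xs ! j) = j - i"
proof -
  note ne = path_between_nth[OF xs]
  have V: "xs ! i \<in> V" "xs ! j \<in> V" "x \<in> V" "y \<in> V"
    using ne(2) ij path_between_ends[OF xs(1)] by auto
  have 1: "d (xs ! i) (xs ! j) \<le> j - i" by (rule d_le[OF path_between_sub[OF xs(1) ij]])
  have "d x (xs ! i) \<le> i" using d_le[OF path_between_sub[OF xs(1), of 0 i]] ij ne by simp
  moreover have "d (xs ! j) y \<le> d x y - j"
    using d_le[OF path_between_sub[OF xs(1), of j "d x y"]] ij xs(2) ne by simp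
  moreover have "d x y \<le> d x (xs ! i) + d (xs ! i) (xs ! j) + d (xs ! j) y"
    using d_triangle[of x "xs ! i" y] d_triangle[of "xs ! i" "xs ! j" y] V by linarith
  ultimately show ?thesis using 1 ij xs(2) by linarith
qed

lemma between_point:
  assumes "x \<in> V" "y \<in> V" "k \<le> d x y"
  obtains p where "p \<in> V" "d x p = k" "d p y = d x y - k"
proof -
  obtain xs where xs: "path_between V E x y xs" "length xs = Suc (d x y)"
    using shortest_path assms by blast
  note ne = path_between_nth[OF xs]
  show thesis
    using that[of "xs ! k"] shortest_path_nth[OF xs, of 0 k] shortest_path_nth[OF xs, of k "d x y"]
      ne xs(2) assms(3) by (simp add: subset_iff)
qed

text \<open>Asking that \<open>A\<close> contain all points between \<open>x\<close> and
  \<open>y\<close> avoids naming a geodesic: whether it stays in \<open>A\<close> becomes a question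
  about distances.\<close>

lemma geodesic_walk_within:
  assumes "x \<in> V" "y \<in> V"
    and A: "\<And>w. w \<in> V \<Longrightarrow> d x w + d w y = d x y \<Longrightarrow> w \<in> A"
  shows "walk_within E A (d x y) x y"
proof -
  obtain xs where xs: "path_between V E x y xs" "length xs = Suc (d x y)"
    using shortest_path assms(1,2) by blast
  note ne = path_between_nth[OF xs]
  have "set xs \<subseteq> A"
  proof
    fix w assume "w \<in> set xs"
    then obtain k where k: "k < length xs" "w = xs ! k" by (metis in_set_conv_nth)
    show "w \<in> A"
      using shortest_path_nth[OF xs, of 0 k] shortest_path_nth[OF xs, of k "d x y"] k ne xs(2) \<open>w \<in> set xs\<close>
      by (intro A) auto
  qed
  then have "path_between A E x y xs" using xs(1) by (auto simp: path_between_def graph_path_def)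
  then show ?thesis by (rule walk_withinI) (simp add: xs)
qed

lemma geodesic_path_through:
  assumes V: "x \<in> V" "p \<in> V" "y \<in> V" and p: "d x p + d p y = d x y"
  obtains xs where "geodesic_path V E xs" "hd xs = x" "last xs = y" "xs ! d x p = p"
proof -
  obtain as where as: "path_between V E x p as" "length as = Suc (d x p)"
    using shortest_path V by blast
  obtain bs where bs: "path_between V E p y bs" "length bs = Suc (d p y)"
    using shortest_path V by blast
  define xs where "xs = as @ tl bs"
  have xs: "path_between V E x y xs"
    using path_between_append[OF as(1) bs(1)] by (simp add: xs_def)
  have l: "length xs = Suc (d x y)" using as(2) bs(2) p by (simp add: xs_def)
  have V': "xs ! i \<in> V" if "i < length xs" for i
    using xs that by (auto simp: path_between_def graph_path_def)
  have "geodesic_path V E xs" unfolding geodesic_path_def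
  proof (intro conjI allI impI)
    show "graph_path V E xs" using xs by (simp add: path_between_def)
    fix m n assume mn: "m < length xs" "n < length xs"
    show "int (d (xs ! m) (xs ! n)) = \<bar>int m - int n\<bar>"
    proof (cases "m \<le> n")
      case True
      then show ?thesis using shortest_path_nth[OF xs l True mn(2)] by simp
    next
      case False
      then show ?thesis
        using shortest_path_nth[OF xs l _ mn(1), of n] d_sym[OF V'[OF mn(1)] V'[OF mn(2)]] by simp
    qed
  qed
  moreover have "xs ! d x p = p"
    using as by (simp add: xs_def nth_append path_between_def graph_path_def)
       (metis diff_Suc_1 last_conv_nth)
  ultimately show thesis using that xs by (auto simp: path_between_def)
qed

text \<open>The definition compares entries of paths; here they are points \<open>p\<close> and
  \<open>q\<close> between \<open>z\<close> and the ends. The last premise says that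
  \<open>k = d z p\<close> is at most the Gromov product, cleared of the fraction.\<close>

lemma hyperbolic_metric:
  assumes "hyperbolic_graph V E"
  obtains D where "\<And>z x y p q. z \<in> V \<Longrightarrow> x \<in> V \<Longrightarrow> y \<in> V \<Longrightarrow> p \<in> V \<Longrightarrow> q \<in> V \<Longrightarrow> d z p = d z q \<Longrightarrow>
    d z p + d p x = d z x \<Longrightarrow> d z q + d q y = d z y \<Longrightarrow> 2 * d z p + d x y \<le> d z x + d z y \<Longrightarrow> d p q \<le> D"
proof -
  obtain \<delta> :: real where \<delta>: "\<And>z \<alpha> \<beta> k. geodesic_path V E \<alpha> \<Longrightarrow> geodesic_path V E \<beta> \<Longrightarrow> hd \<alpha> = z \<Longrightarrow>
      hd \<beta> = z \<Longrightarrow> real k \<le> gromov_product V E (last \<alpha>) (last \<beta>) z \<Longrightarrow> real (d (\<alpha> ! k) (\<beta> ! k)) < \<delta>"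
    using assms unfolding hyperbolic_graph_def by metis
  show thesis
  proof (rule that[of "nat \<lceil>\<delta>\<rceil>"])
    fix z x y p q assume V: "z \<in> V" "x \<in> V" "y \<in> V" "p \<in> V" "q \<in> V"
      and eq: "d z p = d z q" and p: "d z p + d p x = d z x" and q: "d z q + d q y = d z y"
      and le: "2 * d z p + d x y \<le> d z x + d z y"
    obtain \<alpha> where \<alpha>: "geodesic_path V E \<alpha>" "hd \<alpha> = z" "last \<alpha> = x" "\<alpha> ! d z p = p"
      using geodesic_path_through[OF V(1,4,2) p] by blast
    obtain \<beta> where \<beta>: "geodesic_path V E \<beta>" "hd \<beta> = z" "last \<beta> = y" "\<beta> ! d z q = q"
      using geodesic_path_through[OF V(1,5,3) q] by blast
    have "real (2 * d z p + d x y) \<le> real (d z x + d z y)" using le by (rule of_nat_mono)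
    then have "real (d z p) \<le> gromov_product V E (last \<alpha>) (last \<beta>) z"
      using d_sym[OF V(1,2)] d_sym[OF V(1,3)] by (simp add: gromov_product_def \<alpha>(3) \<beta>(3))
    from \<delta>[OF \<alpha>(1) \<beta>(1) \<alpha>(2) \<beta>(2) this] have "real (d p q) < \<delta>" using \<alpha>(4) \<beta>(4) eq by simp
    then show "d p q \<le> nat \<lceil>\<delta>\<rceil>" by linarith
  qed
qed

text \<open>The vertices at level \<open>r\<close> (distance \<open>r\<close> from \<open>b\<close>) on geodesics from \<open>b\<close> to points of the
  \<open>k\<close>-ball about \<open>x\<close>.\<close>

definition slice :: "'v \<Rightarrow> 'v \<Rightarrow> nat \<Rightarrow> nat \<Rightarrow> 'v set" where
  "slice b x k r = {v \<in> V. d b v = r \<and> (\<exists>y\<in>V. d x y \<le> k \<and> d b y = r + d v y)}"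

text \<open>All geodesics that define the slice stay close to one geodesic from \<open>b\<close> to \<open>x\<close> up to the level
  \<open>r + D + 1\<close>. Let \<open>p\<close>, \<open>q\<close> be the points of the latter at the levels \<open>r\<close> and \<open>r + 1\<close>.
  A point \<open>v\<close> of the slice is joined to \<open>p\<close> below the level \<open>r\<close> and to \<open>q\<close> above it, so it
  lies on a short circuit through the edge \<open>{p, q}\<close>.\<close>

lemma slice_subset_circuit_vertices:
  assumes D: "\<And>z x y p q. z \<in> V \<Longrightarrow> x \<in> V \<Longrightarrow> y \<in> V \<Longrightarrow> p \<in> V \<Longrightarrow> q \<in> V \<Longrightarrow> d z p = d z q \<Longrightarrow>
    d z p + d p x = d z x \<Longrightarrow> d z q + d q y = d z y \<Longrightarrow> 2 * d z p + d x y \<le> d z x + d z y \<Longrightarrow> d p q \<le> D"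
    and V: "b \<in> V" "x \<in> V" and r: "r + k + D + 1 \<le> d b x"
  obtains e where "e \<in> E" "slice b x k r \<subseteq> circuit_vertices V E (6 * D + 2) e"
proof -
  obtain p where p: "p \<in> V" "d b p = r" "d p x = d b x - r"
    using between_point[OF V, of r] r by auto
  have "1 \<le> d p x" using r p by simp
  from between_point[OF p(1) V(2) this]
  obtain q where q: "q \<in> V" "d p q = 1" "d q x = d p x - 1" by blast
  have bq: "d b q = r + 1"
    using d_triangle[OF V(1) p(1) q(1)] d_triangle[OF V(1) q(1) V(2)] p q r by linarith
  have e: "{p, q} \<in> E" by (rule d_edge) (use p q in auto)
  \<comment> \<open>Truncated: \<open>pa\<close> lies \<open>D\<close> levels below \<open>p\<close>
    or is \<open>b\<close> itself. From level \<open>r - D\<close>, a path of length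
    \<open>D\<close> cannot rise above \<open>r\<close>; likewise \<open>D\<close> steps from level
    \<open>r + D + 1\<close>, where \<open>qc\<close> is taken, cannot lead down to
    \<open>r\<close>.\<close>
  define a where "a = r - D"
  obtain pa where pa: "pa \<in> V" "d b pa = a" "d pa p = r - a"
    using between_point[OF V(1) p(1), of a] p by (auto simp: a_def)
  have pax: "d b pa + d pa x = d b x"
    using d_triangle[OF V(1) pa(1) V(2)] d_triangle[OF pa(1) p(1) V(2)] pa p r by (simp add: a_def)
  have "D \<le> d q x" using r p q by simp
  from between_point[OF q(1) V(2) this]
  obtain qc where qc: "qc \<in> V" "d q qc = D" "d qc x = d q x - D" by blast
  have bqc: "d b qc = r + D + 1"
    using d_triangle[OF V(1) q(1) qc(1)] d_triangle[OF V(1) qc(1) V(2)] qc q p bq r by linarith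
  have qcx: "d b qc + d qc x = d b x" using bqc qc q p r by linarith
  have "v \<in> circuit_vertices V E (6 * D + 2) {p, q}" if v: "v \<in> slice b x k r" for v
  proof -
    obtain y where vy: "v \<in> V" "d b v = r" "y \<in> V" "d x y \<le> k" "d b y = r + d v y"
      using v by (auto simp: slice_def)
    have by_ge: "d b y + d x y \<ge> d b x"
      using d_triangle[OF V(1) vy(3) V(2)] d_sym[OF V(2) vy(3)] by simp
    obtain va where va: "va \<in> V" "d b va = a" "d va v = r - a"
      using between_point[OF V(1) vy(1), of a] vy by (auto simp: a_def)
    have vay: "d b va + d va y = d b y"
      using d_triangle[OF V(1) va(1) vy(3)] d_triangle[OF va(1) vy(1,3)] va vy by (simp add: a_def)
    have "D + 1 \<le> d v y" using r vy by_ge by simp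
    from between_point[OF vy(1,3) this]
    obtain vc where vc: "vc \<in> V" "d v vc = D + 1" "d vc y = d v y - (D + 1)" by blast
    have bvc: "d b vc = r + D + 1"
      using d_triangle[OF V(1) vy(1) vc(1)] d_triangle[OF V(1) vc(1) vy(3)] vc vy r by_ge by linarith
    have vcy: "d b vc + d vc y = d b y" using bvc vc vy r by_ge by linarith
    have lowD: "d pa va \<le> D"
      by (rule D[of b x y]) (use V vy pa va pax vay by_ge r in \<open>auto simp: a_def\<close>)
    have lowD0: "d pa va = 0" if "r \<le> D"
    proof -
      have "pa = b" "va = b" using that pa va V by (auto simp: a_def intro: d_eq_0[symmetric])
      then show ?thesis using d_self V by simp
    qed
    \<comment> \<open>Twice the level \<open>r + D + 1\<close> plus \<open>d x y\<close> must not
      exceed \<open>d b x + d b y\<close>, which is at least \<open>2 * d b x - d x y\<close>; this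
      is where the bound \<open>r + k + D + 1 \<le> d b x\<close> comes from.\<close>
    have highD: "d vc qc \<le> D"
      using D[of b x y qc vc] d_sym[OF qc(1) vc(1)] V vy qc vc qcx vcy bqc bvc by_ge r by auto
    \<comment> \<open>The two arcs are separated by their levels and can meet only in
      \<open>v\<close>.\<close>
    define A where "A = {w \<in> V. d b w \<le> r}"
    define B where "B = insert v {w \<in> V. d b w > r}"
    have "walk_within E A D p pa"
    proof (rule walk_within_mono[OF geodesic_walk_within[OF p(1) pa(1)] order_refl])
      show "d p pa \<le> D" using pa p d_sym[OF pa(1) p(1)] by (simp add: a_def)
      fix w assume w: "w \<in> V" "d p w + d w pa = d p pa"
      have "d b w \<le> d b pa + d pa w" using d_triangle V pa w by blast
      then show "w \<in> A" using w pa p d_sym[OF pa(1) p(1)] d_sym[OF pa(1) w(1)] by (simp add: A_def a_def)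
    qed
    moreover have "walk_within E A D pa va"
    proof (rule walk_within_mono[OF geodesic_walk_within[OF pa(1) va(1)] order_refl lowD])
      fix w assume w: "w \<in> V" "d pa w + d w va = d pa va"
      have "d b w \<le> d b pa + d pa w" using d_triangle V pa w by blast
      then show "w \<in> A" using w pa lowD lowD0 by (cases "r \<le> D") (auto simp: A_def a_def)
    qed
    moreover have "walk_within E A D va v"
    proof (rule walk_within_mono[OF geodesic_walk_within[OF va(1) vy(1)] order_refl])
      show "d va v \<le> D" using va by (simp add: a_def)
      fix w assume w: "w \<in> V" "d va w + d w v = d va v"
      have "d b w \<le> d b va + d va w" using d_triangle V va w by blast
      then show "w \<in> A" using w va by (simp add: A_def a_def)
    qed
    ultimately have wA: "walk_within E A (D + D + D) p v" by (meson walk_within_trans)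
    have "walk_within E B (D + 1) v vc"
    proof (rule walk_within_mono[OF geodesic_walk_within[OF vy(1) vc(1)] order_refl])
      show "d v vc \<le> D + 1" using vc by simp
      fix w assume w: "w \<in> V" "d v w + d w vc = d v vc"
      have "d b vc \<le> d b w + d w vc" using d_triangle V vc w by blast
      moreover have "w = v" if "d v w = 0" using d_eq_0 that w(1) vy(1) by metis
      ultimately show "w \<in> B" using w vc bvc by (auto simp: B_def)
    qed
    moreover have "walk_within E B D vc qc"
    proof (rule walk_within_mono[OF geodesic_walk_within[OF vc(1) qc(1)] order_refl highD])
      fix w assume w: "w \<in> V" "d vc w + d w qc = d vc qc"
      have "d b vc \<le> d b w + d w vc" using d_triangle V vc w by blast
      then show "w \<in> B" using w bvc highD d_sym[OF vc(1) w(1)] by (simp add: B_def)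
    qed
    moreover have "walk_within E B D qc q"
    proof (rule walk_within_mono[OF geodesic_walk_within[OF qc(1) q(1)] order_refl])
      show "d qc q \<le> D" using qc d_sym[OF qc(1) q(1)] by simp
      fix w assume w: "w \<in> V" "d qc w + d w q = d qc q"
      have "d b qc \<le> d b w + d w qc" using d_triangle V qc w by blast
      then show "w \<in> B" using w bqc qc d_sym[OF qc(1) q(1)] d_sym[OF qc(1) w(1)] by (simp add: B_def)
    qed
    ultimately have wB: "walk_within E B (D + 1 + D + D) v q" by (meson walk_within_trans)
    \<comment> \<open>\<open>3 * D\<close> steps below, \<open>3 * D + 1\<close> above and the edge
      \<open>{p, q}\<close> add up to \<open>6 * D + 2\<close>.\<close>
    have "v \<in> circuit_vertices V E (D + D + D + (D + 1 + D + D) + 1) {p, q}"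
      by (rule mem_circuit_vertices[OF e _ _ _ wA wB]) (use vy in \<open>auto simp: A_def B_def\<close>)
    moreover have "D + D + D + (D + 1 + D + D) + 1 = 6 * D + 2" by simp
    ultimately show ?thesis by (simp only:)
  qed
  then show thesis using that[OF e] by blast
qed

lemma slice_subset:
  assumes "x \<in> V" "x' \<in> V" "d x x' + k \<le> k'"
  shows "slice b x' k r \<subseteq> slice b x k' r"
proof
  fix v assume "v \<in> slice b x' k r"
  then obtain y where y: "v \<in> V" "d b v = r" "y \<in> V" "d x' y \<le> k" "d b y = r + d v y"
    by (auto simp: slice_def)
  have "d x y \<le> k'" using d_triangle[OF assms(1,2) y(3)] y(4) assms(3) by linarith
  then show "v \<in> slice b x k' r" using y by (auto simp: slice_def)
qed

lemma slice_nonempty: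
  assumes "b \<in> V" "x \<in> V" "r \<le> d b x" shows "slice b x k r \<noteq> {}"
proof -
  obtain p where "p \<in> V" "d b p = r" "d p x = d b x - r" using between_point assms by blast
  then have "p \<in> slice b x k r" using assms d_self[of x] by (auto simp: slice_def intro!: bexI[of _ x])
  then show ?thesis by blast
qed

lemma slice_0: "b \<in> V \<Longrightarrow> slice b x k 0 \<subseteq> {b}"
  by (auto simp: slice_def dest: d_eq_0)

lemma slice_dist:
  assumes "b \<in> V" "x \<in> V" "v \<in> slice b x k r" shows "d x v + r \<le> d b x + 2 * k"
proof -
  obtain y where y: "v \<in> V" "d b v = r" "y \<in> V" "d x y \<le> k" "d b y = r + d v y"
    using assms(3) by (auto simp: slice_def)
  have "d x v \<le> d x y + d v y" using d_triangle[OF assms(2) y(3,1)] d_sym[OF y(1,3)] by simp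
  moreover have "d b y \<le> d b x + d x y" using d_triangle[OF assms(1,2) y(3)] .
  ultimately show ?thesis using y by linarith
qed

end

text \<open>Moving a window of \<open>M\<close> levels by one replaces a single summand. The indices
  do not depend on \<open>h\<close>, so they serve all vertices at once. Truncation at 0 is harmless
  because \<open>Suc e' - (s + Suc i)\<close> equals \<open>e' - (s + i)\<close>.\<close>

lemma shifted_sum_diff:
  fixes e e' s M :: nat
  assumes "e \<le> Suc e'" "e' \<le> Suc e" "M > 0"
  obtains i i' where "i < M" "i' < M"
    "\<And>h :: nat \<Rightarrow> real. (\<Sum>i<M. h (e - (s + i))) - (\<Sum>i<M. h (e' - (s + i))) = h (e - (s + i)) - h (e' - (s + i'))"
proof -
  obtain N where N: "M = Suc N" using assms(3) by (cases M) auto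
  have A: "(\<Sum>i<M. h (e - (s + i))) - (\<Sum>i<M. h (e' - (s + i))) = h (e - s) - h (e' - (s + N))"
    if "e = Suc e'" for h :: "nat \<Rightarrow> real"
    unfolding N by (subst sum.lessThan_Suc_shift, subst sum.lessThan_Suc) (simp add: that)
  have B: "(\<Sum>i<M. h (e - (s + i))) - (\<Sum>i<M. h (e' - (s + i))) = h (e - (s + N)) - h (e' - s)"
    if "e' = Suc e" for h :: "nat \<Rightarrow> real"
    unfolding N by (subst (2) sum.lessThan_Suc_shift, subst sum.lessThan_Suc) (simp add: that)
  consider "e = e'" | "e = Suc e'" | "e' = Suc e" using assms by linarith
  then show thesis
  proof cases
    case 1 then show ?thesis using that[of 0 0] assms(3) by simp
  next
    case 2 then show ?thesis using that[of 0 N] A N by simp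
  next
    case 3 then show ?thesis using that[of N 0] B N by simp
  qed
qed

lemma sum_two_step_differences:
  fixes c :: "nat \<Rightarrow> real"
  shows "(\<Sum>k=1..n. c (k + 1) - c (k - 1)) = c (n + 1) + c n - c 1 - c 0"
  by (induction n) auto

section \<open>Slowly varying measures on the vertices\<close>

context connected_simple_graph
begin

text \<open>For a fixed level \<open>r\<close> the slices grow with the radius \<open>k\<close> but have bounded size, so for most
  \<open>k \<le> n\<close> the slices of \<open>x\<close> and of a neighbour \<open>x'\<close> coincide. Averaging over a long range of
  levels, measured from \<open>x\<close>, absorbs the difference of the distances of \<open>x\<close> and \<open>x'\<close> from \<open>b\<close>.\<close>

lemma partition_of_unity_adjacent:
  assumes b: "b \<in> V" and \<epsilon>: "(\<epsilon>::real) > 0"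
    and sl: "\<And>x k r. x \<in> V \<Longrightarrow> r + k + c0 \<le> d b x \<Longrightarrow> finite (slice b x k r) \<and> card (slice b x k r) \<le> C0"
  obtains \<eta> R where "\<And>x. x \<in> V \<Longrightarrow> fin_prob (\<eta> x)" "\<And>x v. x \<in> V \<Longrightarrow> \<eta> x v \<noteq> 0 \<Longrightarrow> v \<in> V \<and> d x v \<le> R"
    "\<And>x x'. x \<in> V \<Longrightarrow> x' \<in> V \<Longrightarrow> d x x' = 1 \<Longrightarrow> l1 (\<lambda>v. \<eta> x v - \<eta> x' v) \<le> \<epsilon>"
proof -
  define C where "C = max C0 1"
  \<comment> \<open>\<open>4 * C / n\<close> comes from moving the centre of the slices,
    \<open>2 / n\<close> from moving the levels.\<close>
  define n where "n = Suc (nat \<lceil>(4 * real C + 2) / \<epsilon>\<rceil>)"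
  have n0: "n > 0" by (simp add: n_def)
  have nle: "(4 * real C + 2) / real n \<le> \<epsilon>"
  proof -
    have "(4 * real C + 2) / \<epsilon> \<le> real n" unfolding n_def by linarith
    then show ?thesis using \<epsilon> n0 by (simp add: divide_le_eq mult.commute)
  qed
  \<comment> \<open>Radii up to \<open>n + 1\<close> occur, so levels at least \<open>s\<close>
    below that of \<open>x\<close> satisfy the assumption on slices.\<close>
  define s where "s = n + 1 + c0"
  \<comment> \<open>Truncated: near \<open>b\<close> the level is 0 and the slice is contained in
    \<open>{b}\<close>, which is why \<open>C\<close> is at least 1.\<close>
  define lev where "lev x i = d b x - (s + i)" for x i
  have fs: "finite (slice b x k (lev x i)) \<and> card (slice b x k (lev x i)) \<le> C"
    if x: "x \<in> V" "k \<le> n + 1" for x k i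
  proof (cases "s + i \<le> d b x")
    case True
    then have "lev x i + k + c0 \<le> d b x" using x by (simp add: lev_def s_def)
    from sl[OF x(1) this] show ?thesis by (auto simp: C_def le_max_iff_disj)
  next
    case False
    then have "slice b x k (lev x i) \<subseteq> {b}" using slice_0[OF b] by (simp add: lev_def)
    then show ?thesis using card_mono[of "{b}" "slice b x k (lev x i)"] finite_subset[of _ "{b}"] by (auto simp: C_def)
  qed
  have ne: "slice b x k (lev x i) \<noteq> {}" if "x \<in> V" for x k i
    by (rule slice_nonempty[OF b that]) (simp add: lev_def)
  define J where "J = {..<n} \<times> {1..n}"
  have J: "finite J" "J \<noteq> {}" "card J = n * n" using n0 by (auto simp: J_def)
  define u where "u x k r = unif (slice b x k r)" for x k r
  \<comment> \<open>\<open>y\<close> is the centre of the slices, \<open>z\<close> the vertex from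
    which levels are measured; \<open>\<zeta> x' x\<close> mediates between
    \<open>\<zeta> x x\<close> and \<open>\<zeta> x' x'\<close>.\<close>
  define \<zeta> where "\<zeta> y z v = (1 / real (card J)) * (\<Sum>(i, k)\<in>J. u y k (lev z i) v)" for y z v
  have fpu: "fin_prob (u x' k (lev x i))" if "x \<in> V" "x' \<in> V" "d x x' \<le> 1" "1 \<le> k" "k \<le> n" for x x' k i
  proof -
    have "slice b x' k (lev x i) \<subseteq> slice b x (k + 1) (lev x i)"
      by (rule slice_subset) (use that in auto)
    then have "finite (slice b x' k (lev x i))"
      using fs[OF that(1), of "k + 1" i] that(5) finite_subset by auto
    moreover have "slice b x (k - 1) (lev x i) \<subseteq> slice b x' k (lev x i)"
      by (rule slice_subset) (use that d_sym[of x x'] in auto)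
    ultimately show ?thesis using ne[OF that(1), of "k - 1" i] by (auto simp: u_def intro: fin_prob_unif)
  qed
  have fp: "fin_prob (\<zeta> x' x)" if "x \<in> V" "x' \<in> V" "d x x' \<le> 1" for x x'
  proof -
    have "fin_prob (\<lambda>v. (1 / real (card J)) * (\<Sum>j\<in>J. (case j of (i, k) \<Rightarrow> u x' k (lev x i)) v))"
      by (rule fin_prob_average[OF J(1,2)]) (use that fpu in \<open>auto simp: J_def\<close>)
    then show ?thesis by (simp add: \<zeta>_def[abs_def] split_def)
  qed
  have supp: "v \<in> V \<and> d x v \<le> 2 * n + s + n" if x: "x \<in> V" and v: "\<zeta> x x v \<noteq> 0" for x v
  proof -
    have "\<exists>i k. i < n \<and> 1 \<le> k \<and> k \<le> n \<and> u x k (lev x i) v \<noteq> 0"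
    proof (rule ccontr)
      assume "\<not> ?thesis"
      then have "\<zeta> x x v = 0" by (auto simp: \<zeta>_def J_def intro!: sum.neutral)
      then show False using v by simp
    qed
    then obtain i k where i: "i < n" "k \<le> n" "v \<in> slice b x k (lev x i)"
      by (auto simp: u_def unif_def split: if_splits)
    have "d x v + lev x i \<le> d b x + 2 * k" by (rule slice_dist[OF b x i(3)])
    moreover have "d b x \<le> lev x i + (s + i)" by (simp add: lev_def)
    ultimately have "d x v \<le> 2 * n + s + n" using i(1,2) by linarith
    then show ?thesis using i(3) by (simp add: slice_def)
  qed
  have nn: "real (card J) = real n * real n" using J(3) by simp
  \<comment> \<open>At equal levels both slices of radius \<open>k\<close> lie between those of
    \<open>x\<close> with radii \<open>k - 1\<close> and \<open>k + 1\<close>; summed over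
    \<open>k\<close>, the gaps telescope.\<close>
  have cmp1: "l1 (\<lambda>v. \<zeta> x x v - \<zeta> x' x v) \<le> 4 * real C / real n"
    if x: "x \<in> V" "x' \<in> V" "d x x' = 1" for x x'
  proof -
    have xx: "d x x \<le> 1" using d_self x by simp
    define D where "D = (\<lambda>(i, k) v. u x k (lev x i) v - u x' k (lev x i) v)"
    have fD: "finite (supp (D j))" if j: "j \<in> J" for j
    proof -
      obtain i k where j': "j = (i, k)" "1 \<le> k" "k \<le> n" using j by (auto simp: J_def)
      have "fin_prob (u x k (lev x i))" "fin_prob (u x' k (lev x i))"
        using fpu[OF x(1,1) xx j'(2,3)] fpu[OF x(1,2) _ j'(2,3)] x(3) by auto
      then show ?thesis unfolding j'(1) D_def prod.case by (intro finite_supp_diff fin_probD(1))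
    qed
    have fS: "finite (supp (\<lambda>v. \<Sum>j\<in>J. D j v))" by (rule finite_supp_sum[OF J(1) fD])
    have e: "(\<lambda>v. \<zeta> x x v - \<zeta> x' x v) = (\<lambda>v. (1 / real (card J)) * (\<Sum>j\<in>J. D j v))"
      by (simp add: \<zeta>_def D_def fun_eq_iff split_def sum_subtractf right_diff_distrib)
    have Dle: "l1 (D (i, k)) \<le> 2 * (real (card (slice b x (k + 1) (lev x i))) - real (card (slice b x (k - 1) (lev x i))))"
      if k: "1 \<le> k" "k \<le> n" for i k
      unfolding D_def u_def prod.case
    proof (rule l1_unif_diff_le)
      show "finite (slice b x (k + 1) (lev x i))" using fs[OF x(1), of "k + 1" i] k by simp
      show "slice b x (k - 1) (lev x i) \<noteq> {}" by (rule ne[OF x(1)])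
      show "slice b x (k - 1) (lev x i) \<subseteq> slice b x k (lev x i)"
        "slice b x k (lev x i) \<subseteq> slice b x (k + 1) (lev x i)"
        by (rule slice_subset; use x d_self in simp)+
      show "slice b x (k - 1) (lev x i) \<subseteq> slice b x' k (lev x i)"
        by (rule slice_subset) (use x k d_sym[OF x(1,2)] in auto)
      show "slice b x' k (lev x i) \<subseteq> slice b x (k + 1) (lev x i)"
        by (rule slice_subset) (use x in auto)
    qed
    have col: "(\<Sum>k=1..n. l1 (D (i, k))) \<le> 4 * real C" for i
    proof -
      define c where "c k = real (card (slice b x k (lev x i)))" for k
      have "(\<Sum>k=1..n. l1 (D (i, k))) \<le> (\<Sum>k=1..n. 2 * (c (k + 1) - c (k - 1)))"
        by (rule sum_mono) (use Dle in \<open>simp add: c_def\<close>)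
      also have "\<dots> = 2 * (c (n + 1) + c n - c 1 - c 0)"
        unfolding sum_distrib_left[symmetric] sum_two_step_differences ..
      also have "\<dots> \<le> 2 * (c (n + 1) + c n)" by (simp add: c_def)
      also have "\<dots> \<le> 2 * (real C + real C)"
        using fs[OF x(1), of "n + 1" i] fs[OF x(1), of n i] by (simp add: c_def)
      finally show ?thesis by simp
    qed
    have "l1 (\<lambda>v. \<Sum>j\<in>J. D j v) \<le> (\<Sum>j\<in>J. l1 (D j))" by (intro l1_sum_le J fD)
    also have "\<dots> = (\<Sum>i<n. \<Sum>k=1..n. l1 (D (i, k)))"
      unfolding J_def by (simp add: sum.cartesian_product)
    also have "\<dots> \<le> (\<Sum>i<n. 4 * real C)" by (rule sum_mono) (rule col)
    finally have "l1 (\<lambda>v. \<Sum>j\<in>J. D j v) \<le> real n * (4 * real C)" by simp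
    from mult_left_mono[OF this, of "1 / real (card J)"] show ?thesis
      unfolding e l1_cmult[OF fS] using n0 by (simp add: nn)
  qed
  \<comment> \<open>All levels but one on each side cancel. Of the \<open>n * n\<close> differences
    \<open>n\<close> are left, each of norm at most 2.\<close>
  have cmp2: "l1 (\<lambda>v. \<zeta> x' x v - \<zeta> x' x' v) \<le> 2 / real n"
    if x: "x \<in> V" "x' \<in> V" "d x x' = 1" for x x'
  proof -
    have xx: "d x' x' \<le> 1" using d_self x by simp
    have "d b x \<le> Suc (d b x')" "d b x' \<le> Suc (d b x)"
      using d_triangle[OF b x(1,2)] d_triangle[OF b x(2,1)] d_sym[OF x(1,2)] x(3) by auto
    from shifted_sum_diff[OF this n0, of s] obtain i i' where i: "i < n" "i' < n"
      "\<And>h :: nat \<Rightarrow> real. (\<Sum>i<n. h (lev x i)) - (\<Sum>i<n. h (lev x' i)) = h (lev x i) - h (lev x' i')"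
      unfolding lev_def by blast
    define D where "D k v = u x' k (lev x i) v - u x' k (lev x' i') v" for k v
    have p: "fin_prob (u x' k (lev x i))" "fin_prob (u x' k (lev x' i'))" if "k \<in> {1..n}" for k
      using that fpu[OF x(1,2)] fpu[OF x(2,2) xx] x(3) by auto
    have fD: "finite (supp (D k))" if "k \<in> {1..n}" for k
      unfolding D_def[abs_def] using p[OF that] by (intro finite_supp_diff fin_probD(1))
    have fS: "finite (supp (\<lambda>v. \<Sum>k=1..n. D k v))" by (rule finite_supp_sum[OF _ fD]) auto
    have sw: "(\<Sum>(i, k)\<in>J. u x' k (lev z i) v) = (\<Sum>i<n. \<Sum>k=1..n. u x' k (lev z i) v)" for z v
      unfolding J_def by (simp add: sum.cartesian_product)
    have "\<zeta> x' x v - \<zeta> x' x' v = (1 / real (card J)) * (\<Sum>k=1..n. D k v)" for v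
      unfolding \<zeta>_def sw right_diff_distrib[symmetric] i(3)[of "\<lambda>r. \<Sum>k=1..n. u x' k r v"]
      by (simp add: D_def sum_subtractf)
    then have e: "(\<lambda>v. \<zeta> x' x v - \<zeta> x' x' v) = (\<lambda>v. (1 / real (card J)) * (\<Sum>k=1..n. D k v))"
      by (rule ext)
    have "l1 (\<lambda>v. \<Sum>k=1..n. D k v) \<le> (\<Sum>k=1..n. l1 (D k))" by (intro l1_sum_le fD) auto
    also have "\<dots> \<le> (\<Sum>k=1..n. 2)"
      unfolding D_def[abs_def] by (rule sum_mono) (use p in \<open>auto intro: l1_fin_prob_diff_le\<close>)
    finally have "l1 (\<lambda>v. \<Sum>k=1..n. D k v) \<le> real n * 2" by simp
    from mult_left_mono[OF this, of "1 / real (card J)"] show ?thesis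
      unfolding e l1_cmult[OF fS] using n0 by (simp add: nn)
  qed
  show thesis
  proof (rule that[of "\<lambda>x. \<zeta> x x" "2 * n + s + n"])
    show "fin_prob (\<zeta> x x)" if "x \<in> V" for x using fp[OF that that] d_self[OF that] by simp
    show "v \<in> V \<and> d x v \<le> 2 * n + s + n" if "x \<in> V" "\<zeta> x x v \<noteq> 0" for x v using supp[OF that] .
    fix x x' assume x: "x \<in> V" "x' \<in> V" "d x x' = 1"
    have "fin_prob (\<zeta> x x)" "fin_prob (\<zeta> x' x)" "fin_prob (\<zeta> x' x')"
      using fp x d_self[OF x(1)] d_self[OF x(2)] by auto
    then have "l1 (\<lambda>v. \<zeta> x x v - \<zeta> x' x' v) \<le> l1 (\<lambda>v. \<zeta> x x v - \<zeta> x' x v) + l1 (\<lambda>v. \<zeta> x' x v - \<zeta> x' x' v)"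
      by (intro l1_triangle fin_probD(1))
    also have "\<dots> \<le> 4 * real C / real n + 2 / real n" using cmp1[OF x] cmp2[OF x] by (rule add_mono)
    also have "\<dots> = (4 * real C + 2) / real n" by (simp add: add_divide_distrib)
    finally show "l1 (\<lambda>v. \<zeta> x x v - \<zeta> x' x' v) \<le> \<epsilon>" using nle by linarith
  qed
qed

lemma l1_le_mult_d:
  assumes p: "\<And>x. x \<in> V \<Longrightarrow> fin_prob (\<eta> x)"
    and adj: "\<And>x x'. x \<in> V \<Longrightarrow> x' \<in> V \<Longrightarrow> d x x' = 1 \<Longrightarrow> l1 (\<lambda>v. \<eta> x v - \<eta> x' v) \<le> \<epsilon>"
    and "x \<in> V" "x' \<in> V"
  shows "l1 (\<lambda>v. \<eta> x v - \<eta> x' v) \<le> \<epsilon> * real (d x x')"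
  using assms(3)
proof (induction "d x x'" arbitrary: x)
  case 0
  then have "x = x'" using d_eq_0 assms(4) by simp
  then show ?case using d_self assms(4) by (simp add: l1_def supp_def)
next
  case (Suc k)
  have "1 \<le> d x x'" using Suc(2) by simp
  from between_point[OF Suc(3) assms(4) this]
  obtain y where y: "y \<in> V" "d x y = 1" "d y x' = d x x' - 1" by blast
  have "l1 (\<lambda>v. \<eta> x v - \<eta> x' v) \<le> l1 (\<lambda>v. \<eta> x v - \<eta> y v) + l1 (\<lambda>v. \<eta> y v - \<eta> x' v)"
    using p Suc(3) y(1) assms(4) by (intro l1_triangle fin_probD(1)) auto
  also have "\<dots> \<le> \<epsilon> + \<epsilon> * real (d y x')"
    using adj[OF Suc(3) y(1,2)] Suc(1)[of y] Suc(2) y by (intro add_mono) simp_all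
  also have "\<dots> = \<epsilon> * real (d x x')"
    unfolding y(3) Suc(2)[symmetric] by (simp add: algebra_simps)
  finally show ?case .
qed

end

section \<open>Group actions on fine hyperbolic graphs\<close>

locale graph_group_action = group_action G V \<phi> + connected_simple_graph V E
  for G (structure) and V :: "'v set" and E and \<phi> +
  assumes edge_iff: "g \<in> carrier G \<Longrightarrow> u \<in> V \<Longrightarrow> v \<in> V \<Longrightarrow> {\<phi> g u, \<phi> g v} \<in> E \<longleftrightarrow> {u, v} \<in> E"
begin

sublocale group G using group_hom group_hom.axioms(1) by blast

lemma act_closed: "g \<in> carrier G \<Longrightarrow> x \<in> V \<Longrightarrow> \<phi> g x \<in> V"
  using element_image by blast

lemma act_one: "x \<in> V \<Longrightarrow> \<phi> \<one> x = x"
  using id_eq_one by (metis restrict_apply')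

lemma act_inv:
  assumes "g \<in> carrier G" "x \<in> V"
  shows "\<phi> (inv g) (\<phi> g x) = x" "\<phi> g (\<phi> (inv g) x) = x"
  using assms by (simp_all add: composition_rule[symmetric] act_one)

lemma graph_path_act:
  assumes g: "g \<in> carrier G" and xs: "graph_path V E xs"
  shows "graph_path V E (map (\<phi> g) xs)"
proof -
  have V: "set xs \<subseteq> V" "xs \<noteq> []" and s: "successively (\<lambda>x y. x = y \<or> {x, y} \<in> E) xs"
    using xs by (auto simp: graph_path_def)
  have "successively (\<lambda>x y. \<phi> g x = \<phi> g y \<or> {\<phi> g x, \<phi> g y} \<in> E) xs"
  proof (rule successively_mono[OF s])
    fix x y assume "x \<in> set xs" "y \<in> set xs" "x = y \<or> {x, y} \<in> E"
    then show "\<phi> g x = \<phi> g y \<or> {\<phi> g x, \<phi> g y} \<in> E"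
      using edge_iff[OF g, of x y] V(1) by blast
  qed
  then show ?thesis using V act_closed[OF g] by (auto simp: graph_path_def successively_map)
qed

lemma d_act:
  assumes g: "g \<in> carrier G" and x: "x \<in> V" "y \<in> V"
  shows "d (\<phi> g x) (\<phi> g y) = d x y"
proof -
  have le: "d (\<phi> h u) (\<phi> h v) \<le> d u v" if h: "h \<in> carrier G" and u: "u \<in> V" "v \<in> V" for h u v
  proof -
    obtain xs where xs: "path_between V E u v xs" "length xs = Suc (d u v)"
      using shortest_path u by blast
    then have "path_between V E (\<phi> h u) (\<phi> h v) (map (\<phi> h) xs)"
      using graph_path_act[OF h] by (auto simp: path_between_def graph_path_def hd_map last_map)
    then show ?thesis by (intro d_le walk_withinI) (auto simp: xs)
  qed
  show ?thesis
    using le[OF g x] le[OF inv_closed[OF g], of "\<phi> g x" "\<phi> g y"] act_inv[OF g] act_closed[OF g] x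
    by simp
qed

lemma circuit_vertices_act:
  assumes g: "g \<in> carrier G" shows "\<phi> g ` circuit_vertices V E n e \<subseteq> circuit_vertices V E n (\<phi> g ` e)"
proof
  fix w assume "w \<in> \<phi> g ` circuit_vertices V E n e"
  then obtain v xs where w: "w = \<phi> g v" and xs: "circuit V E xs" "path_length xs \<le> n"
    "path_contains_edge xs e" "v \<in> set xs" by (auto simp: circuit_vertices_def)
  have p: "graph_path V E xs" and ne: "xs \<noteq> []" and V: "set xs \<subseteq> V"
    using xs(1) by (auto simp: circuit_def graph_path_def)
  have "set (butlast xs) \<subseteq> V" using V in_set_butlastD by fast
  then have "inj_on (\<phi> g) (set (butlast xs))" using inj_prop[OF g] inj_on_subset by blast
  then have "circuit V E (map (\<phi> g) xs)"
    using xs(1) graph_path_act[OF g p] ne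
    by (auto simp: circuit_def hd_map last_map map_butlast[symmetric] distinct_map)
  moreover have "path_length (map (\<phi> g) xs) \<le> n" using xs(2) by (simp add: path_length_def)
  moreover have "path_contains_edge (map (\<phi> g) xs) (\<phi> g ` e)"
    using xs(3) by (force simp: path_contains_edge_def)
  ultimately show "w \<in> circuit_vertices V E n (\<phi> g ` e)"
    unfolding circuit_vertices_def w using xs(4) by force
qed

lemma edge_subset: "e \<in> E \<Longrightarrow> e \<subseteq> V"
  using conn by (auto simp: connected_graph_def simple_graph_def)

lemma circuit_vertices_subset: "circuit_vertices V E n e \<subseteq> V"
  by (auto simp: circuit_vertices_def circuit_def graph_path_def)

lemma card_circuit_vertices_act:
  assumes fine: "fine_graph V E" and g: "g \<in> carrier G" and e: "e \<in> E" "\<phi> g ` e \<in> E"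
  shows "card (circuit_vertices V E n (\<phi> g ` e)) = card (circuit_vertices V E n e)"
proof (rule antisym)
  have le: "card (circuit_vertices V E n a) \<le> card (circuit_vertices V E n (\<phi> h ` a))"
    if h: "h \<in> carrier G" and a: "\<phi> h ` a \<in> E" for h a
  proof -
    have "inj_on (\<phi> h) (circuit_vertices V E n a)"
      using inj_prop[OF h] circuit_vertices_subset inj_on_subset by blast
    then have "card (circuit_vertices V E n a) = card (\<phi> h ` circuit_vertices V E n a)"
      by (simp add: card_image)
    also have "\<dots> \<le> card (circuit_vertices V E n (\<phi> h ` a))"
      by (rule card_mono[OF finite_circuit_vertices[OF fine a] circuit_vertices_act[OF h]])
    finally show ?thesis .
  qed
  show "card (circuit_vertices V E n e) \<le> card (circuit_vertices V E n (\<phi> g ` e))"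
    by (rule le[OF g e(2)])
  have "\<phi> (inv g) ` \<phi> g ` e = e" using act_inv(1)[OF g] edge_subset[OF e(1)] by force
  then show "card (circuit_vertices V E n (\<phi> g ` e)) \<le> card (circuit_vertices V E n e)"
    using le[OF inv_closed[OF g], of "\<phi> g ` e"] e(1) by simp
qed

text \<open>Fineness gives finiteness edge by edge; the common bound comes from the finitely many
  orbits of edges, as the cardinality is constant on each.\<close>

lemma card_circuit_vertices_bounded:
  assumes fine: "fine_graph V E" and fin: "finite (orbits G E (\<lambda>g e. \<phi> g ` e))"
  obtains C where "\<And>e. e \<in> E \<Longrightarrow> card (circuit_vertices V E n e) \<le> C"
proof -
  define c where "c e = card (circuit_vertices V E n e)" for e
  define r where "r ob = (SOME e. e \<in> ob \<and> e \<in> E)" for ob :: "'v set set"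
  have "c ` E \<subseteq> (\<lambda>ob. c (r ob)) ` orbits G E (\<lambda>g e. \<phi> g ` e)"
  proof
    fix k assume "k \<in> c ` E"
    then obtain e where e: "e \<in> E" "k = c e" by blast
    let ?ob = "orbit G (\<lambda>g e. \<phi> g ` e) e"
    have "\<phi> \<one> ` e = e" using edge_subset[OF e(1)] act_one by force
    then have "e \<in> ?ob" unfolding orbit_def by force
    then have "r ?ob \<in> ?ob \<and> r ?ob \<in> E"
      using someI[where P = "\<lambda>a. a \<in> ?ob \<and> a \<in> E" and x = e] e(1) unfolding r_def by blast
    then obtain g where "g \<in> carrier G" "r ?ob = \<phi> g ` e" "r ?ob \<in> E" by (auto simp: orbit_def)
    then have "c (r ?ob) = k" using card_circuit_vertices_act[OF fine _ e(1)] e(2) by (simp add: c_def)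
    then show "k \<in> (\<lambda>ob. c (r ob)) ` orbits G E (\<lambda>g e. \<phi> g ` e)"
      using e(1) by (auto simp: orbits_def)
  qed
  then have "finite (c ` E)" using fin finite_surj by blast
  then have le: "c e \<le> Max (c ` E)" if "e \<in> E" for e using that by simp
  show thesis by (rule that[of "Max (c ` E)"]) (use le in \<open>simp only: c_def\<close>)
qed

section \<open>Orbit representatives and cosets of stabilizers\<close>

definition rep :: "'v \<Rightarrow> 'v" where
  "rep v = (SOME u. u \<in> orbit G \<phi> v)"

text \<open>A left coset of the stabilizer of \<open>rep v\<close>; the cosets belonging to the
  vertices of one orbit partition the group.\<close>

definition rep_coset :: "'v \<Rightarrow> 'a set" where
  "rep_coset v = {g \<in> carrier G. \<phi> g (rep v) = v}"

lemma rep_orbit: "v \<in> V \<Longrightarrow> rep v \<in> orbit G \<phi> v"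
  unfolding rep_def
  by (rule someI[where x = v and P = "\<lambda>u. u \<in> orbit G \<phi> v"]) (rule orbit_refl)

lemma rep_in: "v \<in> V \<Longrightarrow> rep v \<in> V"
  using rep_orbit act_closed by (force simp: orbit_def)

lemma orbit_act:
  assumes "g \<in> carrier G" "v \<in> V" shows "orbit G \<phi> (\<phi> g v) = orbit G \<phi> v"
proof
  show "orbit G \<phi> (\<phi> g v) \<subseteq> orbit G \<phi> v"
    using assms by (auto simp: orbit_def composition_rule[symmetric])
  show "orbit G \<phi> v \<subseteq> orbit G \<phi> (\<phi> g v)"
  proof
    fix u assume "u \<in> orbit G \<phi> v"
    then obtain h where h: "h \<in> carrier G" "u = \<phi> h v" by (auto simp: orbit_def)
    then have "u = \<phi> (h \<otimes> inv g) (\<phi> g v)"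
      using assms by (simp add: composition_rule act_inv act_closed)
    then show "u \<in> orbit G \<phi> (\<phi> g v)" using h assms by (auto simp: orbit_def)
  qed
qed

text \<open>\<open>rep\<close> chooses from the orbit as a set, so the choice depends on the orbit
  only.\<close>

lemma rep_act: "g \<in> carrier G \<Longrightarrow> v \<in> V \<Longrightarrow> rep (\<phi> g v) = rep v"
  by (simp add: rep_def orbit_act)

lemma finite_rep: "finite (orbits G V \<phi>) \<Longrightarrow> finite (rep ` V)"
proof -
  have "rep ` V = (\<lambda>ob. SOME u. u \<in> ob) ` orbits G V \<phi>" by (auto simp: rep_def orbits_def)
  then show "finite (orbits G V \<phi>) \<Longrightarrow> finite (rep ` V)" by simp
qed

lemma rep_coset_nonempty: assumes "v \<in> V" shows "\<exists>g. g \<in> rep_coset v"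
proof -
  obtain g where g: "g \<in> carrier G" "rep v = \<phi> g v" using rep_orbit[OF assms] by (auto simp: orbit_def)
  then have "inv g \<in> rep_coset v" using assms act_inv by (simp add: rep_coset_def)
  then show ?thesis ..
qed

lemma rep_coset_carrier: "rep_coset v \<subseteq> carrier G"
  by (auto simp: rep_coset_def)

lemma rep_coset_mult:
  assumes g: "g \<in> carrier G" and v: "v \<in> V" and h: "h \<in> rep_coset v"
  shows "g \<otimes> h \<in> rep_coset (\<phi> g v)"
  using assms rep_in[OF v] by (simp add: rep_coset_def rep_act composition_rule)

text \<open>Every coset is a left translate of one of finitely many stabilizers.\<close>

lemma unif_exact_rep_cosets:
  assumes fin: "finite (orbits G V \<phi>)"
    and st: "\<And>x. x \<in> V \<Longrightarrow> unif_exact G {stabilizer G \<phi> x}"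
  shows "unif_exact G (rep_coset ` V)"
proof -
  have "unif_exact G (\<Union>r\<in>rep ` V. {stabilizer G \<phi> r})"
    by (rule unif_exact_finite_UN[OF finite_rep[OF fin]]) (use st rep_in in auto)
  then show ?thesis
  proof (rule unif_exact_coarse[where T = "{\<one>}"])
    show "W \<subseteq> carrier G" if "W \<in> (\<Union>r\<in>rep ` V. {stabilizer G \<phi> r})" for W
      using that stabilizer_subset by blast
    fix U assume "U \<in> rep_coset ` V"
    then obtain v where v: "v \<in> V" "U = rep_coset v" by blast
    obtain h where h: "h \<in> rep_coset v" using rep_coset_nonempty[OF v(1)] by blast
    then have hc: "h \<in> carrier G" "\<phi> h (rep v) = v" by (auto simp: rep_coset_def)
    show "\<exists>h\<in>carrier G. \<exists>W\<in>\<Union>r\<in>rep ` V. {stabilizer G \<phi> r}. \<forall>g\<in>U. \<exists>w\<in>W. \<exists>t\<in>{\<one>}. g = h \<otimes> w \<otimes> t"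
    proof (intro bexI[OF _ hc(1)] bexI[of _ "stabilizer G \<phi> (rep v)"] ballI)
      fix g assume "g \<in> U"
      then have g: "g \<in> carrier G" "\<phi> g (rep v) = v" by (auto simp: v(2) rep_coset_def)
      have "\<phi> (inv h) v = rep v" using act_inv(1)[OF hc(1) rep_in[OF v(1)]] hc(2) by simp
      then have "inv h \<otimes> g \<in> stabilizer G \<phi> (rep v)"
        using g hc rep_in[OF v(1)] by (simp add: stabilizer_def composition_rule)
      moreover have "g = h \<otimes> (inv h \<otimes> g) \<otimes> \<one>" using g hc by (simp add: mult_inv_cancel)
      ultimately show "\<exists>w\<in>stabilizer G \<phi> (rep v). \<exists>t\<in>{\<one>}. g = h \<otimes> w \<otimes> t" by blast
    qed (use v in blast)
  qed auto
qed

definition ball_cosets :: "'v \<Rightarrow> nat \<Rightarrow> 'a set" where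
  "ball_cosets b n = (\<Union>v\<in>{v \<in> V. d b v \<le> n}. rep_coset v)"

lemma ball_cosets_carrier: "ball_cosets b n \<subseteq> carrier G"
  using rep_coset_carrier by (auto simp: ball_cosets_def)

text \<open>The translate by \<open>g\<close> of a geodesic from \<open>r\<close> to \<open>r'\<close>, continued by geodesics from
  \<open>\<phi> g r'\<close> to \<open>b\<close> and from \<open>b\<close> to a predecessor of \<open>\<phi> g r\<close>, avoids \<open>\<phi> g r\<close> after its first
  step \<open>\<phi> g w\<close>. So the predecessor lies on a short circuit through the edge \<open>{\<phi> g r, \<phi> g w}\<close>.\<close>

lemma predecessor_in_circuit_vertices:
  assumes b: "b \<in> V" and g: "g \<in> carrier G" and w: "r \<in> V" "w \<in> V" "r' \<in> V" "d r w = 1"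
    "d w r' + 1 = d r r'"
    and v: "d b (\<phi> g r) = Suc n" "d b (\<phi> g r') = Suc n" "\<phi> g r \<noteq> \<phi> g r'"
  obtains u where "u \<in> V" "d b (\<phi> g u) \<le> n" "u \<in> circuit_vertices V E (d r r' + 2 * n + 2) {r, w}"
proof -
  define v where "v = \<phi> g r"
  define v' where "v' = \<phi> g r'"
  define w' where "w' = \<phi> g w"
  have V: "v \<in> V" "v' \<in> V" "w' \<in> V" using g w by (simp_all add: v_def v'_def w'_def act_closed)
  have dd: "d v w' = 1" "d w' v' + 1 = d v v'" "d v v' = d r r'"
    using g w d_act by (simp_all add: v_def v'_def w'_def)
  have lev: "d b v = Suc n" "d b v' = Suc n" "v \<noteq> v'" using v by (simp_all add: v_def v'_def)
  have "n \<le> d b v" using lev by simp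
  from between_point[OF b V(1) this] obtain u where u: "u \<in> V" "d b u = n" "d u v = 1"
    using lev by auto
  have e: "{w', v} \<in> E" using d_edge[OF V(1,3) dd(1)] by (simp add: insert_commute)
  define A where "A = V - {v}"
  have "walk_within E A (d w' v') w' v'"
  proof (rule geodesic_walk_within[OF V(3,2)])
    fix x assume "x \<in> V" "d w' x + d x v' = d w' v'"
    then show "x \<in> A" using dd d_sym[OF V(1,3)] by (auto simp: A_def)
  qed
  moreover have "walk_within E A (d v' b) v' b"
  proof (rule geodesic_walk_within[OF V(2) b])
    fix x assume "x \<in> V" "d v' x + d x b = d v' b"
    moreover have "d v' v \<noteq> 0" using d_eq_0[OF V(2,1)] lev by auto
    ultimately show "x \<in> A" using lev d_sym[OF b V(2)] d_sym[OF b V(1)] by (auto simp: A_def)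
  qed
  moreover have "walk_within E A (d b u) b u"
  proof (rule geodesic_walk_within[OF b u(1)])
    fix x assume "x \<in> V" "d b x + d x u = d b u"
    then show "x \<in> A" using lev u by (auto simp: A_def)
  qed
  ultimately have wA: "walk_within E A (d w' v' + d v' b + d b u) w' u" by (meson walk_within_trans)
  have wB: "walk_within E {u, v} 1 u v" by (rule walk_within_edge) (use d_edge[OF u(1) V(1) u(3)] in auto)
  have "u \<in> circuit_vertices V E (d w' v' + d v' b + d b u + 1 + 1) {w', v}"
    by (rule mem_circuit_vertices[OF e _ _ _ wA wB]) (use V u in \<open>auto simp: A_def\<close>)
  \<comment> \<open>The summands are \<open>d r r' - 1\<close>, \<open>n + 1\<close>,
    \<open>n\<close>, the edge from \<open>u\<close> to \<open>v\<close> and the closing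
    edge.\<close>
  moreover have "d w' v' + d v' b + d b u + 1 + 1 = d r r' + 2 * n + 2"
    using dd lev u d_sym[OF b V(2)] by simp
  ultimately have "u \<in> circuit_vertices V E (d r r' + 2 * n + 2) {w', v}" by (simp only:)
  \<comment> \<open>Translating back by \<open>g\<close> puts the circuit through
    \<open>{r, w}\<close>, an edge that does not depend on \<open>g\<close>.\<close>
  then have "\<phi> (inv g) u \<in> circuit_vertices V E (d r r' + 2 * n + 2) (\<phi> (inv g) ` {w', v})"
    using circuit_vertices_act[OF inv_closed[OF g]] by blast
  moreover have "\<phi> (inv g) ` {w', v} = {r, w}"
    using act_inv(1)[OF g] w by (auto simp: w'_def v_def)
  ultimately have "\<phi> (inv g) u \<in> circuit_vertices V E (d r r' + 2 * n + 2) {r, w}" by simp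
  then show thesis
    using that[of "\<phi> (inv g) u"] act_inv(2)[OF g u(1)] act_closed[OF inv_closed[OF g] u(1)] u(2) by simp
qed

lemma unif_exact_ball_cosets:
  assumes fine: "fine_graph V E" and fin: "finite (orbits G V \<phi>)"
    and co: "unif_exact G (rep_coset ` V)" and b: "b \<in> V"
  shows "unif_exact G {ball_cosets b n}"
proof (induction n)
  case 0
  have "ball_cosets b 0 \<subseteq> rep_coset b" using b d_eq_0[OF b] by (auto simp: ball_cosets_def)
  then show ?case
    by (intro unif_exact_mono[OF co]) (use b rep_coset_carrier in auto)
next
  case (Suc n)
  define I where "I = {v \<in> V. d b v = Suc n}"
  show ?case
  proof (rule unif_exact_union[where X = rep_coset and I = I and ?Y0.0 = "ball_cosets b n"])
    show "ball_cosets b (Suc n) \<subseteq> carrier G" by (rule ball_cosets_carrier)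
    show "g \<in> ball_cosets b n \<or> (\<exists>i\<in>I. g \<in> rep_coset i)" if "g \<in> ball_cosets b (Suc n)" for g
      using that by (auto simp: ball_cosets_def I_def le_Suc_eq)
    show "rep_coset i \<subseteq> carrier G" for i by (rule rep_coset_carrier)
    show "unif_exact G (rep_coset ` I)"
      by (rule unif_exact_mono[OF co]) (use rep_coset_carrier in \<open>auto simp: I_def\<close>)
    fix F assume F: "finite F" "F \<subseteq> carrier G"
    \<comment> \<open>If \<open>g\<close> is in the coset of \<open>i\<close> and
      \<open>g \<otimes> f\<close> in that of \<open>j\<close>, then \<open>\<phi> g r = i\<close>
      and \<open>\<phi> g (\<phi> f r') = j\<close> for the representatives \<open>r\<close>,
      \<open>r'\<close>; so whether \<open>i\<close> and \<open>j\<close> differ depends only on one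
      of finitely many triples.\<close>
    define P where "P = {(r, f, r'). r \<in> rep ` V \<and> f \<in> F \<and> r' \<in> rep ` V \<and> r \<noteq> \<phi> f r'}"
    have "P \<subseteq> rep ` V \<times> F \<times> rep ` V" by (auto simp: P_def)
    then have finP: "finite P" by (rule finite_subset) (use F finite_rep[OF fin] in auto)
    have "\<forall>p\<in>P. \<exists>w. w \<in> V \<and> d (fst p) w = 1 \<and> d w (\<phi> (fst (snd p)) (snd (snd p))) + 1 = d (fst p) (\<phi> (fst (snd p)) (snd (snd p)))"
    proof
      fix p assume "p \<in> P"
      then obtain r f r' where p: "p = (r, f, r')" "r \<in> V" "f \<in> carrier G" "r' \<in> V" "r \<noteq> \<phi> f r'"
        using F rep_in by (auto simp: P_def)
      have fr: "\<phi> f r' \<in> V" using p act_closed by simp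
      have "1 \<le> d r (\<phi> f r')" using d_eq_0[OF p(2) fr] p(5) by (cases "d r (\<phi> f r')") auto
      from between_point[OF p(2) fr this] show "\<exists>w. w \<in> V \<and> d (fst p) w = 1 \<and>
          d w (\<phi> (fst (snd p)) (snd (snd p))) + 1 = d (fst p) (\<phi> (fst (snd p)) (snd (snd p)))"
        using \<open>1 \<le> d r (\<phi> f r')\<close> unfolding p(1) fst_conv snd_conv by (metis le_add_diff_inverse2)
    qed
    from bchoice[OF this] obtain w where w: "\<And>r f r'. (r, f, r') \<in> P \<Longrightarrow>
      w (r, f, r') \<in> V \<and> d r (w (r, f, r')) = 1 \<and> d (w (r, f, r')) (\<phi> f r') + 1 = d r (\<phi> f r')"
      by force
    \<comment> \<open>Finite and chosen before \<open>g\<close>: wherever two different cosets of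
      the sphere interact, \<open>g\<close> moves some vertex of \<open>Q\<close> into the ball of
      radius \<open>n\<close>.\<close>
    define Q where "Q = (\<Union>(r, f, r')\<in>P. circuit_vertices V E (d r (\<phi> f r') + 2 * n + 2) {r, w (r, f, r')})"
    have finQ: "finite Q" unfolding Q_def
    proof (rule finite_UN_I[OF finP], clarify)
      fix r f r' assume p: "(r, f, r') \<in> P"
      then have "{r, w (r, f, r')} \<in> E" using w[OF p] rep_in by (intro d_edge) (auto simp: P_def)
      then show "finite (circuit_vertices V E (d r (\<phi> f r') + 2 * n + 2) {r, w (r, f, r')})"
        by (rule finite_circuit_vertices[OF fine])
    qed
    have QV: "Q \<subseteq> V" unfolding Q_def using circuit_vertices_subset by blast
    have "\<forall>p\<in>Q. \<exists>t. t \<in> rep_coset p" using rep_coset_nonempty QV by blast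
    from bchoice[OF this] obtain t where t: "\<And>p. p \<in> Q \<Longrightarrow> t p \<in> rep_coset p" by blast
    have tc: "t p \<in> carrier G" if "p \<in> Q" for p using t[OF that] rep_coset_carrier by blast
    \<comment> \<open>For such a vertex \<open>u\<close>, the element \<open>g \<otimes> t u\<close>
      carries \<open>rep u\<close> to \<open>\<phi> g u\<close>, so it lies in
      \<open>ball_cosets b n\<close>; right multiplication by \<open>inv (t u)\<close> leads back to
      \<open>g\<close>.\<close>
    define T where "T = insert \<one> ((\<lambda>p. inv (t p)) ` Q)"
    have T: "finite T" "T \<subseteq> carrier G" using finQ tc by (auto simp: T_def)
    define Y where "Y = ball_cosets b n <#> T"
    have sep: "g \<in> Y" if ij: "i \<in> I" "j \<in> I" "g \<in> rep_coset i" "f \<in> F" "g \<otimes> f \<in> rep_coset j" "i \<noteq> j" for g f i j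
    proof -
      define r where "r = rep i"
      define r' where "r' = rep j"
      have iV: "i \<in> V" "j \<in> V" "d b i = Suc n" "d b j = Suc n" using ij by (auto simp: I_def)
      have g: "g \<in> carrier G" "\<phi> g r = i" using ij(3) by (auto simp: rep_coset_def r_def)
      have f: "f \<in> carrier G" using ij(4) F by blast
      have rV: "r \<in> V" "r' \<in> V" "\<phi> f r' \<in> V" using rep_in iV act_closed[OF f] by (auto simp: r_def r'_def)
      have gj: "\<phi> g (\<phi> f r') = j"
        using ij(5) composition_rule[OF rV(2) g(1) f] by (simp add: rep_coset_def r'_def)
      have p: "(r, f, r') \<in> P" using ij g(2) gj iV by (auto simp: P_def r_def r'_def)
      have W: "w (r, f, r') \<in> V" "d r (w (r, f, r')) = 1" "d (w (r, f, r')) (\<phi> f r') + 1 = d r (\<phi> f r')"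
        using w[OF p] by auto
      obtain u where u: "u \<in> V" "d b (\<phi> g u) \<le> n"
        "u \<in> circuit_vertices V E (d r (\<phi> f r') + 2 * n + 2) {r, w (r, f, r')}"
        by (rule predecessor_in_circuit_vertices[OF b g(1) rV(1) W(1) rV(3) W(2,3), of n])
           (use g(2) gj iV ij(6) in auto)
      then have uQ: "u \<in> Q" using p by (auto simp: Q_def)
      have "g \<otimes> t u \<in> rep_coset (\<phi> g u)" by (rule rep_coset_mult[OF g(1) u(1) t[OF uQ]])
      then have "g \<otimes> t u \<in> ball_cosets b n"
        using u(2) act_closed[OF g(1) u(1)] by (auto simp: ball_cosets_def)
      moreover have "g = (g \<otimes> t u) \<otimes> inv (t u)" using g(1) tc[OF uQ] by (simp add: m_assoc)
      moreover have "inv (t u) \<in> T" using uQ by (auto simp: T_def)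
      ultimately show "g \<in> Y" unfolding Y_def set_mult_def by blast
    qed
    have sub: "ball_cosets b n \<subseteq> Y"
    proof
      fix g assume g: "g \<in> ball_cosets b n"
      then have "g \<otimes> \<one> = g" using ball_cosets_carrier by (intro r_one) blast
      moreover have "g \<otimes> \<one> \<in> Y" using g unfolding Y_def set_mult_def T_def by blast
      ultimately show "g \<in> Y" by simp
    qed
    have Yc: "Y \<subseteq> carrier G" unfolding Y_def by (rule set_mult_closed[OF ball_cosets_carrier T(2)])
    have Yu: "unif_exact G {Y}"
    proof (rule unif_exact_coarse[OF Suc T])
      fix U assume U: "U \<in> {Y}"
      show "\<exists>h\<in>carrier G. \<exists>W\<in>{ball_cosets b n}. \<forall>g\<in>U. \<exists>w\<in>W. \<exists>t\<in>T. g = h \<otimes> w \<otimes> t"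
      proof (rule bexI[of _ \<one>], rule bexI[of _ "ball_cosets b n"], rule ballI)
        fix g assume "g \<in> U"
        then obtain x y where xy: "x \<in> ball_cosets b n" "y \<in> T" "g = x \<otimes> y"
          using U by (auto simp: Y_def set_mult_def)
        then have "\<one> \<otimes> x = x" using ball_cosets_carrier by (intro l_one) blast
        then show "\<exists>w\<in>ball_cosets b n. \<exists>t\<in>T. g = \<one> \<otimes> w \<otimes> t" using xy by metis
      qed auto
    qed (use ball_cosets_carrier in auto)
    show "\<exists>Y. ball_cosets b n \<subseteq> Y \<and> Y \<subseteq> carrier G \<and> unif_exact G {Y} \<and>
       (\<forall>g f i j. i \<in> I \<longrightarrow> j \<in> I \<longrightarrow> g \<in> rep_coset i \<longrightarrow> f \<in> F \<longrightarrow> g \<otimes> f \<in> rep_coset j \<longrightarrow> i \<noteq> j \<longrightarrow> g \<in> Y)"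
      by (intro exI[of _ Y] conjI sub Yc Yu allI impI) (rule sep)
  qed
qed

lemma unif_exact_carrier:
  assumes fine: "fine_graph V E" and hyp: "hyperbolic_graph V E"
    and finV: "finite (orbits G V \<phi>)" and finE: "finite (orbits G E (\<lambda>g e. \<phi> g ` e))"
    and st: "\<And>x. x \<in> V \<Longrightarrow> unif_exact G {stabilizer G \<phi> x}"
  shows "unif_exact G {carrier G}"
proof -
  obtain b where b: "b \<in> V" using conn by (auto simp: connected_graph_def)
  note co = unif_exact_rep_cosets[OF finV st]
  obtain D where D: "\<And>z x y p q. z \<in> V \<Longrightarrow> x \<in> V \<Longrightarrow> y \<in> V \<Longrightarrow> p \<in> V \<Longrightarrow> q \<in> V \<Longrightarrow> d z p = d z q \<Longrightarrow>
    d z p + d p x = d z x \<Longrightarrow> d z q + d q y = d z y \<Longrightarrow> 2 * d z p + d x y \<le> d z x + d z y \<Longrightarrow> d p q \<le> D"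
    by (rule hyperbolic_metric[OF hyp]) (rule that)
  obtain C where C: "\<And>e. e \<in> E \<Longrightarrow> card (circuit_vertices V E (6 * D + 2) e) \<le> C"
    by (rule card_circuit_vertices_bounded[OF fine finE]) (rule that)
  have sl: "finite (slice b x k r) \<and> card (slice b x k r) \<le> C" if x: "x \<in> V" "r + k + (D + 1) \<le> d b x" for x k r
  proof -
    have r: "r + k + D + 1 \<le> d b x" using x by simp
    have "\<exists>e\<in>E. slice b x k r \<subseteq> circuit_vertices V E (6 * D + 2) e"
    proof (rule slice_subset_circuit_vertices[where D = D, OF _ b x(1) r])
      fix z x y p q assume "z \<in> V" "x \<in> V" "y \<in> V" "p \<in> V" "q \<in> V" "d z p = d z q"
        "d z p + d p x = d z x" "d z q + d q y = d z y" "2 * d z p + d x y \<le> d z x + d z y"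
      then show "d p q \<le> D" by (rule D)
    qed blast
    then obtain e where e: "e \<in> E" "slice b x k r \<subseteq> circuit_vertices V E (6 * D + 2) e" by blast
    note f = finite_circuit_vertices[OF fine e(1), of "6 * D + 2"]
    show ?thesis using finite_subset[OF e(2) f] card_mono[OF f e(2)] C[OF e(1)] by simp
  qed
  show ?thesis
  proof (rule unif_exact_combine[OF order_refl, where 'i = 'v])
    fix F and \<epsilon> :: real assume F: "finite F" "F \<subseteq> carrier G" "\<epsilon> > 0"
    \<comment> \<open>\<open>F\<close> displaces \<open>b\<close> by at most \<open>l\<close>, so
      \<open>\<epsilon> / l\<close> is the allowance for one edge.\<close>
    define l where "l = Suc (\<Sum>f\<in>F. d b (\<phi> f b))"
    have l: "d b (\<phi> f b) \<le> l" if "f \<in> F" for f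
      unfolding l_def using member_le_sum[OF that, of "\<lambda>f. d b (\<phi> f b)"] F(1) by simp
    have l0: "l > 0" by (simp add: l_def)
    then have el: "\<epsilon> / real l > 0" using F(3) by simp
    obtain \<eta> R where p: "\<And>x. x \<in> V \<Longrightarrow> fin_prob (\<eta> x)"
      and su: "\<And>x v. x \<in> V \<Longrightarrow> \<eta> x v \<noteq> 0 \<Longrightarrow> v \<in> V \<and> d x v \<le> R"
      and adj: "\<And>x x'. x \<in> V \<Longrightarrow> x' \<in> V \<Longrightarrow> d x x' = 1 \<Longrightarrow> l1 (\<lambda>v. \<eta> x v - \<eta> x' v) \<le> \<epsilon> / real l"
      by (rule partition_of_unity_adjacent[where ?c0.0 = "D + 1" and ?C0.0 = C, OF b el])
         (rule sl, assumption+, rule that)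
    define w where "w g = \<eta> (\<phi> g b)" for g
    have 1: "fin_prob (w g)" if "g \<in> carrier G" for g using p act_closed[OF that b] by (simp add: w_def)
    have 2: "l1 (\<lambda>v. w g v - w (g \<otimes> f) v) \<le> \<epsilon>" if g: "g \<in> carrier G" "f \<in> F" for g f
    proof -
      have f: "f \<in> carrier G" using g F by blast
      have V: "\<phi> g b \<in> V" "\<phi> f b \<in> V" "\<phi> (g \<otimes> f) b \<in> V" using g f b act_closed by auto
      have "d (\<phi> g b) (\<phi> (g \<otimes> f) b) \<le> l"
        using d_act[OF g(1) b V(2)] l[OF g(2)] composition_rule[OF b g(1) f] by simp
      then have "\<epsilon> / real l * real (d (\<phi> g b) (\<phi> (g \<otimes> f) b)) \<le> \<epsilon> / real l * real l"
        using F(3) by (intro mult_left_mono) auto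
      also have "\<dots> = \<epsilon>" using l0 by simp
      finally have "\<epsilon> / real l * real (d (\<phi> g b) (\<phi> (g \<otimes> f) b)) \<le> \<epsilon>" .
      moreover have "l1 (\<lambda>v. \<eta> (\<phi> g b) v - \<eta> (\<phi> (g \<otimes> f) b) v)
          \<le> \<epsilon> / real l * real (d (\<phi> g b) (\<phi> (g \<otimes> f) b))"
        by (rule l1_le_mult_d[OF p adj V(1,3)])
      ultimately show ?thesis unfolding w_def by linarith
    qed
    \<comment> \<open>If \<open>w g v \<noteq> 0\<close> and \<open>h\<close> carries
      \<open>rep v\<close> to \<open>v\<close>, then \<open>k = inv h \<otimes> g\<close> moves
      \<open>b\<close> to within \<open>R\<close> of \<open>rep v\<close>. There are finitely many
      representatives, so one \<open>N\<close> bounds the distance from \<open>b\<close> to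
      \<open>\<phi> k (rep b)\<close> for all \<open>v\<close>, and every nonempty piece lies in a
      translate of \<open>ball_cosets b N\<close>.\<close>
    define N where "N = (\<Sum>r\<in>rep ` V. d b r) + R + d b (rep b)"
    have Nr: "d b r \<le> (\<Sum>r\<in>rep ` V. d b r)" if "r \<in> rep ` V" for r
      using member_le_sum[OF that, of "d b"] finite_rep[OF finV] by simp
    have 3: "unif_exact G (range (\<lambda>v. {g \<in> carrier G. w g v \<noteq> 0}))"
    proof (rule unif_exact_coarse[OF unif_exact_ball_cosets[OF fine finV co b, of N], where T = "{\<one>}"])
      fix U assume "U \<in> range (\<lambda>v. {g \<in> carrier G. w g v \<noteq> 0})"
      then obtain v where U: "U = {g \<in> carrier G. w g v \<noteq> 0}" by blast
      show "\<exists>h\<in>carrier G. \<exists>W\<in>{ball_cosets b N}. \<forall>g\<in>U. \<exists>w\<in>W. \<exists>t\<in>{\<one>}. g = h \<otimes> w \<otimes> t"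
      proof (cases "v \<in> V")
        case False
        have "U = {}" using su act_closed[OF _ b] False by (auto simp: U w_def)
        then show ?thesis by auto
      next
        case True
        obtain h where "h \<in> rep_coset v" using rep_coset_nonempty[OF True] by blast
        then have h: "h \<in> carrier G" "\<phi> h (rep v) = v" by (auto simp: rep_coset_def)
        show ?thesis
        proof (intro bexI[OF _ h(1)] bexI[of _ "ball_cosets b N"] ballI)
          fix g assume "g \<in> U"
          then have g: "g \<in> carrier G" "w g v \<noteq> 0" by (auto simp: U)
          define k where "k = inv h \<otimes> g"
          have k: "k \<in> carrier G" using g h by (simp add: k_def)
          have gk: "g = h \<otimes> k" using g h by (simp add: k_def mult_inv_cancel)
          have V: "rep v \<in> V" "rep b \<in> V" "\<phi> k b \<in> V" "\<phi> k (rep b) \<in> V"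
            using rep_in True b act_closed[OF k] by auto
          have "d (\<phi> g b) v \<le> R" using su[of "\<phi> g b" v] g(2) act_closed[OF g(1) b] by (simp add: w_def)
          moreover have "d (\<phi> g b) v = d (\<phi> k b) (rep v)"
            using d_act[OF h(1) V(3,1)] composition_rule[OF b h(1) k] h(2) by (simp add: gk)
          ultimately have "d (rep v) (\<phi> k b) \<le> R" using d_sym[OF V(1,3)] by simp
          moreover have "d b (\<phi> k (rep b)) \<le> d b (\<phi> k b) + d (\<phi> k b) (\<phi> k (rep b))"
            by (rule d_triangle[OF b V(3,4)])
          moreover have "d b (\<phi> k b) \<le> d b (rep v) + d (rep v) (\<phi> k b)" by (rule d_triangle[OF b V(1,3)])
          moreover have "d (\<phi> k b) (\<phi> k (rep b)) = d b (rep b)" by (rule d_act[OF k b V(2)])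
          moreover have "d b (rep v) \<le> (\<Sum>r\<in>rep ` V. d b r)" by (rule Nr) (use True in blast)
          ultimately have "d b (\<phi> k (rep b)) \<le> N" unfolding N_def by linarith
          moreover have "k \<in> rep_coset (\<phi> k (rep b))"
          proof -
            have "rep (rep b) = rep b"
              using rep_orbit[OF b] rep_act b by (auto simp: orbit_def)
            then show ?thesis using k by (simp add: rep_coset_def rep_act V)
          qed
          ultimately have "k \<in> ball_cosets b N" using V(4) unfolding ball_cosets_def by blast
          moreover have "g = h \<otimes> k \<otimes> \<one>" using gk h k by simp
          ultimately show "\<exists>w\<in>ball_cosets b N. \<exists>t\<in>{\<one>}. g = h \<otimes> w \<otimes> t" by blast
        qed simp
      qed
    qed (use ball_cosets_carrier in auto)
    show "\<exists>w :: 'a \<Rightarrow> 'v \<Rightarrow> real. (\<forall>g\<in>carrier G. fin_prob (w g)) \<and>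
        (\<forall>g\<in>carrier G. \<forall>f\<in>F. g \<otimes> f \<in> carrier G \<longrightarrow> l1 (\<lambda>i. w g i - w (g \<otimes> f) i) \<le> \<epsilon>) \<and>
        unif_exact G (range (\<lambda>i. {g \<in> carrier G. w g i \<noteq> 0}))"
      using 1 2 3 by (intro exI[of _ w] conjI ballI impI) simp_all
  qed
qed

end

theorem mainTheorem2:
  fixes \<Gamma> :: "('g, 'm) monoid_scheme"
    and V :: "'v set" and E :: "'v set set" and \<phi> :: "'g \<Rightarrow> 'v \<Rightarrow> 'v"
  assumes "connected_graph V E" and "countable V"
    and "fine_graph V E" and "hyperbolic_graph V E"
    and "graph_action \<Gamma> V E \<phi>" and "finite_quotient \<Gamma> V E \<phi>"
    and "\<And>x. x \<in> V \<Longrightarrow> exact_group (stabilizer_group \<Gamma> \<phi> x)"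
  shows "exact_group \<Gamma>"
proof -
  interpret graph_group_action \<Gamma> V E \<phi>
    using assms(1,5)
    by (simp add: graph_group_action_def connected_simple_graph_def graph_group_action_axioms_def
        graph_action_def)
  have "unif_exact \<Gamma> {stabilizer \<Gamma> \<phi> x}" if "x \<in> V" for x
    by (rule unif_exact_if_exact_subgroup[OF stabilizer_subgroup[OF that] assms(7)[OF that]])
  then have "unif_exact \<Gamma> {carrier \<Gamma>}"
    using assms(3,4,6) by (intro unif_exact_carrier) (auto simp: finite_quotient_def)
  then show ?thesis by (rule exact_group_if_unif_exact)
qed

end
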